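(* Let $\mathfrak{M}$ be a factor of type I or II on a Hilbert space $\mathcal{H}$ and let $\rho$ be a faithful normal semifinite trace on $\mathfrak{M}$. For $F\in L^2(\rho)$ set $$|||F|||_2=\sup\bigl\{\|WFW\|_1:\ W\in L^\infty(\rho)\cap L^2(\rho),\ W\ge0,\ \|W\|_2\le1,\ \|W\|_\infty\le1\bigr\}.$$ Then the map $|||\cdot|||_2$ is a norm on $L^2(\rho)$.
   Context: For $1\le p<\infty$, $L^p(\rho)$ is the noncommutative $L^p$-space: the completion of $\{X\in\mathfrak{M}:\rho(|X|^p)<\infty\}$ with respect to $\|X\|_p=\rho(|X|^p)^{1/p}$, where $|X|=(X^*X)^{1/2}$; its elements are identified with operators affiliated with $\mathfrak{M}$. $L^\infty(\rho)=\mathfrak{M}$ with $\|\cdot\|_\infty$ the operator norm. *)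

theory Defs
  imports "HOL-Analysis.Analysis"
begin

section \<open>Complex Hilbert spaces\<close>

text \<open>The complex inner product is conjugate-linear in its first argument. Norm, metric and
  completeness come from the underlying real Hilbert space, whose inner product is the real part
  of the complex one; hence \<open>norm x = sqrt (Re (cinner x x))\<close> and positive definiteness is inherited.\<close>

class complex_hilbert_space = real_inner + complete_space +
  fixes scaleC :: "complex \<Rightarrow> 'a \<Rightarrow> 'a"  (infixr "*\<^sub>C" 75)
    and cinner :: "'a \<Rightarrow> 'a \<Rightarrow> complex"
  assumes scaleC_add_right: "a *\<^sub>C (x + y) = a *\<^sub>C x + a *\<^sub>C y"
    and scaleC_add_left: "(a + b) *\<^sub>C x = a *\<^sub>C x + b *\<^sub>C x"
    and scaleC_scaleC: "a *\<^sub>C (b *\<^sub>C x) = (a * b) *\<^sub>C x"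
    and scaleC_of_real: "complex_of_real r *\<^sub>C x = r *\<^sub>R x"
    and cinner_commute: "cinner x y = cnj (cinner y x)"
    and cinner_add_right: "cinner x (y + z) = cinner x y + cinner x z"
    and cinner_scaleC_right: "cinner x (c *\<^sub>C y) = c * cinner x y"
    and inner_eq_Re_cinner: "inner x y = Re (cinner x y)"


section \<open>Bounded operators\<close>

text \<open>Bounded operators are the bounded real-linear maps that commute with complex scalars;
  the norm of the library type is then the operator norm, and \<open>o\<^sub>L\<close> is the product.\<close>

definition bounded_ops :: "('a::complex_hilbert_space \<Rightarrow>\<^sub>L 'a) set" where
  "bounded_ops = {T. \<forall>c x. blinfun_apply T (c *\<^sub>C x) = c *\<^sub>C blinfun_apply T x}"

lemma norm_scaleC: "norm (c *\<^sub>C x) = cmod c * norm (x :: 'a::complex_hilbert_space)"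
proof -
  have conj: "cinner (c *\<^sub>C x) y = cnj c * cinner x y" for y :: 'a
    by (metis cinner_commute cinner_scaleC_right complex_cnj_cnj complex_cnj_mult)
  have "(norm (c *\<^sub>C x))\<^sup>2 = Re (cnj c * c * cinner x x)"
    by (simp add: power2_norm_eq_inner inner_eq_Re_cinner cinner_scaleC_right conj mult_ac)
  also have "cnj c * c = complex_of_real ((cmod c)\<^sup>2)"
    by (simp only: complex_norm_square mult.commute)
  also have "Re (complex_of_real ((cmod c)\<^sup>2) * cinner x x) = (cmod c)\<^sup>2 * (norm x)\<^sup>2"
    unfolding power2_norm_eq_inner[of x] inner_eq_Re_cinner by (simp del: of_real_power)
  finally show ?thesis
    by (metis norm_ge_zero power2_eq_iff_nonneg power_mult_distrib zero_le_mult_iff)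
qed

definition scaleC_op :: "complex \<Rightarrow> ('a::complex_hilbert_space \<Rightarrow>\<^sub>L 'a) \<Rightarrow> ('a \<Rightarrow>\<^sub>L 'a)" where
  "scaleC_op c T = Blinfun (\<lambda>x. c *\<^sub>C blinfun_apply T x)"

lemma scaleC_op_apply: "blinfun_apply (scaleC_op c T) x = c *\<^sub>C blinfun_apply T x"
proof -
  have "bounded_linear (\<lambda>y::'a. c *\<^sub>C y)"
  proof (rule bounded_linear_intro[where K = "cmod c"])
    show "c *\<^sub>C (r *\<^sub>R y) = r *\<^sub>R (c *\<^sub>C y)" for r and y :: 'a
      by (simp add: scaleC_scaleC mult.commute flip: scaleC_of_real)
  qed (simp_all add: scaleC_add_right norm_scaleC)
  then have "bounded_linear (\<lambda>x. c *\<^sub>C blinfun_apply T x)"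
    by (rule bounded_linear_compose[OF _ blinfun.bounded_linear_right])
  then show ?thesis
    unfolding scaleC_op_def by (simp add: bounded_linear_Blinfun_apply)
qed

definition adj :: "('a::complex_hilbert_space \<Rightarrow>\<^sub>L 'a) \<Rightarrow> ('a \<Rightarrow>\<^sub>L 'a)" where
  "adj T = (THE S. \<forall>x y. cinner (blinfun_apply S x) y = cinner x (blinfun_apply T y))"

definition positive_op :: "('a::complex_hilbert_space \<Rightarrow>\<^sub>L 'a) \<Rightarrow> bool" where
  "positive_op T \<longleftrightarrow> T \<in> bounded_ops \<and> (\<forall>x. cinner x (blinfun_apply T x) \<in> \<real>\<^sub>\<ge>\<^sub>0)"

definition op_le :: "('a::complex_hilbert_space \<Rightarrow>\<^sub>L 'a) \<Rightarrow> ('a \<Rightarrow>\<^sub>L 'a) \<Rightarrow> bool" where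
  "op_le S T \<longleftrightarrow> positive_op (T - S)"

definition sqrt_op :: "('a::complex_hilbert_space \<Rightarrow>\<^sub>L 'a) \<Rightarrow> ('a \<Rightarrow>\<^sub>L 'a)" where
  "sqrt_op T = (THE S. positive_op S \<and> S o\<^sub>L S = T)"

definition abs_op :: "('a::complex_hilbert_space \<Rightarrow>\<^sub>L 'a) \<Rightarrow> ('a \<Rightarrow>\<^sub>L 'a)" where
  "abs_op X = sqrt_op (adj X o\<^sub>L X)"

primrec power_op :: "('a::complex_hilbert_space \<Rightarrow>\<^sub>L 'a) \<Rightarrow> nat \<Rightarrow> ('a \<Rightarrow>\<^sub>L 'a)" where
  "power_op T 0 = id_blinfun"
| "power_op T (Suc n) = T o\<^sub>L power_op T n"


section \<open>Von Neumann algebras, factors and types\<close>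

definition commutant :: "('a::complex_hilbert_space \<Rightarrow>\<^sub>L 'a) set \<Rightarrow> ('a \<Rightarrow>\<^sub>L 'a) set" where
  "commutant M = {T \<in> bounded_ops. \<forall>S\<in>M. T o\<^sub>L S = S o\<^sub>L T}"

definition von_neumann_algebra :: "('a::complex_hilbert_space \<Rightarrow>\<^sub>L 'a) set \<Rightarrow> bool" where
  "von_neumann_algebra M \<longleftrightarrow>
     M \<subseteq> bounded_ops \<and> (\<forall>T\<in>M. adj T \<in> M) \<and> commutant (commutant M) = M"

definition center :: "('a::complex_hilbert_space \<Rightarrow>\<^sub>L 'a) set \<Rightarrow> ('a \<Rightarrow>\<^sub>L 'a) set" where
  "center M = M \<inter> commutant M"

definition factor :: "('a::complex_hilbert_space \<Rightarrow>\<^sub>L 'a) set \<Rightarrow> bool" where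
  "factor M \<longleftrightarrow> von_neumann_algebra M \<and> center M = range (\<lambda>c. scaleC_op c id_blinfun)"

definition projections :: "('a::complex_hilbert_space \<Rightarrow>\<^sub>L 'a) set \<Rightarrow> ('a \<Rightarrow>\<^sub>L 'a) set" where
  "projections M = {E \<in> M. E o\<^sub>L E = E \<and> adj E = E}"

definition mvn_equiv ::
    "('a::complex_hilbert_space \<Rightarrow>\<^sub>L 'a) set \<Rightarrow> ('a \<Rightarrow>\<^sub>L 'a) \<Rightarrow> ('a \<Rightarrow>\<^sub>L 'a) \<Rightarrow> bool" where
  "mvn_equiv M E F \<longleftrightarrow> (\<exists>V\<in>M. adj V o\<^sub>L V = E \<and> V o\<^sub>L adj V = F)"

definition finite_projection ::
    "('a::complex_hilbert_space \<Rightarrow>\<^sub>L 'a) set \<Rightarrow> ('a \<Rightarrow>\<^sub>L 'a) \<Rightarrow> bool" where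
  "finite_projection M E \<longleftrightarrow>
     E \<in> projections M \<and> (\<forall>F\<in>projections M. op_le F E \<and> mvn_equiv M E F \<longrightarrow> F = E)"

definition abelian_projection ::
    "('a::complex_hilbert_space \<Rightarrow>\<^sub>L 'a) set \<Rightarrow> ('a \<Rightarrow>\<^sub>L 'a) \<Rightarrow> bool" where
  "abelian_projection M E \<longleftrightarrow>
     E \<in> projections M \<and>
     (\<forall>X\<in>M. \<forall>Y\<in>M. (E o\<^sub>L X o\<^sub>L E) o\<^sub>L (E o\<^sub>L Y o\<^sub>L E) = (E o\<^sub>L Y o\<^sub>L E) o\<^sub>L (E o\<^sub>L X o\<^sub>L E))"

definition type_I :: "('a::complex_hilbert_space \<Rightarrow>\<^sub>L 'a) set \<Rightarrow> bool" where
  "type_I M \<longleftrightarrow>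
     (\<forall>Z\<in>projections (center M). Z \<noteq> 0 \<longrightarrow> (\<exists>E. abelian_projection M E \<and> E \<noteq> 0 \<and> op_le E Z))"

definition type_II :: "('a::complex_hilbert_space \<Rightarrow>\<^sub>L 'a) set \<Rightarrow> bool" where
  "type_II M \<longleftrightarrow>
     (\<forall>E. abelian_projection M E \<longrightarrow> E = 0) \<and>
     (\<forall>Z\<in>projections (center M). Z \<noteq> 0 \<longrightarrow> (\<exists>E. finite_projection M E \<and> E \<noteq> 0 \<and> op_le E Z))"


section \<open>Traces\<close>

text \<open>A trace is a weight on the positive cone of \<open>M\<close>; only its values there matter. Note that
  \<open>0 * \<infinity> = 0\<close> in \<^typ>\<open>ennreal\<close>.\<close>

definition pos_cone :: "('a::complex_hilbert_space \<Rightarrow>\<^sub>L 'a) set \<Rightarrow> ('a \<Rightarrow>\<^sub>L 'a) set" where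
  "pos_cone M = {X \<in> M. positive_op X}"

definition is_trace ::
    "('a::complex_hilbert_space \<Rightarrow>\<^sub>L 'a) set \<Rightarrow> (('a \<Rightarrow>\<^sub>L 'a) \<Rightarrow> ennreal) \<Rightarrow> bool" where
  "is_trace M \<rho> \<longleftrightarrow>
     (\<forall>X\<in>pos_cone M. \<forall>Y\<in>pos_cone M. \<rho> (X + Y) = \<rho> X + \<rho> Y) \<and>
     (\<forall>X\<in>pos_cone M. \<forall>r\<ge>0. \<rho> (r *\<^sub>R X) = ennreal r * \<rho> X) \<and>
     (\<forall>X\<in>M. \<rho> (adj X o\<^sub>L X) = \<rho> (X o\<^sub>L adj X))"

definition faithful ::
    "('a::complex_hilbert_space \<Rightarrow>\<^sub>L 'a) set \<Rightarrow> (('a \<Rightarrow>\<^sub>L 'a) \<Rightarrow> ennreal) \<Rightarrow> bool" where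
  "faithful M \<rho> \<longleftrightarrow> (\<forall>X\<in>pos_cone M. \<rho> X = 0 \<longrightarrow> X = 0)"

text \<open>Normality is stated for upward directed sets, which is equivalent to bounded increasing nets;
  boundedness is implied by the existence of the least upper bound \<open>S\<close>.\<close>

definition normal ::
    "('a::complex_hilbert_space \<Rightarrow>\<^sub>L 'a) set \<Rightarrow> (('a \<Rightarrow>\<^sub>L 'a) \<Rightarrow> ennreal) \<Rightarrow> bool" where
  "normal M \<rho> \<longleftrightarrow>
     (\<forall>D S. D \<noteq> {} \<and> D \<subseteq> pos_cone M \<and>
        (\<forall>X\<in>D. \<forall>Y\<in>D. \<exists>Z\<in>D. op_le X Z \<and> op_le Y Z) \<and>
        S \<in> pos_cone M \<and> (\<forall>X\<in>D. op_le X S) \<and>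
        (\<forall>T\<in>pos_cone M. (\<forall>X\<in>D. op_le X T) \<longrightarrow> op_le S T)
        \<longrightarrow> \<rho> S = (SUP X\<in>D. \<rho> X))"

definition semifinite ::
    "('a::complex_hilbert_space \<Rightarrow>\<^sub>L 'a) set \<Rightarrow> (('a \<Rightarrow>\<^sub>L 'a) \<Rightarrow> ennreal) \<Rightarrow> bool" where
  "semifinite M \<rho> \<longleftrightarrow>
     (\<forall>X\<in>pos_cone M. X \<noteq> 0 \<longrightarrow> (\<exists>Y\<in>pos_cone M. Y \<noteq> 0 \<and> op_le Y X \<and> \<rho> Y < \<infinity>))"


section \<open>Noncommutative \<open>L\<^sup>p\<close> spaces\<close>

text \<open>The exponent is a natural number \<open>p \<ge> 1\<close> (only \<open>p = 1\<close> and \<open>p = 2\<close> are used), so that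
  \<open>|X|\<^sup>p\<close> is an ordinary operator power. \<open>Lp_bdd M \<rho> p\<close> is the space to be completed; it is also
  the intersection of \<open>L\<^sup>\<infinity>(\<rho>) = M\<close> with \<open>L\<^sup>p(\<rho>)\<close>.\<close>

definition Lp_bdd ::
    "('a::complex_hilbert_space \<Rightarrow>\<^sub>L 'a) set \<Rightarrow> (('a \<Rightarrow>\<^sub>L 'a) \<Rightarrow> ennreal) \<Rightarrow> nat \<Rightarrow> ('a \<Rightarrow>\<^sub>L 'a) set" where
  "Lp_bdd M \<rho> p = {X \<in> M. \<rho> (power_op (abs_op X) p) < \<infinity>}"

definition pnorm ::
    "(('a::complex_hilbert_space \<Rightarrow>\<^sub>L 'a) \<Rightarrow> ennreal) \<Rightarrow> nat \<Rightarrow> ('a \<Rightarrow>\<^sub>L 'a) \<Rightarrow> real" where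
  "pnorm \<rho> p X = root p (enn2real (\<rho> (power_op (abs_op X) p)))"

text \<open>The completion consists of the Cauchy sequences modulo the null sequences.\<close>

definition Lp_Cauchy ::
    "('a::complex_hilbert_space \<Rightarrow>\<^sub>L 'a) set \<Rightarrow> (('a \<Rightarrow>\<^sub>L 'a) \<Rightarrow> ennreal) \<Rightarrow> nat
      \<Rightarrow> (nat \<Rightarrow> 'a \<Rightarrow>\<^sub>L 'a) set" where
  "Lp_Cauchy M \<rho> p =
     {X. (\<forall>n. X n \<in> Lp_bdd M \<rho> p) \<and> (\<forall>e>0. \<exists>N. \<forall>m\<ge>N. \<forall>n\<ge>N. pnorm \<rho> p (X m - X n) < e)}"

definition Lp_rel ::
    "('a::complex_hilbert_space \<Rightarrow>\<^sub>L 'a) set \<Rightarrow> (('a \<Rightarrow>\<^sub>L 'a) \<Rightarrow> ennreal) \<Rightarrow> nat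
      \<Rightarrow> (nat \<Rightarrow> 'a \<Rightarrow>\<^sub>L 'a) rel" where
  "Lp_rel M \<rho> p =
     {(X, Y). X \<in> Lp_Cauchy M \<rho> p \<and> Y \<in> Lp_Cauchy M \<rho> p \<and> (\<lambda>n. pnorm \<rho> p (X n - Y n)) \<longlonglongrightarrow> 0}"

definition Lp ::
    "('a::complex_hilbert_space \<Rightarrow>\<^sub>L 'a) set \<Rightarrow> (('a \<Rightarrow>\<^sub>L 'a) \<Rightarrow> ennreal) \<Rightarrow> nat
      \<Rightarrow> (nat \<Rightarrow> 'a \<Rightarrow>\<^sub>L 'a) set set" where
  "Lp M \<rho> p = Lp_Cauchy M \<rho> p // Lp_rel M \<rho> p"

definition Lp_norm ::
    "(('a::complex_hilbert_space \<Rightarrow>\<^sub>L 'a) \<Rightarrow> ennreal) \<Rightarrow> nat \<Rightarrow> (nat \<Rightarrow> 'a \<Rightarrow>\<^sub>L 'a) set \<Rightarrow> real" where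
  "Lp_norm \<rho> p F = (THE r. \<forall>X\<in>F. (\<lambda>n. pnorm \<rho> p (X n)) \<longlonglongrightarrow> r)"

definition Lp_zero ::
    "('a::complex_hilbert_space \<Rightarrow>\<^sub>L 'a) set \<Rightarrow> (('a \<Rightarrow>\<^sub>L 'a) \<Rightarrow> ennreal) \<Rightarrow> nat
      \<Rightarrow> (nat \<Rightarrow> 'a \<Rightarrow>\<^sub>L 'a) set" where
  "Lp_zero M \<rho> p = Lp_rel M \<rho> p `` {\<lambda>_. 0}"

definition Lp_add ::
    "('a::complex_hilbert_space \<Rightarrow>\<^sub>L 'a) set \<Rightarrow> (('a \<Rightarrow>\<^sub>L 'a) \<Rightarrow> ennreal) \<Rightarrow> nat
      \<Rightarrow> (nat \<Rightarrow> 'a \<Rightarrow>\<^sub>L 'a) set \<Rightarrow> (nat \<Rightarrow> 'a \<Rightarrow>\<^sub>L 'a) set \<Rightarrow> (nat \<Rightarrow> 'a \<Rightarrow>\<^sub>L 'a) set" where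
  "Lp_add M \<rho> p F G = Lp_rel M \<rho> p `` {\<lambda>n. X n + Y n | X Y. X \<in> F \<and> Y \<in> G}"

definition Lp_scale ::
    "('a::complex_hilbert_space \<Rightarrow>\<^sub>L 'a) set \<Rightarrow> (('a \<Rightarrow>\<^sub>L 'a) \<Rightarrow> ennreal) \<Rightarrow> nat
      \<Rightarrow> complex \<Rightarrow> (nat \<Rightarrow> 'a \<Rightarrow>\<^sub>L 'a) set \<Rightarrow> (nat \<Rightarrow> 'a \<Rightarrow>\<^sub>L 'a) set" where
  "Lp_scale M \<rho> p c F = Lp_rel M \<rho> p `` {\<lambda>n. scaleC_op c (X n) | X. X \<in> F}"

text \<open>For \<open>F \<in> L\<^sup>2(\<rho>)\<close> and \<open>W \<in> L\<^sup>\<infinity>(\<rho>) \<inter> L\<^sup>2(\<rho>)\<close>, the product \<open>W F W\<close> is an element of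
  \<open>L\<^sup>1(\<rho>)\<close>, defined by continuous extension: if \<open>F\<close> is the
  limit of \<open>X n\<close> in \<open>L\<^sup>2(\<rho>)\<close>, then \<open>W F W\<close> is the limit of \<open>W X n W\<close> in \<open>L\<^sup>1(\<rho>)\<close>.\<close>

definition sandwich ::
    "('a::complex_hilbert_space \<Rightarrow>\<^sub>L 'a) set \<Rightarrow> (('a \<Rightarrow>\<^sub>L 'a) \<Rightarrow> ennreal)
      \<Rightarrow> ('a \<Rightarrow>\<^sub>L 'a) \<Rightarrow> (nat \<Rightarrow> 'a \<Rightarrow>\<^sub>L 'a) set \<Rightarrow> (nat \<Rightarrow> 'a \<Rightarrow>\<^sub>L 'a) set" where
  "sandwich M \<rho> W F = Lp_rel M \<rho> 1 `` {\<lambda>n. W o\<^sub>L X n o\<^sub>L W | X. X \<in> F}"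

text \<open>The supremum is taken in \<open>[0,\<infinity>]\<close>, so that its finiteness is a genuine claim.\<close>

definition triple_norm ::
    "('a::complex_hilbert_space \<Rightarrow>\<^sub>L 'a) set \<Rightarrow> (('a \<Rightarrow>\<^sub>L 'a) \<Rightarrow> ennreal)
      \<Rightarrow> (nat \<Rightarrow> 'a \<Rightarrow>\<^sub>L 'a) set \<Rightarrow> ennreal" where
  "triple_norm M \<rho> F =
     (SUP W\<in>{W \<in> Lp_bdd M \<rho> 2. positive_op W \<and> pnorm \<rho> 2 W \<le> 1 \<and> norm W \<le> 1}.
        ennreal (Lp_norm \<rho> 1 (sandwich M \<rho> W F)))"

definition is_norm_on ::
    "'v set \<Rightarrow> ('v \<Rightarrow> 'v \<Rightarrow> 'v) \<Rightarrow> (complex \<Rightarrow> 'v \<Rightarrow> 'v) \<Rightarrow> 'v \<Rightarrow> ('v \<Rightarrow> real) \<Rightarrow> bool" where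
  "is_norm_on V pls scl zer N \<longleftrightarrow>
     (\<forall>F\<in>V. 0 \<le> N F \<and> (N F = 0 \<longleftrightarrow> F = zer)) \<and>
     (\<forall>c. \<forall>F\<in>V. N (scl c F) = cmod c * N F) \<and>
     (\<forall>F\<in>V. \<forall>G\<in>V. N (pls F G) \<le> N F + N G)"

end

theory Submission
  imports Defs
begin

text \<open>The supremum \<open>|||F|||\<close> is taken over the functions \<open>F \<mapsto> \<parallel>WFW\<parallel>\<^sub>1\<close>. Each of them is a seminorm
  bounded by \<open>\<parallel>F\<parallel>\<^sub>2\<close>, by the triangle and Hoelder inequalities for the trace norm, so \<open>|||F|||\<close> is a
  finite seminorm. The other point is that it vanishes only at \<open>0\<close>.

  \<^bold>\<open>The trace norm.\<close> Say that positive operators \<open>(P, Q)\<close> dominate \<open>X\<close> if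
  \<open>2 Re \<langle>x, X y\<rangle> \<le> \<langle>x, P x\<rangle> + \<langle>y, Q y\<rangle>\<close> for all \<open>x, y\<close>, that is, if the block operator with rows
  \<open>(P, -X)\<close> and \<open>(-X\<^sup>*, Q)\<close> is positive. Then \<open>\<rho> |X|\<close> is the minimum of
  \<open>(\<rho> P + \<rho> Q) / 2\<close> over all dominating pairs in the algebra (\<open>rho_abs_le\<close>); it is attained at
  \<open>(|X\<^sup>*|, |X|)\<close> (\<open>dominates_abs\<close>, \<open>rho_abs_adj_le\<close>). Since domination is additive, this gives the
  triangle inequality for \<open>\<rho> |X|\<close>. The pair \<open>(A\<^sup>* A, B\<^sup>* B)\<close> dominates \<open>A\<^sup>* B\<close> and gives
  \<open>\<parallel>A\<^sup>* B\<parallel>\<^sub>1 \<le> \<parallel>A\<parallel>\<^sub>2 \<parallel>B\<parallel>\<^sub>2\<close>, hence \<open>\<parallel>WFW\<parallel>\<^sub>1 \<le> \<parallel>F\<parallel>\<^sub>2\<close>. Conjugating the domination of \<open>X\<close> by a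
  contraction replaces the duality of \<open>L\<^sup>1\<close> and \<open>L\<^sup>\<infinity>\<close>: it yields
  \<open>\<parallel>Y\<parallel>\<^sub>2\<^sup>2 \<le> \<parallel>Y - A\<parallel>\<^sub>2\<^sup>2 + 2 \<parallel>Y\<parallel>\<^sub>\<infinity> \<parallel>A\<parallel>\<^sub>1\<close> (\<open>rho_square_le\<close>).

  \<^bold>\<open>Cutoffs instead of spectral theory.\<close> For \<open>0 \<le> T \<le> 1\<close> the operators
  \<open>E\<^sub>n = 1 - (1 - T)\<^sup>n\<close> increase to the support projection of \<open>T\<close>, and \<open>E\<^sub>n = T p\<^sub>n\<close> with the
  geometric sum \<open>p\<^sub>n = \<Sum>\<^bsub>k<n\<^esub> (1 - T)\<^sup>k\<close>. As the \<open>T (1 - T)\<^sup>k\<close> decrease in \<open>k\<close> and add up to at most \<open>1\<close>,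
  \<open>n T (1 - T)\<^sup>n \<le> 1\<close>; so \<open>T E\<^sub>n\<close> increases to \<open>T\<close>, and normality gives \<open>\<rho> (T E\<^sub>n) \<rightarrow> \<rho> T\<close>
  (\<open>cutoff_convergence\<close>). Thus \<open>X p\<^sub>n\<close>, formed with \<open>T = |X|\<close>, serves as an approximate polar part
  of \<open>X\<close>, and \<open>E\<^sub>n\<close> as an approximate support projection, of finite trace if \<open>\<rho> T < \<infinity>\<close>.

  \<^bold>\<open>Definiteness.\<close> Let \<open>X\<^sub>n\<close> represent \<open>F\<close> and let \<open>\<parallel>W X\<^sub>n W\<parallel>\<^sub>1 \<rightarrow> 0\<close> for all admissible \<open>W\<close>. Fix a
  large \<open>m\<close>. A cutoff \<open>W\<close> of a multiple of \<open>X\<^sub>m\<^sup>* X\<^sub>m + X\<^sub>m X\<^sub>m\<^sup>*\<close> makes \<open>\<parallel>X\<^sub>m - W X\<^sub>m W\<parallel>\<^sub>2\<close> small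
  (\<open>sandwich_approximation\<close>), so \<open>\<parallel>X\<^sub>m - W X\<^sub>n W\<parallel>\<^sub>2\<close> is small for every large \<open>n\<close>. The inequality above
  with \<open>Y = X\<^sub>m\<close> and \<open>A = W X\<^sub>n W\<close> and \<open>n \<rightarrow> \<infinity>\<close> bounds \<open>\<parallel>X\<^sub>m\<parallel>\<^sub>2\<close> by that small number
  (\<open>L2_null_sequence\<close>), so \<open>F = 0\<close>.\<close>

section \<open>Self-adjoint operators on a real Hilbert space\<close>

text \<open>The representing vector minimizes \<open>\<parallel>x\<parallel>\<^sup>2 - 2 f x\<close>: by the parallelogram law minimizing
  sequences are Cauchy, and the derivative at a minimum vanishes in every direction.\<close>

lemma riesz_representation:
  fixes f :: "'a::{real_inner,banach} \<Rightarrow> real"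
  assumes "bounded_linear f"
  obtains v where "\<And>x. f x = inner v x"
proof -
  interpret bounded_linear f by fact
  obtain K where K: "\<And>x. norm (f x) \<le> norm x * K"
    using bounded by blast
  define q where "q x = (norm x)\<^sup>2 - 2 * f x" for x
  have q_ge: "- K\<^sup>2 \<le> q x" for x
  proof -
    have "f x \<le> norm x * K" using K[of x] by simp
    moreover have "0 \<le> (norm x - K)\<^sup>2" by simp
    ultimately show ?thesis unfolding q_def by (simp add: power2_diff)
  qed
  define I where "I = Inf (range q)"
  have bdd: "bdd_below (range q)" using q_ge by (auto intro!: bdd_belowI)
  have I_le: "I \<le> q x" for x unfolding I_def using bdd by (auto intro: cInf_lower)
  have "\<exists>x. q x < I + inverse (real (Suc n))" for n
  proof -
    have "\<exists>y\<in>range q. y < I + inverse (real (Suc n))"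
      unfolding I_def using bdd by (subst cInf_less_iff[symmetric]) auto
    then show ?thesis by auto
  qed
  then obtain x where x: "\<And>n. q (x n) < I + inverse (real (Suc n))" by metis
  \<comment> \<open>The parallelogram law, with the midpoint bounded below by the infimum.\<close>
  have par: "(norm (y - z))\<^sup>2 \<le> 2 * (q y + q z - 2 * I)" for y z
  proof -
    have "2 * (q y + q z - 2 * q ((1/2) *\<^sub>R (y + z))) = (norm (y - z))\<^sup>2"
      unfolding q_def
      by (simp add: power2_norm_eq_inner inner_add inner_diff scaleR add inner_commute algebra_simps)
    then show ?thesis using I_le[of "(1/2) *\<^sub>R (y + z)"] by simp
  qed
  have "Cauchy x"
  proof (rule CauchyI)
    fix e :: real assume e: "0 < e"
    obtain N where N: "inverse (real (Suc N)) < e\<^sup>2 / 4"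
      using reals_Archimedean[of "e\<^sup>2 / 4"] e by auto
    have "norm (x m - x n) < e" if "m \<ge> N" "n \<ge> N" for m n
    proof -
      have "inverse (real (Suc m)) \<le> inverse (real (Suc N))"
           "inverse (real (Suc n)) \<le> inverse (real (Suc N))"
        using that by (auto intro!: le_imp_inverse_le)
      then have "(norm (x m - x n))\<^sup>2 < e\<^sup>2"
        using par[of "x m" "x n"] x[of m] x[of n] N by argo
      then show ?thesis using e by (simp add: power2_less_imp_less)
    qed
    then show "\<exists>N. \<forall>m\<ge>N. \<forall>n\<ge>N. norm (x m - x n) < e" by blast
  qed
  then obtain v where v: "x \<longlonglongrightarrow> v" using Cauchy_convergent_iff convergent_def by blast
  have "(\<lambda>n. q (x n)) \<longlonglongrightarrow> q v"
    unfolding q_def by (intro tendsto_intros v tendsto)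
  moreover have "(\<lambda>n. I + inverse (real (Suc n))) \<longlonglongrightarrow> I + 0"
    by (intro tendsto_intros LIMSEQ_inverse_real_of_nat)
  ultimately have "q v \<le> I"
    using x by (intro LIMSEQ_le[where X = "\<lambda>n. q (x n)"]) (auto intro: less_imp_le)
  then have min: "q v \<le> q y" for y using I_le order_trans by blast
  have "f y = inner v y" for y
  proof (cases "y = 0")
    case False
    define d where "d = inner v y - f y"
    \<comment> \<open>This multiple of \<open>y\<close> minimizes \<open>q\<close> on the line through \<open>v\<close> in direction \<open>y\<close>.\<close>
    have "0 \<le> q (v + (- d / (norm y)\<^sup>2) *\<^sub>R y) - q v" using min by simp
    also have "\<dots> = - (d\<^sup>2 / (norm y)\<^sup>2)"
      unfolding q_def power2_norm_eq_inner
      using False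
      by (simp add: inner_add scaleR add inner_commute field_simps power2_eq_square d_def)
    finally have "d\<^sup>2 / (norm y)\<^sup>2 \<le> 0" by simp
    then have "d = 0" using False by (simp add: divide_le_0_iff)
    then show ?thesis by (simp add: d_def)
  qed (simp add: zero)
  then show thesis using that by blast
qed

text \<open>Self-adjointness and positivity are phrased with the real inner product. For operators that
  commute with complex scalars these are the usual notions (\<open>positive_op_iff\<close>), and complex numbers
  then hardly occur any more.\<close>

definition self_adjoint :: "('a::real_inner \<Rightarrow>\<^sub>L 'a) \<Rightarrow> bool" where
  "self_adjoint T \<longleftrightarrow> (\<forall>x y. inner (T x) y = inner x (T y))"

definition nonneg_op :: "('a::real_inner \<Rightarrow>\<^sub>L 'a) \<Rightarrow> bool" where
  "nonneg_op T \<longleftrightarrow> self_adjoint T \<and> (\<forall>x. 0 \<le> inner x (T x))"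

lemma compose_assoc: "(A o\<^sub>L B) o\<^sub>L C = A o\<^sub>L (B o\<^sub>L C)"
  by (rule blinfun_eqI) simp

lemmas compose_algebra =
  bounded_bilinear.add_left[OF bounded_bilinear_blinfun_compose]
  bounded_bilinear.add_right[OF bounded_bilinear_blinfun_compose]
  bounded_bilinear.diff_left[OF bounded_bilinear_blinfun_compose]
  bounded_bilinear.diff_right[OF bounded_bilinear_blinfun_compose]
  bounded_bilinear.scaleR_left[OF bounded_bilinear_blinfun_compose]
  bounded_bilinear.scaleR_right[OF bounded_bilinear_blinfun_compose]

lemma compose_id [simp]: "id_blinfun o\<^sub>L T = T" "T o\<^sub>L id_blinfun = T"
  by (auto intro: blinfun_eqI)

lemma nonneg_opD: "nonneg_op T \<Longrightarrow> 0 \<le> inner x (T x)" "nonneg_op T \<Longrightarrow> self_adjoint T"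
  by (auto simp: nonneg_op_def)

lemma self_adjointD: "self_adjoint T \<Longrightarrow> inner (T x) y = inner x (T y)"
  by (auto simp: self_adjoint_def)

lemma self_adjoint_intros:
  shows "self_adjoint 0" "self_adjoint id_blinfun"
    "self_adjoint A \<Longrightarrow> self_adjoint B \<Longrightarrow> self_adjoint (A + B)"
    "self_adjoint A \<Longrightarrow> self_adjoint B \<Longrightarrow> self_adjoint (A - B)"
    "self_adjoint A \<Longrightarrow> self_adjoint (r *\<^sub>R A)"
    "self_adjoint A \<Longrightarrow> self_adjoint B \<Longrightarrow> A o\<^sub>L B = B o\<^sub>L A \<Longrightarrow> self_adjoint (A o\<^sub>L B)"
    "self_adjoint A \<Longrightarrow> self_adjoint B \<Longrightarrow> self_adjoint (A o\<^sub>L B o\<^sub>L A)"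
       apply (auto simp: self_adjoint_def blinfun.bilinear_simps inner_add inner_diff)
  by (metis blinfun_apply_blinfun_compose)

lemma nonneg_op_intros:
  shows "nonneg_op 0" "nonneg_op id_blinfun"
    "nonneg_op A \<Longrightarrow> nonneg_op B \<Longrightarrow> nonneg_op (A + B)"
    "nonneg_op A \<Longrightarrow> 0 \<le> r \<Longrightarrow> nonneg_op (r *\<^sub>R A)"
    "self_adjoint A \<Longrightarrow> nonneg_op B \<Longrightarrow> nonneg_op (A o\<^sub>L B o\<^sub>L A)"
    "self_adjoint A \<Longrightarrow> nonneg_op (A o\<^sub>L A)"
proof -
  show "self_adjoint A \<Longrightarrow> nonneg_op (A o\<^sub>L A)"
    by (auto simp: nonneg_op_def self_adjoint_intros) (metis inner_ge_zero self_adjointD)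
  show "self_adjoint A \<Longrightarrow> nonneg_op B \<Longrightarrow> nonneg_op (A o\<^sub>L B o\<^sub>L A)"
    by (auto simp: nonneg_op_def self_adjoint_intros) (metis self_adjointD)
qed (auto simp: nonneg_op_def self_adjoint_def blinfun.bilinear_simps inner_add inner_diff)

lemma norm_le_1_if_contractive:
  assumes "\<And>x. (norm (blinfun_apply A x))\<^sup>2 \<le> (norm x)\<^sup>2"
  shows "norm A \<le> 1"
  by (rule norm_blinfun_bound) (use assms in \<open>auto simp: power2_le_iff_abs_le\<close>)

lemma norm_apply_le:
  assumes "norm A \<le> 1" shows "norm (blinfun_apply A x) \<le> norm x"
  using norm_blinfun[of A x] mult_right_mono[OF assms norm_ge_zero[of x]] by simp

text \<open>The inequality \<open>A\<^sup>2 \<le> A\<close> for \<open>0 \<le> A \<le> 1\<close>, written as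
  \<open>A - A\<^sup>2 = (1 - A) A (1 - A) + A (1 - A) A\<close>.\<close>

lemma norm_square_le_form:
  assumes "nonneg_op A" "nonneg_op (id_blinfun - A)"
  shows "(norm (A x))\<^sup>2 \<le> inner x (A x)"
proof -
  have sa: "inner (A y) z = inner y (A z)" for y z
    using assms by (simp add: nonneg_opD self_adjointD)
  have "0 \<le> inner (x - A x) (A (x - A x)) + inner (A x) ((id_blinfun - A) (A x))"
    using assms by (intro add_nonneg_nonneg nonneg_opD)
  also have "\<dots> = inner x (A x) - (norm (A x))\<^sup>2"
    by (simp add: power2_norm_eq_inner blinfun.bilinear_simps inner_diff inner_add sa)
  finally show ?thesis by simp
qed

lemma norm_le_1_if_between_0_id:
  assumes "nonneg_op A" "nonneg_op (id_blinfun - A)"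
  shows "norm A \<le> 1"
proof (rule norm_le_1_if_contractive)
  fix x
  have "0 \<le> inner x ((id_blinfun - A) x)" using assms nonneg_opD by blast
  then have "inner x (A x) \<le> (norm x)\<^sup>2"
    by (simp add: power2_norm_eq_inner blinfun.bilinear_simps inner_diff)
  then show "(norm (A x))\<^sup>2 \<le> (norm x)\<^sup>2"
    using norm_square_le_form[OF assms, of x] by (rule order_trans[rotated])
qed

lemma nonneg_id_minus:
  assumes "self_adjoint A" "norm A \<le> 1"
  shows "nonneg_op (id_blinfun - A)"
proof -
  have "inner x (A x) \<le> inner x x" for x
  proof -
    have "inner x (A x) \<le> norm x * norm (A x)" by (rule norm_cauchy_schwarz)
    also have "\<dots> \<le> norm x * norm x"
      using norm_apply_le[OF assms(2)] by (simp add: mult_left_mono)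
    finally show ?thesis by (simp add: power2_norm_eq_inner power2_eq_square[symmetric])
  qed
  then show ?thesis
    using assms by (auto simp: nonneg_op_def self_adjoint_intros blinfun.bilinear_simps inner_diff)
qed

lemma nonneg_op_vanish:
  assumes "nonneg_op A" "inner x (A x) = 0"
  shows "A x = 0"
proof -
  define B where "B = (1 / (norm A + 1)) *\<^sub>R A"
  have nA: "0 < norm A + 1" by (simp add: add_nonneg_pos)
  have "norm B \<le> 1" using nA by (simp add: B_def)
  moreover have "nonneg_op B" unfolding B_def using assms nA by (intro nonneg_op_intros) auto
  ultimately have "(norm (B x))\<^sup>2 \<le> inner x (B x)"
    by (intro norm_square_le_form nonneg_id_minus nonneg_opD)
  also have "\<dots> = 0" by (simp add: B_def blinfun.bilinear_simps assms)
  finally show ?thesis using nA by (simp add: B_def blinfun.bilinear_simps)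
qed

section \<open>Square roots of positive operators\<close>

text \<open>For \<open>\<parallel>A\<parallel> \<le> 1\<close> the iterates converge in norm to an operator \<open>L\<close> with \<open>2 L = A + L\<^sup>2\<close>, so that
  \<open>(1 - L)\<^sup>2 = 1 - A\<close>. They are polynomials in \<open>A\<close> with nonnegative coefficients, so all norm
  estimates reduce to the scalar iteration for \<open>A = 1\<close>.\<close>

primrec sqrt_iter :: "('a::real_normed_vector \<Rightarrow>\<^sub>L 'a) \<Rightarrow> nat \<Rightarrow> ('a \<Rightarrow>\<^sub>L 'a)" where
  "sqrt_iter A 0 = 0"
| "sqrt_iter A (Suc k) = (1/2) *\<^sub>R (A + (sqrt_iter A k o\<^sub>L sqrt_iter A k))"

primrec sqrt_majorant :: "nat \<Rightarrow> real" where
  "sqrt_majorant 0 = 0"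
| "sqrt_majorant (Suc k) = (1 + (sqrt_majorant k)\<^sup>2) / 2"

lemma sqrt_majorant_bounds: "0 \<le> sqrt_majorant k \<and> sqrt_majorant k \<le> 1"
  by (induction k) (auto simp: power_le_one)

lemma sqrt_majorant_incseq: "incseq sqrt_majorant"
proof (rule incseq_SucI)
  fix k
  have "0 \<le> (sqrt_majorant k - 1)\<^sup>2" by simp
  then show "sqrt_majorant k \<le> sqrt_majorant (Suc k)" by (simp add: power2_diff)
qed

lemma norm_sqrt_iter:
  assumes "norm A \<le> 1"
  shows "norm (sqrt_iter A k) \<le> sqrt_majorant k"
proof (induction k)
  case (Suc k)
  have "norm (A + (sqrt_iter A k o\<^sub>L sqrt_iter A k))
      \<le> 1 + norm (sqrt_iter A k) * norm (sqrt_iter A k)"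
    by (rule order_trans[OF norm_triangle_ineq add_mono[OF assms norm_blinfun_compose]])
  also have "\<dots> \<le> 1 + (sqrt_majorant k)\<^sup>2"
    unfolding power2_eq_square using Suc by (intro add_left_mono mult_mono) (auto simp: sqrt_majorant_bounds)
  finally show ?case by simp
qed simp

text \<open>Induction via \<open>Y\<^sub>k\<^sub>+\<^sub>1\<^sup>2 - Y\<^sub>k\<^sup>2 = Y\<^sub>k\<^sub>+\<^sub>1 (Y\<^sub>k\<^sub>+\<^sub>1 - Y\<^sub>k) + (Y\<^sub>k\<^sub>+\<^sub>1 - Y\<^sub>k) Y\<^sub>k\<close>; for the scalar
  majorant the same expression is an equality.\<close>

lemma norm_sqrt_iter_Suc_diff:
  assumes "norm A \<le> 1"
  shows "norm (sqrt_iter A (Suc k) - sqrt_iter A k) \<le> sqrt_majorant (Suc k) - sqrt_majorant k"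
proof (induction k)
  case 0 then show ?case using assms by simp
next
  case (Suc k)
  let ?Y = "sqrt_iter A" and ?y = sqrt_majorant
  let ?D = "?Y (Suc k) - ?Y k" and ?d = "?y (Suc k) - ?y k"
  have "?Y (Suc (Suc k)) - ?Y (Suc k) = (1/2) *\<^sub>R ((?Y (Suc k) o\<^sub>L ?D) + (?D o\<^sub>L ?Y k))"
    unfolding sqrt_iter.simps(2)[of A "Suc k"]
    by (subst (2) sqrt_iter.simps(2)) (simp del: sqrt_iter.simps add: compose_algebra scaleR_add_right scaleR_diff_right)
  also have "norm \<dots> \<le> (norm (?Y (Suc k)) * norm ?D + norm ?D * norm (?Y k)) / 2"
    using norm_triangle_le[OF add_mono[OF norm_blinfun_compose norm_blinfun_compose]]
    by (simp del: sqrt_iter.simps)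
  also have "\<dots> \<le> (?y (Suc k) * ?d + ?d * ?y k) / 2"
    using Suc norm_sqrt_iter[OF assms] sqrt_majorant_bounds sqrt_majorant_incseq
    by (intro divide_right_mono add_mono mult_mono) (auto simp del: sqrt_iter.simps sqrt_majorant.simps simp: incseq_SucD)
  also have "\<dots> = ((?y (Suc k))\<^sup>2 - (?y k)\<^sup>2) / 2"
    by (simp add: power2_eq_square algebra_simps del: sqrt_majorant.simps)
  also have "\<dots> = ?y (Suc (Suc k)) - ?y (Suc k)"
    by (subst (2 3) sqrt_majorant.simps(2)) (simp del: sqrt_majorant.simps add: field_simps)
  finally show ?case .
qed

lemma sqrt_iter_convergent:
  fixes A :: "'a::banach \<Rightarrow>\<^sub>L 'a"
  assumes "norm A \<le> 1"
  shows "convergent (sqrt_iter A)"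
proof -
  let ?Y = "sqrt_iter A" and ?y = sqrt_majorant
  have diff: "norm (?Y (n + j) - ?Y n) \<le> ?y (n + j) - ?y n" for n j
  proof (induction j)
    case (Suc j)
    have "?Y (n + Suc j) - ?Y n = (?Y (Suc (n + j)) - ?Y (n + j)) + (?Y (n + j) - ?Y n)"
      by simp
    also have "norm \<dots> \<le> (?y (Suc (n + j)) - ?y (n + j)) + (?y (n + j) - ?y n)"
      by (rule norm_triangle_le[OF add_mono[OF norm_sqrt_iter_Suc_diff[OF assms] Suc]])
    finally show ?case by simp
  qed simp
  have "convergent ?y"
    using sqrt_majorant_incseq sqrt_majorant_bounds
    by (intro Bseq_mono_convergent BseqI'[where K = 1]) (auto simp: incseq_def)
  then have "Cauchy ?y" by (simp add: Cauchy_convergent_iff)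
  have "Cauchy ?Y"
  proof (rule CauchyI')
    fix e :: real assume "0 < e"
    then obtain N where N: "\<And>m n. m \<ge> N \<Longrightarrow> n \<ge> N \<Longrightarrow> norm (?y m - ?y n) < e"
      using CauchyD[OF \<open>Cauchy ?y\<close>] by blast
    have "dist (?Y m) (?Y n) < e" if "m \<ge> N" "n > m" for m n
    proof -
      have "norm (?Y n - ?Y m) \<le> ?y n - ?y m" using diff[of m "n - m"] that by simp
      also have "\<dots> < e" using N[of n m] that by simp
      finally show ?thesis by (simp add: dist_norm norm_minus_commute)
    qed
    then show "\<exists>M. \<forall>m\<ge>M. \<forall>n>m. dist (?Y m) (?Y n) < e" by blast
  qed
  then show ?thesis by (simp add: Cauchy_convergent_iff)
qed

text \<open>This is what makes the iteration useful beyond existence: it transports intertwining relations,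
  in particular commutation, to the limit.\<close>

lemma sqrt_iter_intertwine:
  assumes "A o\<^sub>L X = X o\<^sub>L B"
  shows "sqrt_iter A k o\<^sub>L X = X o\<^sub>L sqrt_iter B k"
proof (induction k)
  case (Suc k)
  then have "sqrt_iter A k o\<^sub>L sqrt_iter A k o\<^sub>L X = X o\<^sub>L (sqrt_iter B k o\<^sub>L sqrt_iter B k)"
    by (metis compose_assoc)
  then show ?case by (simp add: compose_algebra assms)
qed simp

lemma sqrt_iter_self_adjoint:
  assumes "self_adjoint A" shows "self_adjoint (sqrt_iter A k)"
  by (induction k) (auto intro!: self_adjoint_intros assms)

text \<open>The square root of \<open>T \<ge> 0\<close>, computed after division by any bound \<open>c\<close> of its norm. The bound
  is kept as a parameter so that the roots of two operators can be formed with a common one.\<close>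

definition scaled_root :: "real \<Rightarrow> ('a::{real_inner,banach} \<Rightarrow>\<^sub>L 'a) \<Rightarrow> ('a \<Rightarrow>\<^sub>L 'a)" where
  "scaled_root c T = sqrt c *\<^sub>R (id_blinfun - lim (sqrt_iter (id_blinfun - (1/c) *\<^sub>R T)))"

lemma norm_id_minus_scaled:
  assumes "nonneg_op T" "norm T \<le> c" "0 < c"
  shows "norm (id_blinfun - (1/c) *\<^sub>R T) \<le> 1"
proof (rule norm_le_1_if_between_0_id)
  show "nonneg_op (id_blinfun - (1/c) *\<^sub>R T)"
    using assms by (intro nonneg_id_minus self_adjoint_intros nonneg_opD) auto
  show "nonneg_op (id_blinfun - (id_blinfun - (1/c) *\<^sub>R T))"
    using assms by (simp add: nonneg_op_intros)
qed

lemma scaled_root_nonneg_square: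
  assumes "nonneg_op T" "norm T \<le> c" "0 < c"
  shows "nonneg_op (scaled_root c T)" "scaled_root c T o\<^sub>L scaled_root c T = T"
proof -
  let ?A = "id_blinfun - (1/c) *\<^sub>R T"
  define L where "L = lim (sqrt_iter ?A)"
  note n1 = norm_id_minus_scaled[OF assms]
  have lim: "sqrt_iter ?A \<longlonglongrightarrow> L"
    using sqrt_iter_convergent[OF n1] convergent_LIMSEQ_iff L_def by blast
  have "norm L \<le> 1"
    using norm_sqrt_iter[OF n1] sqrt_majorant_bounds
    by (intro Lim_norm_ubound[OF _ lim]) (auto intro: order_trans always_eventually)
  moreover have "self_adjoint L"
    unfolding self_adjoint_def
  proof (intro allI)
    fix x y
    have "self_adjoint (sqrt_iter ?A k)" for k
      using assms by (intro sqrt_iter_self_adjoint self_adjoint_intros nonneg_opD)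
    then have "(\<lambda>k. inner (sqrt_iter ?A k x) y) = (\<lambda>k. inner x (sqrt_iter ?A k y))"
      by (auto simp: self_adjoint_def)
    moreover have "(\<lambda>k. inner (sqrt_iter ?A k x) y) \<longlonglongrightarrow> inner (L x) y"
      by (intro tendsto_intros blinfun.tendsto lim)
    moreover have "(\<lambda>k. inner x (sqrt_iter ?A k y)) \<longlonglongrightarrow> inner x (L y)"
      by (intro tendsto_intros blinfun.tendsto lim)
    ultimately show "inner (L x) y = inner x (L y)" by (metis LIMSEQ_unique)
  qed
  ultimately show "nonneg_op (scaled_root c T)"
    unfolding scaled_root_def L_def[symmetric] using assms
    by (intro nonneg_op_intros nonneg_id_minus) auto
  have "(\<lambda>k. sqrt_iter ?A (Suc k)) \<longlonglongrightarrow> (1/2) *\<^sub>R (?A + (L o\<^sub>L L))"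
    unfolding sqrt_iter.simps by (intro tendsto_intros lim bounded_bilinear.tendsto[OF bounded_bilinear_blinfun_compose])
  then have "L = (1/2) *\<^sub>R (?A + (L o\<^sub>L L))"
    using LIMSEQ_Suc[OF lim] LIMSEQ_unique by blast
  then have "2 *\<^sub>R L = ?A + (L o\<^sub>L L)" by (metis scaleR_half_double scaleR_2 scaleR_add_right)
  then have "(id_blinfun - L) o\<^sub>L (id_blinfun - L) = (1/c) *\<^sub>R T"
    by (simp add: compose_algebra scaleR_2 algebra_simps)
  then show "scaled_root c T o\<^sub>L scaled_root c T = T"
    unfolding scaled_root_def L_def[symmetric] using assms
    by (simp add: bounded_bilinear.scaleR_left[OF bounded_bilinear_blinfun_compose]
        bounded_bilinear.scaleR_right[OF bounded_bilinear_blinfun_compose])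
qed

lemma scaled_root_intertwine:
  assumes "nonneg_op S" "norm S \<le> c" "nonneg_op T" "norm T \<le> c" "0 < c"
    and "S o\<^sub>L X = X o\<^sub>L T"
  shows "scaled_root c S o\<^sub>L X = X o\<^sub>L scaled_root c T"
proof -
  let ?A = "id_blinfun - (1/c) *\<^sub>R S" and ?B = "id_blinfun - (1/c) *\<^sub>R T"
  have "?A o\<^sub>L X = X o\<^sub>L ?B" using assms by (simp add: compose_algebra)
  then have "(\<lambda>k. sqrt_iter ?A k o\<^sub>L X) = (\<lambda>k. X o\<^sub>L sqrt_iter ?B k)"
    by (auto intro: sqrt_iter_intertwine)
  moreover have "(\<lambda>k. sqrt_iter ?A k o\<^sub>L X) \<longlonglongrightarrow> (lim (sqrt_iter ?A) o\<^sub>L X)"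
    using sqrt_iter_convergent[OF norm_id_minus_scaled] assms convergent_LIMSEQ_iff
    by (intro bounded_bilinear.tendsto[OF bounded_bilinear_blinfun_compose] tendsto_const) blast
  moreover have "(\<lambda>k. X o\<^sub>L sqrt_iter ?B k) \<longlonglongrightarrow> (X o\<^sub>L lim (sqrt_iter ?B))"
    using sqrt_iter_convergent[OF norm_id_minus_scaled] assms convergent_LIMSEQ_iff
    by (intro bounded_bilinear.tendsto[OF bounded_bilinear_blinfun_compose] tendsto_const) blast
  ultimately have "lim (sqrt_iter ?A) o\<^sub>L X = X o\<^sub>L lim (sqrt_iter ?B)"
    by (metis LIMSEQ_unique)
  then show ?thesis by (simp add: scaled_root_def compose_algebra)
qed

text \<open>On a vector \<open>y = (R - S) x\<close> the operator \<open>R + S\<close> vanishes, since \<open>(R + S) (R - S) = 0\<close>. As both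
  summands are positive, both vanish on \<open>y\<close>; hence \<open>(R - S) y = 0\<close> and
  \<open>\<parallel>y\<parallel>\<^sup>2 = \<langle>x, (R - S) y\<rangle> = 0\<close>.\<close>

lemma nonneg_root_unique:
  fixes R S :: "'a::{real_inner,banach} \<Rightarrow>\<^sub>L 'a"
  assumes R: "nonneg_op R" and S: "nonneg_op S" and sq: "R o\<^sub>L R = S o\<^sub>L S" and comm: "R o\<^sub>L S = S o\<^sub>L R"
  shows "R = S"
proof (rule blinfun_eqI)
  fix x
  let ?D = "R - S"
  let ?y = "?D x"
  have D: "self_adjoint ?D" using R S by (intro self_adjoint_intros nonneg_opD)
  have "(R + S) o\<^sub>L ?D = 0" by (simp add: compose_algebra sq comm)
  then have "R ?y + S ?y = 0"
    by (metis blinfun.add_left blinfun_apply_blinfun_compose blinfun.zero_left)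
  then have "inner ?y (R ?y) + inner ?y (S ?y) = 0"
    by (metis inner_add_right inner_zero_right)
  then have "inner ?y (R ?y) = 0" "inner ?y (S ?y) = 0"
    using nonneg_opD(1)[OF R] nonneg_opD(1)[OF S] by (auto simp: add_nonneg_eq_0_iff)
  then have "R ?y = 0" "S ?y = 0" using nonneg_op_vanish R S by blast+
  then have "?D ?y = 0" by (simp add: blinfun.diff_left)
  then have "inner ?y ?y = 0" using self_adjointD[OF D, of x ?y] by simp
  then show "R x = S x" by (simp add: blinfun.diff_left)
qed

lemma nonneg_root_eq_hroot:
  assumes "nonneg_op R" "R o\<^sub>L R = T" "norm T \<le> c" "0 < c"
  shows "R = scaled_root c T"
proof -
  have T: "nonneg_op T" using assms(1,2) nonneg_op_intros(6) nonneg_opD(2) by blast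
  show ?thesis
  proof (rule nonneg_root_unique)
    have "T o\<^sub>L R = R o\<^sub>L T" using assms(2) compose_assoc by metis
    then show "R o\<^sub>L scaled_root c T = scaled_root c T o\<^sub>L R"
      using scaled_root_intertwine[OF T assms(3) T assms(3,4)] by simp
  qed (use scaled_root_nonneg_square[OF T] assms in auto)
qed

lemma nonneg_root_exists:
  fixes T :: "'a::{real_inner,banach} \<Rightarrow>\<^sub>L 'a"
  assumes "nonneg_op T"
  shows "\<exists>R. nonneg_op R \<and> R o\<^sub>L R = T"
  using scaled_root_nonneg_square[OF assms, of "norm T + 1"] norm_ge_zero[of T]
  by (metis add_nonneg_pos less_add_one less_imp_le zero_less_one)

text \<open>Square roots inherit intertwining relations from their squares. With \<open>R = Q\<close> this says that a
  root commutes with everything its square commutes with; with \<open>R = |X\<^sup>*|\<close>, \<open>Q = |X|\<close> it gives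
  \<open>|X\<^sup>*| X = X |X|\<close>.\<close>

lemma nonneg_root_intertwine:
  fixes R Q :: "'a::{real_inner,banach} \<Rightarrow>\<^sub>L 'a"
  assumes "nonneg_op R" "nonneg_op Q" "R o\<^sub>L R o\<^sub>L X = X o\<^sub>L (Q o\<^sub>L Q)"
  shows "R o\<^sub>L X = X o\<^sub>L Q"
proof -
  define c where "c = max (norm (R o\<^sub>L R)) (norm (Q o\<^sub>L Q)) + 1"
  have c: "norm (R o\<^sub>L R) \<le> c" "norm (Q o\<^sub>L Q) \<le> c" "0 < c"
    by (auto simp: c_def intro!: add_nonneg_pos simp: le_max_iff_disj)
  then have "R = scaled_root c (R o\<^sub>L R)" "Q = scaled_root c (Q o\<^sub>L Q)"
    using assms nonneg_root_eq_hroot by blast+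
  then show ?thesis
    using scaled_root_intertwine[OF _ c(1) _ c(2,3) assms(3)] assms(1,2) nonneg_op_intros(6) nonneg_opD(2) by metis
qed

text \<open>\<open>A B = \<surd>A B \<surd>A\<close>, because \<open>\<surd>A\<close> commutes with \<open>B\<close>.\<close>

lemma nonneg_op_compose:
  fixes A B :: "'a::{real_inner,banach} \<Rightarrow>\<^sub>L 'a"
  assumes A: "nonneg_op A" and B: "nonneg_op B" and comm: "A o\<^sub>L B = B o\<^sub>L A"
  shows "nonneg_op (A o\<^sub>L B)"
proof -
  obtain R where R: "nonneg_op R" "R o\<^sub>L R = A" using nonneg_root_exists[OF A] by blast
  have "R o\<^sub>L B = B o\<^sub>L R"
    by (rule nonneg_root_intertwine) (use R comm in auto)
  then have "A o\<^sub>L B = R o\<^sub>L B o\<^sub>L R" using R by (metis compose_assoc)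
  then show ?thesis using R B nonneg_op_intros(5) nonneg_opD(2) by metis
qed

section \<open>Adjoints and positivity on a complex Hilbert space\<close>

instance complex_hilbert_space \<subseteq> banach ..

lemma inner_scaleC_left: "inner (c *\<^sub>C x) y = inner x (cnj c *\<^sub>C y)"
  unfolding inner_eq_Re_cinner
  by (metis cinner_commute cinner_scaleC_right complex_cnj_cnj complex_cnj_mult)

text \<open>The real inner product determines the complex one. Hence the identities between operators that
  commute with \<open>\<i>\<close> need only be checked for real inner products.\<close>

lemma Im_cinner: "Im (cinner x y) = - inner x (\<i> *\<^sub>C y)"
  by (simp add: inner_eq_Re_cinner cinner_scaleC_right)

lemma cinner_eqI:
  assumes "\<And>y. inner u y = inner v (S y)" "\<And>y. S (\<i> *\<^sub>C y) = \<i> *\<^sub>C S y"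
  shows "cinner u y = cinner v (S y)"
  using assms by (simp add: complex_eq_iff Im_cinner) (simp add: inner_eq_Re_cinner)

lemma bounded_opsD: "T \<in> bounded_ops \<Longrightarrow> T (c *\<^sub>C x) = c *\<^sub>C T x"
  by (simp add: bounded_ops_def)

lemma positive_op_iff: "positive_op T \<longleftrightarrow> T \<in> bounded_ops \<and> nonneg_op T"
proof
  assume T: "positive_op T"
  then have b: "T \<in> bounded_ops" and "\<And>x. cinner x (T x) \<in> \<real>\<^sub>\<ge>\<^sub>0" by (auto simp: positive_op_def)
  then have p: "0 \<le> inner x (T x)" and im: "inner x (\<i> *\<^sub>C T x) = 0" for x
    using Im_cinner[of x "T x"] by (auto simp: complex_nonneg_Reals_iff inner_eq_Re_cinner)
  \<comment> \<open>The real operator \<open>\<i> T\<close> is antisymmetric, by polarization.\<close>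
  have anti: "inner x (\<i> *\<^sub>C T y) = - inner y (\<i> *\<^sub>C T x)" for x y
    using im[of "x + y"] im[of x] im[of y]
    by (simp add: blinfun.add_right scaleC_add_right inner_add)
  have "inner (T x) y = inner x (T y)" for x y
  proof -
    have "\<i> *\<^sub>C T (- \<i> *\<^sub>C y) = T y"
      using bounded_opsD[OF b] scaleC_of_real[of 1 "T y"] by (simp add: scaleC_scaleC)
    then have "inner x (T y) = - inner (- \<i> *\<^sub>C y) (\<i> *\<^sub>C T x)"
      using anti[of x "- \<i> *\<^sub>C y"] by simp
    also have "\<dots> = - inner y (\<i> *\<^sub>C \<i> *\<^sub>C T x)" by (simp add: inner_scaleC_left)
    also have "\<i> *\<^sub>C \<i> *\<^sub>C T x = - T x"
      using scaleC_of_real[of "-1" "T x"] by (simp add: scaleC_scaleC)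
    finally show ?thesis by (simp add: inner_commute)
  qed
  with b p show "T \<in> bounded_ops \<and> nonneg_op T" by (auto simp: nonneg_op_def self_adjoint_def)
next
  assume T: "T \<in> bounded_ops \<and> nonneg_op T"
  have "Im (cinner x (T x)) = 0" for x
  proof -
    have "inner x (\<i> *\<^sub>C T x) = inner (T x) (\<i> *\<^sub>C x)"
      using T bounded_opsD[of T] self_adjointD[OF nonneg_opD(2)] by metis
    also have "\<dots> = - Im (cinner (T x) x)" by (simp add: Im_cinner)
    also have "\<dots> = Im (cinner x (T x))" by (subst cinner_commute) simp
    finally show ?thesis by (simp add: Im_cinner)
  qed
  with T show "positive_op T"
    by (auto simp: positive_op_def nonneg_op_def complex_nonneg_Reals_iff inner_eq_Re_cinner)
qed

lemma adj_unique:
  assumes "T \<in> bounded_ops" "\<And>x y. inner (blinfun_apply S x) y = inner x (T y)"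
  shows "adj T = S"
  unfolding adj_def
proof (rule the_equality)
  show "\<forall>x y. cinner (S x) y = cinner x (T y)"
    using assms by (auto intro!: cinner_eqI simp: bounded_opsD)
  fix S' assume "\<forall>x y. cinner (blinfun_apply S' x) y = cinner x (T y)"
  then have "inner (S' x) y = inner (S x) y" for x y
    using assms(2) by (simp add: inner_eq_Re_cinner)
  then show "S' = S" by (metis blinfun_eqI vector_eq_rdot)
qed

lemma adj_exists:
  assumes "T \<in> bounded_ops"
  shows "\<exists>S. (\<forall>x y. inner (blinfun_apply S x) y = inner x (T y))"
proof -
  have "\<exists>v. \<forall>y. inner x (T y) = inner v y" for x
  proof -
    have "bounded_linear (\<lambda>y. inner x (T y))"
      by (intro bounded_linear_compose[OF bounded_linear_inner_right] blinfun.bounded_linear_right)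
    then show ?thesis by (metis riesz_representation)
  qed
  then obtain S where S: "\<And>x y. inner x (T y) = inner (S x) y" by metis
  have "bounded_linear S"
  proof (rule bounded_linear_intro[where K = "norm T"])
    show "S (x + y) = S x + S y" for x y
    proof -
      have "inner (S (x + y)) z = inner (S x + S y) z" for z
        using S by (metis inner_add_left)
      then show ?thesis by (metis vector_eq_rdot)
    qed
    show "S (r *\<^sub>R x) = r *\<^sub>R S x" for r x
    proof -
      have "inner (S (r *\<^sub>R x)) z = inner (r *\<^sub>R S x) z" for z
        using S by (metis inner_scaleR_left)
      then show ?thesis by (metis vector_eq_rdot)
    qed
    show "norm (S x) \<le> norm x * norm T" for x
    proof (cases "S x = 0")
      case False
      have "norm (S x) * norm (S x) = inner x (T (S x))"
        by (simp add: S power2_norm_eq_inner[symmetric] power2_eq_square)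
      also have "\<dots> \<le> norm x * norm (T (S x))" by (rule norm_cauchy_schwarz)
      also have "\<dots> \<le> norm x * (norm T * norm (S x))"
        by (intro mult_left_mono norm_blinfun) simp
      finally have "norm (S x) * norm (S x) \<le> (norm x * norm T) * norm (S x)"
        by (simp add: mult.assoc)
      then show ?thesis using False by (simp add: mult_le_cancel_right)
    qed simp
  qed
  then show ?thesis using S by (intro exI[where x = "Blinfun S"]) (simp add: bounded_linear_Blinfun_apply)
qed

lemma inner_adj:
  assumes "T \<in> bounded_ops"
  shows "inner (adj T x) y = inner x (T y)"
  proof -
  obtain S where S: "\<And>x y. inner (blinfun_apply S x) y = inner x (T y)"
    using adj_exists[OF assms] by blast
  then show ?thesis using adj_unique[OF assms, of S] by simp
qed

lemma inner_adj':
  assumes "T \<in> bounded_ops"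
  shows "inner x (adj T y) = inner (T x) y"
  using inner_adj[OF assms] by (metis inner_commute)

lemma adj_bounded_ops:
  assumes "T \<in> bounded_ops" shows "adj T \<in> bounded_ops"
proof -
  have "inner (adj T (c *\<^sub>C x)) y = inner (c *\<^sub>C adj T x) y" for c x y
    by (simp add: inner_adj[OF assms] inner_scaleC_left bounded_opsD[OF assms])
  then have "adj T (c *\<^sub>C x) = c *\<^sub>C adj T x" for c x
    by (metis vector_eq_rdot)
  then show ?thesis by (simp add: bounded_ops_def)
qed

lemma adj_self_adjoint: "T \<in> bounded_ops \<Longrightarrow> self_adjoint T \<Longrightarrow> adj T = T"
  by (rule adj_unique) (auto simp: self_adjoint_def)

lemma adj_adj: "T \<in> bounded_ops \<Longrightarrow> adj (adj T) = T"
  by (rule adj_unique) (auto simp: adj_bounded_ops inner_adj')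

lemma bounded_ops_iff_commute: "T \<in> bounded_ops \<longleftrightarrow> (\<forall>c. T o\<^sub>L scaleC_op c id_blinfun = scaleC_op c id_blinfun o\<^sub>L T)"
proof -
  have "T o\<^sub>L scaleC_op c id_blinfun = scaleC_op c id_blinfun o\<^sub>L T \<longleftrightarrow> (\<forall>x. T (c *\<^sub>C x) = c *\<^sub>C T x)" for c
    unfolding blinfun_apply_inject[symmetric] fun_eq_iff by (simp add: scaleC_op_apply)
  then show ?thesis by (simp add: bounded_ops_def)
qed

lemma scaleC_zero_right: "c *\<^sub>C (0::'a::complex_hilbert_space) = 0"
  using scaleC_add_right[of c "0::'a" 0] by simp

lemma scaleC_minus_right: "c *\<^sub>C (- x) = - (c *\<^sub>C x)"
  using scaleC_add_right[of c x "- x"] scaleC_zero_right[of c] by (metis add.inverse_unique add.right_inverse)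

lemma scaleC_diff_right: "c *\<^sub>C (x - y) = c *\<^sub>C x - c *\<^sub>C y"
  using scaleC_add_right[of c x "- y"] by (simp add: scaleC_minus_right)

lemma scaleC_scaleR_right: "c *\<^sub>C (r *\<^sub>R x) = r *\<^sub>R (c *\<^sub>C x)"
  by (simp add: scaleC_scaleC mult.commute flip: scaleC_of_real)

lemma scaleC_op_of_real: "scaleC_op (of_real r) T = r *\<^sub>R T"
  by (rule blinfun_eqI) (simp add: scaleC_op_apply scaleC_of_real blinfun.scaleR_left)

lemma bounded_ops_intros:
  shows "0 \<in> bounded_ops" "id_blinfun \<in> bounded_ops"
    "A \<in> bounded_ops \<Longrightarrow> B \<in> bounded_ops \<Longrightarrow> A + B \<in> bounded_ops"
    "A \<in> bounded_ops \<Longrightarrow> B \<in> bounded_ops \<Longrightarrow> A - B \<in> bounded_ops"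
    "A \<in> bounded_ops \<Longrightarrow> r *\<^sub>R A \<in> bounded_ops"
    "A \<in> bounded_ops \<Longrightarrow> scaleC_op c A \<in> bounded_ops"
    "A \<in> bounded_ops \<Longrightarrow> B \<in> bounded_ops \<Longrightarrow> A o\<^sub>L B \<in> bounded_ops"
  by (auto simp: bounded_ops_def blinfun.bilinear_simps scaleC_op_apply scaleC_add_right scaleC_diff_right
      scaleC_scaleR_right scaleC_scaleC scaleC_zero_right mult.commute)

lemma commutant_intros:
  assumes "N \<subseteq> bounded_ops"
  shows "0 \<in> commutant N" "id_blinfun \<in> commutant N"
    "A \<in> commutant N \<Longrightarrow> B \<in> commutant N \<Longrightarrow> A + B \<in> commutant N"
    "A \<in> commutant N \<Longrightarrow> B \<in> commutant N \<Longrightarrow> A - B \<in> commutant N"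
    "A \<in> commutant N \<Longrightarrow> r *\<^sub>R A \<in> commutant N"
    "A \<in> commutant N \<Longrightarrow> scaleC_op c A \<in> commutant N"
    "A \<in> commutant N \<Longrightarrow> B \<in> commutant N \<Longrightarrow> A o\<^sub>L B \<in> commutant N"
proof -
  show "A \<in> commutant N \<Longrightarrow> scaleC_op c A \<in> commutant N"
  proof -
    assume A: "A \<in> commutant N"
    have "scaleC_op c A o\<^sub>L S = S o\<^sub>L scaleC_op c A" if "S \<in> N" for S
    proof (rule blinfun_eqI)
      fix x
      have "A (S x) = S (A x)"
        using A that by (auto simp: commutant_def) (metis blinfun_apply_blinfun_compose)
      then show "(scaleC_op c A o\<^sub>L S) x = (S o\<^sub>L scaleC_op c A) x"
        using bounded_opsD[of S c "A x"] that assms by (auto simp: scaleC_op_apply)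
    qed
    then show ?thesis using A by (auto simp: commutant_def bounded_ops_intros)
  qed
  show "A \<in> commutant N \<Longrightarrow> B \<in> commutant N \<Longrightarrow> A o\<^sub>L B \<in> commutant N"
    by (simp add: commutant_def bounded_ops_intros compose_assoc) (simp add: compose_assoc[symmetric])
qed (auto simp: commutant_def bounded_ops_intros compose_algebra)

section \<open>Von Neumann algebras\<close>

locale von_neumann =
  fixes M :: "('a::complex_hilbert_space \<Rightarrow>\<^sub>L 'a) set"
  assumes vN: "von_neumann_algebra M"
begin

lemma in_bounded_ops: "T \<in> M \<Longrightarrow> T \<in> bounded_ops"
  using vN by (auto simp: von_neumann_algebra_def)

lemma bicommutant: "commutant (commutant M) = M"
  using vN by (auto simp: von_neumann_algebra_def)

lemma algebra_closed:
  shows "0 \<in> M" "id_blinfun \<in> M"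
    "A \<in> M \<Longrightarrow> B \<in> M \<Longrightarrow> A + B \<in> M"
    "A \<in> M \<Longrightarrow> B \<in> M \<Longrightarrow> A - B \<in> M"
    "A \<in> M \<Longrightarrow> r *\<^sub>R A \<in> M"
    "A \<in> M \<Longrightarrow> scaleC_op c A \<in> M"
    "A \<in> M \<Longrightarrow> B \<in> M \<Longrightarrow> A o\<^sub>L B \<in> M"
proof -
  have "commutant M \<subseteq> bounded_ops" by (auto simp: commutant_def)
  note * = commutant_intros[OF this, unfolded bicommutant]
  show "0 \<in> M" "id_blinfun \<in> M"
    "A \<in> M \<Longrightarrow> B \<in> M \<Longrightarrow> A + B \<in> M"
    "A \<in> M \<Longrightarrow> B \<in> M \<Longrightarrow> A - B \<in> M"
    "A \<in> M \<Longrightarrow> r *\<^sub>R A \<in> M"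
    "A \<in> M \<Longrightarrow> scaleC_op c A \<in> M"
    "A \<in> M \<Longrightarrow> B \<in> M \<Longrightarrow> A o\<^sub>L B \<in> M"
    by (fact *)+
qed

lemma adj_closed: "A \<in> M \<Longrightarrow> adj A \<in> M"
  using vN by (auto simp: von_neumann_algebra_def)

text \<open>The root commutes with whatever its square commutes with: with multiplication by scalars, so it
  is a bounded complex operator, and with the commutant, so it lies in the bicommutant.\<close>

lemma root_closed:
  assumes "R o\<^sub>L R \<in> M" "nonneg_op R"
  shows "R \<in> M"
proof -
  have comm: "R o\<^sub>L S = S o\<^sub>L R" if "R o\<^sub>L R o\<^sub>L S = S o\<^sub>L (R o\<^sub>L R)" for S
    by (rule nonneg_root_intertwine[OF assms(2) assms(2) that])
  have "R \<in> bounded_ops"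
    using comm in_bounded_ops[OF assms(1)] unfolding bounded_ops_iff_commute by blast
  moreover have "R o\<^sub>L S = S o\<^sub>L R" if "S \<in> commutant M" for S
    using that assms(1) by (auto intro!: comm simp: commutant_def)
  ultimately show ?thesis using bicommutant by (auto simp: commutant_def[of "commutant M"])
qed

lemma pos_cone_iff: "A \<in> pos_cone M \<longleftrightarrow> A \<in> M \<and> nonneg_op A"
  using in_bounded_ops by (auto simp: pos_cone_def positive_op_iff)

lemma adj_compose_nonneg:
  assumes "A \<in> M" shows "nonneg_op (adj A o\<^sub>L A)"
  using in_bounded_ops[OF assms]
  by (auto simp: nonneg_op_def self_adjoint_def inner_adj inner_adj' adj_bounded_ops)

lemma abs_op:
  assumes "A \<in> M"
  shows "abs_op A \<in> M" "nonneg_op (abs_op A)" "abs_op A o\<^sub>L abs_op A = adj A o\<^sub>L A"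
proof -
  let ?T = "adj A o\<^sub>L A"
  have T: "?T \<in> M" using assms by (simp add: algebra_closed adj_closed)
  obtain R where R: "nonneg_op R" "R o\<^sub>L R = ?T"
    using nonneg_root_exists[OF adj_compose_nonneg[OF assms]] by blast
  have RM: "R \<in> M" by (rule root_closed) (use R T in auto)
  have "abs_op A = R" unfolding abs_op_def sqrt_op_def
  proof (rule the_equality)
    show "positive_op R \<and> R o\<^sub>L R = ?T" using R RM in_bounded_ops by (simp add: positive_op_iff)
    show "S = R" if "positive_op S \<and> S o\<^sub>L S = ?T" for S
      using that R nonneg_root_eq_hroot[of S ?T "norm ?T + 1"] nonneg_root_eq_hroot[of R ?T "norm ?T + 1"]
      by (simp add: positive_op_iff add_nonneg_pos)
  qed
  then show "abs_op A \<in> M" "nonneg_op (abs_op A)" "abs_op A o\<^sub>L abs_op A = ?T"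
    using R RM by auto
qed

lemma abs_op_eqI:
  assumes "A \<in> M" "nonneg_op R" "R o\<^sub>L R = adj A o\<^sub>L A"
  shows "abs_op A = R"
proof -
  let ?T = "adj A o\<^sub>L A"
  have "0 < norm ?T + 1" by (simp add: add_nonneg_pos)
  then have "S = scaled_root (norm ?T + 1) ?T" if "nonneg_op S" "S o\<^sub>L S = ?T" for S
    using that by (intro nonneg_root_eq_hroot) auto
  then show ?thesis using abs_op[OF assms(1)] assms(2,3) by blast
qed

end

section \<open>Cutoffs of an operator between zero and the identity\<close>

lemma power_op_intertwine:
  assumes "A o\<^sub>L X = X o\<^sub>L B"
  shows "power_op A n o\<^sub>L X = X o\<^sub>L power_op B n"
proof (induction n)
  case (Suc n)
  then show ?case by (metis assms compose_assoc power_op.simps(2))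
qed simp

text \<open>Since \<open>T (\<Sum>\<^bsub>k<n\<^esub> (1 - T)\<^sup>k) = 1 - (1 - T)\<^sup>n\<close>, the geometric sum is an approximate inverse of \<open>T\<close>
  and the cutoff an approximate support projection.\<close>

definition geom_op :: "('a::complex_hilbert_space \<Rightarrow>\<^sub>L 'a) \<Rightarrow> nat \<Rightarrow> ('a \<Rightarrow>\<^sub>L 'a)" where
  "geom_op T n = (\<Sum>k<n. power_op (id_blinfun - T) k)"

definition cutoff :: "('a::complex_hilbert_space \<Rightarrow>\<^sub>L 'a) \<Rightarrow> nat \<Rightarrow> ('a \<Rightarrow>\<^sub>L 'a)" where
  "cutoff T n = id_blinfun - power_op (id_blinfun - T) n"

lemma compose_geom_op: "T o\<^sub>L geom_op T n = cutoff T n"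
  by (induction n) (auto simp: geom_op_def cutoff_def compose_algebra)

lemma geom_op_intertwine:
  assumes "A o\<^sub>L X = X o\<^sub>L B"
  shows "geom_op A n o\<^sub>L X = X o\<^sub>L geom_op B n"
proof -
  have "power_op (id_blinfun - A) n o\<^sub>L X = X o\<^sub>L power_op (id_blinfun - B) n" for n
    by (rule power_op_intertwine) (simp add: compose_algebra assms)
  then show ?thesis by (induction n) (auto simp: geom_op_def compose_algebra)
qed

lemma geom_op_commute: "T o\<^sub>L geom_op T n = geom_op T n o\<^sub>L T"
  by (rule geom_op_intertwine[symmetric]) simp

locale unit_interval_op =
  fixes T :: "'a::complex_hilbert_space \<Rightarrow>\<^sub>L 'a"
  assumes T_nonneg: "nonneg_op T" and T_le: "nonneg_op (id_blinfun - T)"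
begin

abbreviation C where "C \<equiv> id_blinfun - T"

lemma power_nonneg: "nonneg_op (power_op C n)"
proof (induction n)
  case (Suc n)
  then show ?case
    using nonneg_op_compose[OF T_le Suc] power_op_intertwine[of C C C n] by simp
qed (simp add: nonneg_op_intros)

lemma norm_C: "norm C \<le> 1"
  by (rule norm_le_1_if_between_0_id) (use T_nonneg T_le in auto)

lemma norm_T: "norm T \<le> 1"
  using T_nonneg T_le by (rule norm_le_1_if_between_0_id)

lemma norm_power: "norm (power_op C n) \<le> 1"
proof (induction n)
  case 0 then show ?case by (simp add: norm_blinfun_id_le)
next
  case (Suc n)
  have "norm (power_op C (Suc n)) \<le> norm C * norm (power_op C n)"
    by (simp add: norm_blinfun_compose)
  also have "\<dots> \<le> 1" using mult_le_one[OF norm_C _ Suc] by simp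
  finally show ?case .
qed

lemma power_le: "nonneg_op (id_blinfun - power_op C n)"
  by (intro nonneg_id_minus nonneg_opD power_nonneg norm_power)

lemma cutoff_nonneg: "nonneg_op (cutoff T n)" unfolding cutoff_def by (rule power_le)

lemma cutoff_le: "nonneg_op (id_blinfun - cutoff T n)"
  unfolding cutoff_def by (simp add: power_nonneg)

lemma norm_cutoff: "norm (cutoff T n) \<le> 1"
  using cutoff_nonneg cutoff_le by (rule norm_le_1_if_between_0_id)

lemma geom_op_nonneg: "nonneg_op (geom_op T n)"
  unfolding geom_op_def by (induction n) (auto intro: nonneg_op_intros power_nonneg)

lemma T_power_commute: "T o\<^sub>L power_op C n = power_op C n o\<^sub>L T"
  by (rule power_op_intertwine[symmetric]) (simp add: compose_algebra)

lemma T_power_nonneg: "nonneg_op (T o\<^sub>L power_op C n)"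
  by (intro nonneg_op_compose T_nonneg power_nonneg T_power_commute)

lemma T_power_decreasing: "nonneg_op ((T o\<^sub>L power_op C n) - (T o\<^sub>L power_op C (Suc n)))"
proof -
  have "(T o\<^sub>L power_op C n) - (T o\<^sub>L power_op C (Suc n)) = T o\<^sub>L power_op C n o\<^sub>L T"
    by (simp add: compose_algebra T_power_commute compose_assoc[symmetric])
  then show ?thesis using nonneg_op_intros(5)[OF nonneg_opD(2)[OF T_nonneg] power_nonneg] by simp
qed

text \<open>The forms of \<open>T (1 - T)\<^sup>k\<close> decrease in \<open>k\<close>, so \<open>n\<close> times the \<open>n\<close>-th is at most the sum of the
  first \<open>n\<close>, which is the form of \<open>1 - (1 - T)\<^sup>n \<le> 1\<close>.\<close>

lemma T_power_form_le: "real n * inner x ((T o\<^sub>L power_op C n) x) \<le> inner x x"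
proof -
  define f where "f k = inner x ((T o\<^sub>L power_op C k) x)" for k
  have "f (Suc k) \<le> f k" for k
    using nonneg_opD(1)[OF T_power_decreasing[of k], of x] by (simp add: f_def blinfun.diff_left inner_diff)
  then have dec: "decseq f" by (rule decseq_SucI)
  have "real n * f n = (\<Sum>k<n. f n)" by simp
  also have "\<dots> \<le> (\<Sum>k<n. f k)" using dec by (intro sum_mono) (auto simp: decseq_def)
  also have "\<dots> = inner x ((T o\<^sub>L geom_op T n) x)"
    by (simp add: f_def geom_op_def blinfun.sum_left blinfun.sum_right inner_sum_right)
  also have "\<dots> \<le> inner x x"
    using nonneg_opD(1)[OF cutoff_le, of x] unfolding compose_geom_op by (simp add: blinfun.diff_left inner_diff)
  finally show ?thesis by (simp add: f_def)
qed

lemma T_power_form_tendsto: "(\<lambda>n. inner x ((T o\<^sub>L power_op C n) x)) \<longlonglongrightarrow> 0"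
proof (rule tendsto_sandwich[OF always_eventually eventually_sequentiallyI tendsto_const])
  show "\<forall>n. 0 \<le> inner x ((T o\<^sub>L power_op C n) x)" using nonneg_opD(1)[OF T_power_nonneg] by blast
  show "inner x ((T o\<^sub>L power_op C n) x) \<le> inner x x * inverse (real n)" if "1 \<le> n" for n
    using T_power_form_le[of n x] that by (simp add: field_simps)
  show "(\<lambda>n. inner x x * inverse (real n)) \<longlonglongrightarrow> 0"
    by (intro tendsto_mult_right_zero lim_inverse_n)
qed

text \<open>\<open>0 \<le> T (1 - T)\<^sup>n \<le> 1\<close> turns convergence of the quadratic forms into strong convergence.\<close>

lemma T_power_tendsto: "(\<lambda>n. T (power_op C n x)) \<longlonglongrightarrow> 0"
proof -
  have le: "nonneg_op (id_blinfun - (T o\<^sub>L power_op C n))" for n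
  proof (rule nonneg_id_minus)
    show "self_adjoint (T o\<^sub>L power_op C n)" by (rule nonneg_opD(2)[OF T_power_nonneg])
    show "norm (T o\<^sub>L power_op C n) \<le> 1"
      using norm_blinfun_compose[of T "power_op C n"] mult_le_one[OF norm_T _ norm_power[of n]] by simp
  qed
  have "(\<lambda>n. (norm (T (power_op C n x)))\<^sup>2) \<longlonglongrightarrow> 0"
  proof (rule tendsto_sandwich[OF always_eventually always_eventually tendsto_const T_power_form_tendsto])
    show "\<forall>n. (norm (T (power_op C n x)))\<^sup>2 \<le> inner x ((T o\<^sub>L power_op C n) x)"
      using norm_square_le_form[OF T_power_nonneg le] by simp
  qed simp
  then have "(\<lambda>n. sqrt ((norm (T (power_op C n x)))\<^sup>2)) \<longlonglongrightarrow> sqrt 0"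
    by (rule tendsto_real_sqrt)
  then show ?thesis by (simp add: tendsto_norm_zero_iff)
qed

end

section \<open>Absolute values and dominating pairs\<close>

lemma adj_compose:
  assumes "A \<in> bounded_ops" "B \<in> bounded_ops"
  shows "adj (A o\<^sub>L B) = adj B o\<^sub>L adj A"
  by (rule adj_unique) (use assms in \<open>auto simp: inner_adj bounded_ops_intros\<close>)

lemma adj_scaleC_op:
  assumes "A \<in> bounded_ops"
  shows "adj (scaleC_op c A) = scaleC_op (cnj c) (adj A)"
  by (rule adj_unique)
     (use assms in \<open>auto simp: inner_adj bounded_ops_intros scaleC_op_apply inner_scaleC_left bounded_opsD\<close>)

lemma adj_scaleR: "A \<in> bounded_ops \<Longrightarrow> adj (r *\<^sub>R A) = r *\<^sub>R adj A"
  using adj_scaleC_op[of A "of_real r"] by (simp add: scaleC_op_of_real)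

lemma norm_adj_le:
  assumes "U \<in> bounded_ops" "norm U \<le> 1"
  shows "norm (adj U) \<le> 1"
proof (rule norm_le_1_if_contractive)
  fix x
  let ?v = "adj U x"
  have "norm ?v * norm ?v = inner x (U ?v)"
    by (simp add: inner_adj'[OF assms(1)] inner_adj[OF assms(1), symmetric] power2_eq_square[symmetric] power2_norm_eq_inner)
  also have "\<dots> \<le> norm x * norm (U ?v)" by (rule norm_cauchy_schwarz)
  also have "\<dots> \<le> norm x * norm ?v"
    by (intro mult_left_mono norm_apply_le assms) simp
  finally have "norm ?v \<le> norm x"
    by (cases "?v = 0") (auto simp: mult_le_cancel_right)
  then show "(norm ?v)\<^sup>2 \<le> (norm x)\<^sup>2" by (simp add: power_mono)
qed

text \<open>Positivity of the block operator with rows \<open>(P, -X)\<close> and \<open>(-X\<^sup>*, Q)\<close>; the signs do not matter,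
  as \<open>x\<close> may be replaced by \<open>-x\<close>. It is a linear condition on \<open>(P, Q, X)\<close>, which is the reason for
  measuring \<open>X\<close> by its dominating pairs.\<close>

definition dominates where
  "dominates P Q X \<longleftrightarrow> (\<forall>x y. 2 * inner x (blinfun_apply X y) \<le> inner x (blinfun_apply P x) + inner y (blinfun_apply Q y))"

context von_neumann
begin

lemma positive_root:
  assumes "P \<in> M" "nonneg_op P"
  obtains R where "R \<in> M" "nonneg_op R" "R o\<^sub>L R = P"
proof -
  obtain R where R: "nonneg_op R" "R o\<^sub>L R = P" using nonneg_root_exists[OF assms(2)] by blast
  then show thesis using that root_closed[of R] assms(1) by blast
qed

lemma power_closed: "A \<in> M \<Longrightarrow> power_op A n \<in> M"
  by (induction n) (auto intro: algebra_closed)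

lemma geom_op_closed: "A \<in> M \<Longrightarrow> geom_op A n \<in> M"
  unfolding geom_op_def by (induction n) (auto intro: algebra_closed power_closed)

lemma cutoff_closed: "A \<in> M \<Longrightarrow> cutoff A n \<in> M"
  unfolding cutoff_def by (auto intro: algebra_closed power_closed)

lemma abs_inner:
  assumes "X \<in> M"
  shows "inner (abs_op X u) (abs_op X v) = inner (X u) (X v)"
proof -
  have "inner (abs_op X u) (abs_op X v) = inner u ((abs_op X o\<^sub>L abs_op X) v)"
    using self_adjointD[OF nonneg_opD(2)[OF abs_op(2)[OF assms]]] by simp
  also have "\<dots> = inner (X u) (X v)"
    by (simp add: abs_op[OF assms] inner_adj'[OF in_bounded_ops[OF assms]])
  finally show ?thesis .
qed

lemma abs_norm:
  assumes "X \<in> M"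
  shows "norm (abs_op X u) = norm (X u)"
  using abs_inner[OF assms, of u u] by (simp add: norm_eq_sqrt_inner)

lemma abs_unit_interval:
  assumes "X \<in> M" "norm X \<le> 1"
  shows "unit_interval_op (abs_op X)"
proof
  show "nonneg_op (abs_op X)" using assms abs_op by simp
  have "norm (abs_op X) \<le> 1"
    by (rule norm_le_1_if_contractive) (simp add: abs_norm[OF assms(1)] norm_apply_le[OF assms(2)] power_mono)
  then show "nonneg_op (id_blinfun - abs_op X)"
    using assms abs_op by (intro nonneg_id_minus nonneg_opD) auto
qed

lemma abs_scaleC_op:
  assumes "X \<in> M" shows "abs_op (scaleC_op c X) = cmod c *\<^sub>R abs_op X"
proof (rule abs_op_eqI)
  show "scaleC_op c X \<in> M" using assms by (rule algebra_closed)
  show "nonneg_op (cmod c *\<^sub>R abs_op X)" using assms abs_op by (intro nonneg_op_intros) auto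
  have "adj (scaleC_op c X) o\<^sub>L scaleC_op c X = (cmod c)\<^sup>2 *\<^sub>R (adj X o\<^sub>L X)"
  proof (rule blinfun_eqI)
    fix x
    have "cnj c *\<^sub>C c *\<^sub>C adj X (X x) = (cmod c)\<^sup>2 *\<^sub>R adj X (X x)"
      by (simp only: scaleC_scaleC mult.commute[of "cnj c"] complex_norm_square[symmetric] scaleC_of_real)
    then show "(adj (scaleC_op c X) o\<^sub>L scaleC_op c X) x = ((cmod c)\<^sup>2 *\<^sub>R (adj X o\<^sub>L X)) x"
      using assms in_bounded_ops
      by (simp add: adj_scaleC_op scaleC_op_apply bounded_opsD[OF adj_bounded_ops] blinfun.scaleR_left)
  qed
  then show "cmod c *\<^sub>R abs_op X o\<^sub>L cmod c *\<^sub>R abs_op X = adj (scaleC_op c X) o\<^sub>L scaleC_op c X"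
    using abs_op[OF assms] by (simp add: compose_algebra power2_eq_square)
qed

lemma abs_scaleR:
  assumes "X \<in> M" "0 \<le> r" shows "abs_op (r *\<^sub>R X) = r *\<^sub>R abs_op X"
  using abs_scaleC_op[OF assms(1), of "of_real r"] assms by (simp add: scaleC_op_of_real)

text \<open>\<open>|X\<^sup>*|\<^sup>2 X = X X\<^sup>* X = X |X|\<^sup>2\<close>, and square roots respect this.\<close>

lemma abs_intertwine:
  assumes "X \<in> M"
  shows "abs_op (adj X) o\<^sub>L X = X o\<^sub>L abs_op X"
proof (rule nonneg_root_intertwine)
  show "abs_op (adj X) o\<^sub>L abs_op (adj X) o\<^sub>L X = X o\<^sub>L (abs_op X o\<^sub>L abs_op X)"
    using assms by (simp add: abs_op adj_closed adj_adj in_bounded_ops compose_assoc)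
qed (use assms in \<open>auto simp: abs_op adj_closed\<close>)

text \<open>Put \<open>S = |X\<^sup>*|\<close>, \<open>T = |X|\<close>. With the polar decomposition \<open>X = U T\<close> one would split
  \<open>\<langle>x, X y\<rangle> = \<langle>U\<^sup>* x, T y\<rangle>\<close>, apply Cauchy-Schwarz to the form of \<open>T\<close>, and use \<open>U T U\<^sup>* = S\<close>. Here
  \<open>X p\<^sub>n(T)\<close> takes the place of \<open>U\<close>: it gives \<open>E\<^sub>n S E\<^sub>n \<le> S\<close> in place of \<open>S\<close> (with the cutoff \<open>E\<^sub>n\<close>
  of \<open>S\<close>), and \<open>X (1 - T)\<^sup>n \<rightarrow> 0\<close> removes the error.\<close>

lemma dominates_abs_contraction:
  assumes X: "X \<in> M" and nX: "norm X \<le> 1"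
  shows "dominates (abs_op (adj X)) (abs_op X) X"
  unfolding dominates_def
proof (intro allI)
  fix x y
  let ?S = "abs_op (adj X)" and ?T = "abs_op X"
  have X': "adj X \<in> M" using X by (rule adj_closed)
  interpret T: unit_interval_op ?T using X nX by (rule abs_unit_interval)
  interpret S: unit_interval_op ?S
    using X' norm_adj_le[OF in_bounded_ops[OF X] nX] by (rule abs_unit_interval)
  have bX: "X \<in> bounded_ops" using X in_bounded_ops by blast
  have saT: "inner (?T u) v = inner u (?T v)" and saS: "inner (?S u) v = inner u (?S v)" for u v
    using self_adjointD nonneg_opD(2) T.T_nonneg S.T_nonneg by blast+
  have TX': "?T o\<^sub>L adj X = adj X o\<^sub>L ?S"
    using abs_intertwine[OF X'] by (simp add: adj_adj bX)
  have bound: "2 * inner x (X (cutoff ?T n y)) \<le> inner x (?S x) + inner y (?T y)" for n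
  proof -
    \<comment> \<open>The approximate \<open>U\<^sup>* x\<close>, equal to \<open>p\<^sub>n(T) X\<^sup>* x\<close> by the intertwining relation.\<close>
    define v where "v = adj X (geom_op ?S n x)"
    have gX: "geom_op ?T n (adj X x) = v"
      using arg_cong[OF geom_op_intertwine[OF TX', of n], of "\<lambda>f. blinfun_apply f x"] by (simp add: v_def)
    have "cutoff ?T n y = geom_op ?T n (?T y)"
      using arg_cong[OF geom_op_commute[of ?T n], of "\<lambda>f. blinfun_apply f y"]
      by (simp flip: compose_geom_op)
    then have "inner x (X (cutoff ?T n y)) = inner v (?T y)"
      using self_adjointD[OF nonneg_opD(2)[OF T.geom_op_nonneg[of n]]]
      by (simp add: inner_adj[OF bX, symmetric] gX[symmetric])
    moreover have "0 \<le> inner (v - y) (?T (v - y))" by (rule nonneg_opD(1)[OF T.T_nonneg])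
    then have "2 * inner v (?T y) \<le> inner v (?T v) + inner y (?T y)"
      using saT[of v y] by (simp add: blinfun.diff_right inner_diff inner_commute)
    moreover have "inner v (?T v) \<le> inner x (?S x)"
    proof -
      define e where "e = cutoff ?S n x"
      have e: "e = ?S (geom_op ?S n x)"
        by (simp add: e_def flip: compose_geom_op)
      have "?T v = adj X e"
        using arg_cong[OF TX', of "\<lambda>f. blinfun_apply f (geom_op ?S n x)"] by (simp add: v_def e)
      then have "inner v (?T v) = inner (adj X (geom_op ?S n x)) (adj X e)" by (simp add: v_def)
      also have "\<dots> = inner e (?S e)"
        by (simp add: abs_inner[OF X', symmetric] e)
      also have "\<dots> = inner x ((cutoff ?S n o\<^sub>L ?S o\<^sub>L cutoff ?S n) x)"
        using self_adjointD[OF nonneg_opD(2)[OF S.cutoff_nonneg[of n]]] by (simp add: e_def)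
      also have "\<dots> \<le> inner x (?S x)"
      proof -
        let ?E = "cutoff ?S n"
        \<comment> \<open>\<open>S - E S E = S (1 - E\<^sup>2)\<close> is a product of commuting positive operators.\<close>
        have SE: "?S o\<^sub>L ?E = ?E o\<^sub>L ?S"
          by (simp add: cutoff_def compose_algebra S.T_power_commute)
        have "norm (?E o\<^sub>L ?E) \<le> 1"
          using norm_blinfun_compose[of ?E ?E] mult_le_one[OF S.norm_cutoff _ S.norm_cutoff]
          by (meson norm_ge_zero order_trans)
        then have "nonneg_op (id_blinfun - (?E o\<^sub>L ?E))"
          by (rule nonneg_id_minus[OF nonneg_opD(2)[OF nonneg_op_intros(6)[OF nonneg_opD(2)[OF S.cutoff_nonneg]]]])
        moreover have "?S o\<^sub>L (id_blinfun - (?E o\<^sub>L ?E)) = (id_blinfun - (?E o\<^sub>L ?E)) o\<^sub>L ?S"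
          by (simp add: compose_algebra) (metis SE compose_assoc)
        ultimately have "nonneg_op (?S o\<^sub>L (id_blinfun - (?E o\<^sub>L ?E)))"
          by (intro nonneg_op_compose S.T_nonneg)
        moreover have "?S o\<^sub>L (id_blinfun - (?E o\<^sub>L ?E)) = ?S - (?E o\<^sub>L ?S o\<^sub>L ?E)"
          by (simp add: compose_algebra SE[symmetric] compose_assoc)
        ultimately have "0 \<le> inner x ((?S - (?E o\<^sub>L ?S o\<^sub>L ?E)) x)"
          using nonneg_opD(1) by metis
        then show ?thesis by (simp add: blinfun.diff_left inner_diff)
      qed
      finally show ?thesis .
    qed
    ultimately show ?thesis by linarith
  qed
  have "(\<lambda>n. X (power_op (id_blinfun - ?T) n y)) \<longlonglongrightarrow> 0"
    using T.T_power_tendsto[of y] tendsto_norm_zero_iff abs_norm[OF X]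
    by (metis (no_types, lifting) ext)
  then have "(\<lambda>n. 2 * inner x (X y - X (power_op (id_blinfun - ?T) n y))) \<longlonglongrightarrow> 2 * inner x (X y - 0)"
    by (intro tendsto_intros)
  moreover have "X y - X (power_op (id_blinfun - ?T) n y) = X (cutoff ?T n y)" for n
    by (simp add: cutoff_def blinfun.bilinear_simps)
  ultimately have "(\<lambda>n. 2 * inner x (X (cutoff ?T n y))) \<longlonglongrightarrow> 2 * inner x (X y)" by simp
  then show "2 * inner x (X y) \<le> inner x (?S x) + inner y (?T y)"
    by (rule LIMSEQ_le_const2) (use bound in blast)
qed

lemma contraction_scaling:
  fixes X :: "'a \<Rightarrow>\<^sub>L 'a"
  obtains r where "0 < r" "norm (r *\<^sub>R X) \<le> 1"
proof
  show "0 < 1 / (norm X + 1)" by (simp add: add_nonneg_pos)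
  have "0 < norm X + 1" by (simp add: add_nonneg_pos)
  then show "norm ((1 / (norm X + 1)) *\<^sub>R X) \<le> 1" by simp
qed

lemma dominates_abs:
  assumes X: "X \<in> M"
  shows "dominates (abs_op (adj X)) (abs_op X) X"
proof -
  obtain r where r: "0 < r" "norm (r *\<^sub>R X) \<le> 1" using contraction_scaling .
  have "dominates (r *\<^sub>R abs_op (adj X)) (r *\<^sub>R abs_op X) (r *\<^sub>R X)"
    using dominates_abs_contraction[OF algebra_closed(5)[OF X] r(2)] r X in_bounded_ops
    by (simp add: abs_scaleR adj_scaleR adj_closed)
  then show ?thesis
    using r unfolding dominates_def
    by (simp add: blinfun.scaleR_left mult.left_commute[of 2] distrib_left[symmetric] del: distrib_left_numeral)
qed

end

section \<open>Traces, and the trace norm as a minimum over dominating pairs\<close>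

locale traced_algebra = von_neumann M
  for M :: "('a::complex_hilbert_space \<Rightarrow>\<^sub>L 'a) set" +
  fixes \<rho> :: "('a \<Rightarrow>\<^sub>L 'a) \<Rightarrow> ennreal"
  assumes trace: "is_trace M \<rho>" and normal: "normal M \<rho>"
begin

lemma rho_add: "A \<in> M \<Longrightarrow> nonneg_op A \<Longrightarrow> B \<in> M \<Longrightarrow> nonneg_op B \<Longrightarrow> \<rho> (A + B) = \<rho> A + \<rho> B"
  using trace by (auto simp: is_trace_def pos_cone_iff)

lemma rho_scaleR: "A \<in> M \<Longrightarrow> nonneg_op A \<Longrightarrow> 0 \<le> r \<Longrightarrow> \<rho> (r *\<^sub>R A) = ennreal r * \<rho> A"
  using trace by (auto simp: is_trace_def pos_cone_iff)

lemma rho_adj_commute: "A \<in> M \<Longrightarrow> \<rho> (adj A o\<^sub>L A) = \<rho> (A o\<^sub>L adj A)"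
  using trace by (auto simp: is_trace_def)

lemma rho_mono:
  assumes "A \<in> M" "nonneg_op A" "B \<in> M" "nonneg_op (B - A)"
  shows "\<rho> A \<le> \<rho> B"
  using rho_add[of A "B - A"] assms by (simp add: algebra_closed)

text \<open>With \<open>R = \<surd>P\<close>, the trace property moves \<open>U\<close> to the inside:
  \<open>\<rho> ((R U)\<^sup>* (R U)) = \<rho> (R U U\<^sup>* R) \<le> \<rho> (R\<^sup>2)\<close>.\<close>

lemma rho_conj_le:
  assumes U: "U \<in> M" "norm U \<le> 1" and P: "P \<in> M" "nonneg_op P"
  shows "\<rho> (adj U o\<^sub>L P o\<^sub>L U) \<le> \<rho> P"
proof -
  obtain R where R: "R \<in> M" "nonneg_op R" "R o\<^sub>L R = P" using P by (rule positive_root)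
  have aR: "adj R = R" using R in_bounded_ops by (intro adj_self_adjoint nonneg_opD)
  have RU: "R o\<^sub>L U \<in> M" using R U by (intro algebra_closed)
  have aRU: "adj (R o\<^sub>L U) = adj U o\<^sub>L R" using R U aR by (simp add: adj_compose in_bounded_ops)
  have "\<rho> (adj U o\<^sub>L P o\<^sub>L U) = \<rho> (adj (R o\<^sub>L U) o\<^sub>L (R o\<^sub>L U))"
    by (simp add: aRU R(3)[symmetric] compose_assoc)
  also have "\<dots> = \<rho> ((R o\<^sub>L U) o\<^sub>L adj (R o\<^sub>L U))" by (rule rho_adj_commute[OF RU])
  also have "\<dots> \<le> \<rho> P"
  proof (rule rho_mono)
    show "R o\<^sub>L U o\<^sub>L adj (R o\<^sub>L U) \<in> M" using RU by (simp add: algebra_closed adj_closed)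
    show "nonneg_op (R o\<^sub>L U o\<^sub>L adj (R o\<^sub>L U))"
      using adj_compose_nonneg[OF adj_closed[OF RU]] by (simp add: adj_adj[OF in_bounded_ops[OF RU]])
    have aU: "adj U \<in> M" using U by (simp add: adj_closed)
    have nUU: "nonneg_op (U o\<^sub>L adj U)"
      using adj_compose_nonneg[OF aU] by (simp add: adj_adj U in_bounded_ops)
    have "norm (U o\<^sub>L adj U) \<le> 1"
      using norm_blinfun_compose[of U "adj U"] mult_le_one[OF U(2) _ norm_adj_le[OF in_bounded_ops[OF U(1)] U(2)]]
      by (meson norm_ge_zero order_trans)
    then have "nonneg_op (id_blinfun - (U o\<^sub>L adj U))"
      using nUU by (intro nonneg_id_minus nonneg_opD)
    then have "nonneg_op (R o\<^sub>L (id_blinfun - (U o\<^sub>L adj U)) o\<^sub>L R)"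
      using R by (intro nonneg_op_intros nonneg_opD)
    moreover have "R o\<^sub>L (id_blinfun - (U o\<^sub>L adj U)) o\<^sub>L R = P - (R o\<^sub>L U o\<^sub>L adj (R o\<^sub>L U))"
      by (simp add: compose_algebra R(3) aRU compose_assoc)
    ultimately show "nonneg_op (P - (R o\<^sub>L U o\<^sub>L adj (R o\<^sub>L U)))" by simp
  qed fact
  finally show ?thesis .
qed

text \<open>The operators \<open>T (1 - (1 - T)\<^sup>n)\<close> increase, and \<open>T\<close> is their least upper bound, because their
  quadratic forms converge to that of \<open>T\<close>. So this is an instance of normality.\<close>

lemma cutoff_convergence:
  assumes "T \<in> M" "unit_interval_op T"
  shows "\<rho> T = (SUP n. \<rho> (T o\<^sub>L cutoff T n))" "incseq (\<lambda>n. \<rho> (T o\<^sub>L cutoff T n))"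
proof -
  interpret unit_interval_op T by fact
  let ?f = "\<lambda>n. T o\<^sub>L cutoff T n"
  have eq: "?f n = T - (T o\<^sub>L power_op C n)" for n by (simp add: cutoff_def compose_algebra)
  have TE: "T o\<^sub>L cutoff T n = cutoff T n o\<^sub>L T" for n
    by (simp add: cutoff_def compose_algebra T_power_commute)
  have fM: "?f n \<in> M" and fn: "nonneg_op (?f n)" for n
    using assms by (auto simp: algebra_closed cutoff_closed intro!: nonneg_op_compose T_nonneg cutoff_nonneg TE)
  have step_nonneg: "nonneg_op (?f (Suc n) - ?f n)" for n
    unfolding eq using T_power_decreasing[of n] by (simp add: algebra_simps)
  show "incseq (\<lambda>n. \<rho> (?f n))"
    by (intro incseq_SucI rho_mono fM fn step_nonneg)
  have mono: "nonneg_op (?f n - ?f m)" if "m \<le> n" for m n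
    using that
  proof (induction n rule: dec_induct)
    case (step n)
    have "?f (Suc n) - ?f m = (?f (Suc n) - ?f n) + (?f n - ?f m)" by simp
    then show ?case using nonneg_op_intros(3)[OF step_nonneg[of n] step.IH] by simp
  qed (simp add: nonneg_op_intros)
  have le: "op_le A B \<longleftrightarrow> nonneg_op (B - A)" if "A \<in> M" "B \<in> M" for A B
    using that in_bounded_ops algebra_closed by (simp add: op_le_def positive_op_iff)
  have lub: "nonneg_op (Z - T)" if "nonneg_op Z" "\<And>n. nonneg_op (Z - ?f n)" for Z
  proof -
    have "inner x (T x) \<le> inner x (Z x)" for x
    proof (rule LIMSEQ_le_const2)
      have "(\<lambda>n. inner x (T x) - inner x ((T o\<^sub>L power_op C n) x)) \<longlonglongrightarrow> inner x (T x) - 0"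
        by (intro tendsto_intros T_power_form_tendsto)
      then show "(\<lambda>n. inner x (?f n x)) \<longlonglongrightarrow> inner x (T x)"
        by (simp add: eq blinfun.diff_left inner_diff)
      have "inner x (?f n x) \<le> inner x (Z x)" for n
        using nonneg_opD(1)[OF that(2)[of n], of x] by (simp add: blinfun.diff_left inner_diff)
      then show "\<exists>N. \<forall>n\<ge>N. inner x (?f n x) \<le> inner x (Z x)" by blast
    qed
    moreover have "self_adjoint (Z - T)"
      using that(1) T_nonneg by (intro self_adjoint_intros nonneg_opD)
    ultimately show ?thesis by (simp add: nonneg_op_def blinfun.diff_left inner_diff)
  qed
  have "\<rho> T = (SUP X\<in>range ?f. \<rho> X)"
  proof (rule normal[unfolded normal_def, rule_format], intro conjI ballI allI impI)
    show "range ?f \<subseteq> pos_cone M" using fM fn by (auto simp: pos_cone_iff)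
    show "T \<in> pos_cone M" using assms T_nonneg by (auto simp: pos_cone_iff)
    show "op_le X T" if "X \<in> range ?f" for X
      using that T_power_nonneg fM assms by (auto simp: le eq)
    show "op_le T Z" if "Z \<in> pos_cone M" "\<forall>X\<in>range ?f. op_le X Z" for Z
      using that lub[of Z] fM assms by (auto simp: le pos_cone_iff)
    fix X Y assume "X \<in> range ?f" "Y \<in> range ?f"
    then obtain m n where "X = ?f m" "Y = ?f n" by auto
    then have "op_le X (?f (max m n)) \<and> op_le Y (?f (max m n))"
      using mono[of m "max m n"] mono[of n "max m n"] by (simp add: le fM)
    then show "\<exists>Z\<in>range ?f. op_le X Z \<and> op_le Y Z" by blast
  qed simp
  then show "\<rho> T = (SUP n. \<rho> (?f n))" by (simp add: image_image)
qed

lemma tail_convergence: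
  assumes "T \<in> M" "unit_interval_op T" "\<rho> T < \<infinity>" "0 < e"
  obtains n where "\<rho> (T o\<^sub>L power_op (id_blinfun - T) n) < ennreal e"
proof -
  interpret unit_interval_op T by fact
  note cc = cutoff_convergence[OF assms(1,2)]
  have nn: "nonneg_op (T o\<^sub>L cutoff T n)" for n
    by (rule nonneg_op_compose[OF T_nonneg cutoff_nonneg])
       (simp add: cutoff_def compose_algebra T_power_commute)
  have sum: "\<rho> T = \<rho> (T o\<^sub>L power_op C n) + \<rho> (T o\<^sub>L cutoff T n)" for n
  proof -
    have "T = (T o\<^sub>L power_op C n) + (T o\<^sub>L cutoff T n)" by (simp add: cutoff_def compose_algebra)
    moreover have "T o\<^sub>L power_op C n \<in> M" "T o\<^sub>L cutoff T n \<in> M"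
      using assms by (auto intro!: algebra_closed power_closed cutoff_closed)
    ultimately show ?thesis using rho_add[OF _ T_power_nonneg _ nn] by metis
  qed
  show thesis
  proof (cases "\<rho> T = 0")
    case True
    then have "\<rho> (T o\<^sub>L power_op C 0) = 0" using sum[of 0] by (metis add_eq_0_iff_both_eq_0)
    then show thesis using assms(4) by (intro that[of 0]) simp
  next
    case False
    have "\<rho> T - ennreal e < \<rho> T"
      using False assms by (cases "\<rho> T") (auto simp: ennreal_minus intro!: ennreal_lessI)
    then have "\<exists>n. \<rho> T - ennreal e < \<rho> (T o\<^sub>L cutoff T n)"
      by (subst (asm) (2) cc(1)) (auto simp: less_SUP_iff)
    then obtain n where n: "\<rho> T - ennreal e < \<rho> (T o\<^sub>L cutoff T n)" by blast
    have "\<rho> (T o\<^sub>L power_op C n) < ennreal e"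
    proof (rule ccontr)
      assume "\<not> ?thesis"
      then have "ennreal e + \<rho> (T o\<^sub>L cutoff T n) \<le> \<rho> T" by (subst sum[of n]) (intro add_right_mono, simp)
      then have "\<rho> (T o\<^sub>L cutoff T n) \<le> \<rho> T - ennreal e"
        using ennreal_minus_mono[of "ennreal e + \<rho> (T o\<^sub>L cutoff T n)" "\<rho> T" "ennreal e" "ennreal e"] by simp
      with n show False by simp
    qed
    then show thesis by (rule that)
  qed
qed

text \<open>With a polar decomposition \<open>X = U |X|\<close>, the choice \<open>x = U y\<close> in the definition of domination gives
  \<open>2 |X| \<le> U\<^sup>* P U + Q\<close>, and \<open>\<rho> (U\<^sup>* P U) \<le> \<rho> P\<close>. The approximate polar part \<open>X p\<^sub>n(|X|)\<close> is a
  contraction as well and gives the same with \<open>|X| E\<^sub>n\<close> in place of \<open>|X|\<close>, whose trace tends to that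
  of \<open>|X|\<close>. The cutoffs require \<open>\<parallel>X\<parallel> \<le> 1\<close>; the general case follows by scaling.\<close>

lemma rho_abs_le:
  assumes X: "X \<in> M" and P: "P \<in> M" "nonneg_op P" and Q: "Q \<in> M" "nonneg_op Q"
    and dom: "dominates P Q X"
  shows "2 * \<rho> (abs_op X) \<le> \<rho> P + \<rho> Q"
proof -
  have contr: "2 * \<rho> (abs_op X) \<le> \<rho> P + \<rho> Q"
    if X: "X \<in> M" and P: "P \<in> M" "nonneg_op P" and Q: "Q \<in> M" "nonneg_op Q"
      and dom: "dominates P Q X" and nX: "norm X \<le> 1" for X P Q
  proof -
    let ?T = "abs_op X"
    have T: "?T \<in> M" using abs_op X by blast
    have ui: "unit_interval_op ?T" using X nX by (rule abs_unit_interval)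
    interpret unit_interval_op ?T by (rule ui)
    have le: "2 * \<rho> (?T o\<^sub>L cutoff ?T n) \<le> \<rho> P + \<rho> Q" for n
    proof -
      let ?E = "cutoff ?T n"
      define U where "U = X o\<^sub>L geom_op ?T n"
      have U: "U \<in> M" using X T by (auto simp: U_def intro!: algebra_closed geom_op_closed)
      have TE: "?T o\<^sub>L ?E = ?E o\<^sub>L ?T"
        by (simp add: cutoff_def compose_algebra T_power_commute)
      have EU: "?T (geom_op ?T n y) = ?E y" for y by (simp flip: compose_geom_op)
      have "norm (U y) = norm (?E y)" for y
        by (simp add: U_def abs_norm[OF X, symmetric] EU)
      then have nU: "norm U \<le> 1"
        by (intro norm_le_1_if_contractive) (simp add: norm_apply_le[OF norm_cutoff] power_mono)
      have UX: "inner (U y) (X y) = inner y ((?T o\<^sub>L ?E) y)" for y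
        by (simp add: U_def abs_inner[OF X, symmetric] EU TE self_adjointD[OF nonneg_opD(2)[OF cutoff_nonneg]])
      have TEM: "?T o\<^sub>L ?E \<in> M" using T by (auto intro!: algebra_closed cutoff_closed)
      have TEn: "nonneg_op (?T o\<^sub>L ?E)" by (intro nonneg_op_compose T_nonneg cutoff_nonneg TE)
      have UPM: "adj U o\<^sub>L P o\<^sub>L U \<in> M" using U P by (intro algebra_closed adj_closed)
      have bU: "U \<in> bounded_ops" using U by (rule in_bounded_ops)
      have UPn: "nonneg_op (adj U o\<^sub>L P o\<^sub>L U)"
        using P nonneg_opD[of P] self_adjointD[of P]
        by (auto simp: nonneg_op_def self_adjoint_def inner_adj[OF bU] inner_adj'[OF bU])
      have "nonneg_op (((adj U o\<^sub>L P o\<^sub>L U) + Q) - 2 *\<^sub>R (?T o\<^sub>L ?E))"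
        unfolding nonneg_op_def
      proof (intro conjI allI)
        show "self_adjoint (((adj U o\<^sub>L P o\<^sub>L U) + Q) - 2 *\<^sub>R (?T o\<^sub>L ?E))"
          using UPn TEn Q by (intro self_adjoint_intros nonneg_opD)
        fix y
        have "2 * inner (U y) (X y) \<le> inner (U y) (P (U y)) + inner y (Q y)"
          using dom unfolding dominates_def by blast
        then show "0 \<le> inner y ((((adj U o\<^sub>L P o\<^sub>L U) + Q) - 2 *\<^sub>R (?T o\<^sub>L ?E)) y)"
          unfolding UX by (simp add: blinfun.bilinear_simps inner_add inner_diff inner_adj'[OF bU])
      qed
      then have "\<rho> (2 *\<^sub>R (?T o\<^sub>L ?E)) \<le> \<rho> ((adj U o\<^sub>L P o\<^sub>L U) + Q)"
        using UPM TEM Q TEn by (intro rho_mono algebra_closed(3,5) nonneg_op_intros(4)) auto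
      also have "\<dots> = \<rho> (adj U o\<^sub>L P o\<^sub>L U) + \<rho> Q" using UPM UPn Q by (rule rho_add)
      also have "\<dots> \<le> \<rho> P + \<rho> Q" using rho_conj_le[OF U nU P] by (rule add_right_mono)
      finally show ?thesis using TEM TEn by (simp add: rho_scaleR)
    qed
    have "2 * \<rho> ?T = (SUP n. 2 * \<rho> (?T o\<^sub>L cutoff ?T n))"
      by (subst cutoff_convergence(1)[OF T ui]) (rule SUP_mult_left_ennreal)
    also have "\<dots> \<le> \<rho> P + \<rho> Q" using le by (rule SUP_least)
    finally show ?thesis .
  qed
  obtain r where r: "0 < r" "norm (r *\<^sub>R X) \<le> 1" using contraction_scaling .
  have "dominates (r *\<^sub>R P) (r *\<^sub>R Q) (r *\<^sub>R X)"
    using dom r unfolding dominates_def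
    by (simp add: blinfun.scaleR_left mult.left_commute[of 2] distrib_left[symmetric] del: distrib_left_numeral)
  then have "2 * \<rho> (abs_op (r *\<^sub>R X)) \<le> \<rho> (r *\<^sub>R P) + \<rho> (r *\<^sub>R Q)"
    using X P Q r by (intro contr algebra_closed nonneg_op_intros) auto
  then have "ennreal r * (2 * \<rho> (abs_op X)) \<le> ennreal r * (\<rho> P + \<rho> Q)"
    using X P Q r by (simp add: abs_scaleR rho_scaleR abs_op distrib_left mult.left_commute)
  then show ?thesis using r by (simp add: ennreal_mult_le_mult_iff)
qed

text \<open>For \<open>S = |X\<^sup>*|\<close>, \<open>T = |X|\<close> and \<open>\<parallel>X\<parallel> \<le> 1\<close> the operators \<open>S E\<^sub>n(S) = X p\<^sub>n(T) X\<^sup>*\<close> and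
  \<open>T E\<^sub>n(T) = \<surd>p\<^sub>n(T) X\<^sup>* X \<surd>p\<^sub>n(T)\<close> have the form \<open>V V\<^sup>*\<close> and \<open>V\<^sup>* V\<close> with \<open>V = X \<surd>p\<^sub>n(T)\<close>, hence
  equal trace; now let \<open>n \<rightarrow> \<infinity>\<close>.\<close>

lemma rho_abs_adj_le:
  assumes X: "X \<in> M"
  shows "\<rho> (abs_op (adj X)) \<le> \<rho> (abs_op X)"
proof -
  have contr: "\<rho> (abs_op (adj X)) \<le> \<rho> (abs_op X)" if X: "X \<in> M" and nX: "norm X \<le> 1" for X
  proof -
    let ?S = "abs_op (adj X)" and ?T = "abs_op X"
    have X': "adj X \<in> M" using X by (rule adj_closed)
    have bX: "X \<in> bounded_ops" using X by (rule in_bounded_ops)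
    have uT: "unit_interval_op ?T" using X nX by (rule abs_unit_interval)
    have uS: "unit_interval_op ?S" using X' norm_adj_le[OF bX nX] by (rule abs_unit_interval)
    interpret T: unit_interval_op ?T by (rule uT)
    have SM: "?S \<in> M" and TM: "?T \<in> M" using X X' abs_op by auto
    have "\<rho> (?S o\<^sub>L cutoff ?S n) \<le> \<rho> ?T" for n
    proof -
      obtain R where R: "R \<in> M" "nonneg_op R" "R o\<^sub>L R = geom_op ?T n"
        using positive_root[OF geom_op_closed[OF TM] T.geom_op_nonneg] .
      have aR: "adj R = R" using R in_bounded_ops by (intro adj_self_adjoint nonneg_opD)
      have XR: "X o\<^sub>L R \<in> M" using X R by (intro algebra_closed)
      have aXR: "adj (X o\<^sub>L R) = R o\<^sub>L adj X" using X R by (simp add: adj_compose in_bounded_ops aR)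
      have "?S o\<^sub>L cutoff ?S n = ?S o\<^sub>L ?S o\<^sub>L geom_op ?S n"
        by (simp add: compose_assoc flip: compose_geom_op)
      also have "\<dots> = geom_op ?S n o\<^sub>L (?S o\<^sub>L ?S)"
        by (rule geom_op_intertwine[symmetric]) (simp add: compose_assoc)
      also have "\<dots> = geom_op ?S n o\<^sub>L X o\<^sub>L adj X"
        using abs_op(3)[OF X'] by (simp add: adj_adj bX compose_assoc)
      also have "geom_op ?S n o\<^sub>L X = X o\<^sub>L geom_op ?T n"
        using abs_intertwine[OF X] by (rule geom_op_intertwine)
      finally have SS: "?S o\<^sub>L cutoff ?S n = (X o\<^sub>L R) o\<^sub>L adj (X o\<^sub>L R)"
        by (simp add: aXR R(3)[symmetric] compose_assoc)
      have RT: "R o\<^sub>L ?T = ?T o\<^sub>L R"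
        by (rule nonneg_root_intertwine) (simp_all add: R geom_op_commute)
      have "adj (X o\<^sub>L R) o\<^sub>L (X o\<^sub>L R) = R o\<^sub>L (?T o\<^sub>L ?T) o\<^sub>L R"
        by (simp add: aXR abs_op(3)[OF X] compose_assoc)
      also have "\<dots> = ?T o\<^sub>L (?T o\<^sub>L (R o\<^sub>L R))"
        by (metis RT compose_assoc)
      also have "\<dots> = ?T o\<^sub>L cutoff ?T n" by (simp add: R(3) compose_geom_op)
      finally have "\<rho> (?S o\<^sub>L cutoff ?S n) = \<rho> (?T o\<^sub>L cutoff ?T n)"
        using rho_adj_commute[OF XR] SS by simp
      also have "\<dots> \<le> (SUP n. \<rho> (?T o\<^sub>L cutoff ?T n))" by (rule SUP_upper) simp
      also have "\<dots> = \<rho> ?T" by (rule cutoff_convergence(1)[OF TM uT, symmetric])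
      finally show ?thesis .
    qed
    then show ?thesis by (subst cutoff_convergence(1)[OF SM uS]) (rule SUP_least)
  qed
  obtain r where r: "0 < r" "norm (r *\<^sub>R X) \<le> 1" using contraction_scaling .
  have "\<rho> (abs_op (adj (r *\<^sub>R X))) \<le> \<rho> (abs_op (r *\<^sub>R X))"
    using X r by (intro contr algebra_closed)
  then have "ennreal r * \<rho> (abs_op (adj X)) \<le> ennreal r * \<rho> (abs_op X)"
    using X r by (simp add: adj_scaleR in_bounded_ops abs_scaleR adj_closed rho_scaleR abs_op)
  then show ?thesis using r by (simp add: ennreal_mult_le_mult_iff)
qed

lemma rho_abs_add:
  assumes X: "X \<in> M" and Y: "Y \<in> M"
  shows "\<rho> (abs_op (X + Y)) \<le> \<rho> (abs_op X) + \<rho> (abs_op Y)"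
proof -
  have X': "adj X \<in> M" "adj Y \<in> M" using X Y by (auto intro: adj_closed)
  have "dominates (abs_op (adj X) + abs_op (adj Y)) (abs_op X + abs_op Y) (X + Y)"
    unfolding dominates_def
  proof (intro allI)
    fix x y
    have "2 * inner x (X y) \<le> inner x (abs_op (adj X) x) + inner y (abs_op X y)"
      "2 * inner x (Y y) \<le> inner x (abs_op (adj Y) x) + inner y (abs_op Y y)"
      using dominates_abs[OF X] dominates_abs[OF Y] unfolding dominates_def by blast+
    then show "2 * inner x ((X + Y) y) \<le> inner x ((abs_op (adj X) + abs_op (adj Y)) x) + inner y ((abs_op X + abs_op Y) y)"
      by (simp add: blinfun.add_left inner_add)
  qed
  then have "2 * \<rho> (abs_op (X + Y)) \<le> \<rho> (abs_op (adj X) + abs_op (adj Y)) + \<rho> (abs_op X + abs_op Y)"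
    using X Y X' by (intro rho_abs_le algebra_closed nonneg_op_intros abs_op)
  also have "\<dots> \<le> (\<rho> (abs_op X) + \<rho> (abs_op Y)) + (\<rho> (abs_op X) + \<rho> (abs_op Y))"
    using X Y X' by (auto simp: rho_add abs_op intro!: add_mono rho_abs_adj_le)
  also have "\<dots> = 2 * (\<rho> (abs_op X) + \<rho> (abs_op Y))" by (simp add: mult_2)
  finally show ?thesis by (simp add: ennreal_mult_le_mult_iff del: distrib_left_numeral)
qed

text \<open>The pair \<open>(t A\<^sup>* A, t\<^sup>-\<^sup>1 B\<^sup>* B)\<close> dominates \<open>A\<^sup>* B\<close> for every \<open>t > 0\<close>; the optimal \<open>t\<close> is \<open>b / a\<close>.\<close>

lemma rho_abs_compose_le:
  assumes A: "A \<in> M" and B: "B \<in> M"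
    and "0 < a" "0 < b" "\<rho> (adj A o\<^sub>L A) \<le> ennreal (a\<^sup>2)" "\<rho> (adj B o\<^sub>L B) \<le> ennreal (b\<^sup>2)"
  shows "\<rho> (abs_op (adj A o\<^sub>L B)) \<le> ennreal (a * b)"
proof -
  define t where "t = b / a"
  have t: "0 < t" using assms by (simp add: t_def)
  let ?P = "t *\<^sub>R (adj A o\<^sub>L A)" and ?Q = "(1/t) *\<^sub>R (adj B o\<^sub>L B)"
  have bA: "A \<in> bounded_ops" and bB: "B \<in> bounded_ops" using A B by (auto intro: in_bounded_ops)
  have "dominates ?P ?Q (adj A o\<^sub>L B)"
    unfolding dominates_def
  proof (intro allI)
    fix x y
    have "0 \<le> (norm (sqrt t *\<^sub>R A x - sqrt (1/t) *\<^sub>R B y))\<^sup>2" by simp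
    also have "\<dots> = t * inner (A x) (A x) + (1/t) * inner (B y) (B y) - 2 * inner (A x) (B y)"
      using t unfolding power2_norm_eq_inner
      by (simp add: inner_diff inner_commute real_sqrt_divide)
    finally show "2 * inner x ((adj A o\<^sub>L B) y) \<le> inner x (?P x) + inner y (?Q y)"
      by (simp add: blinfun.scaleR_left inner_adj'[OF bA] inner_adj'[OF bB])
  qed
  then have "2 * \<rho> (abs_op (adj A o\<^sub>L B)) \<le> \<rho> ?P + \<rho> ?Q"
    using A B t adj_closed[OF A] adj_closed[OF B]
    by (intro rho_abs_le algebra_closed(5,7) nonneg_op_intros(4) adj_compose_nonneg) auto
  also have "\<dots> = ennreal t * \<rho> (adj A o\<^sub>L A) + ennreal (1/t) * \<rho> (adj B o\<^sub>L B)"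
    using A B t by (simp add: rho_scaleR algebra_closed(7) adj_closed adj_compose_nonneg)
  also have "\<dots> \<le> ennreal t * ennreal (a\<^sup>2) + ennreal (1/t) * ennreal (b\<^sup>2)"
    using assms by (intro add_mono mult_left_mono) auto
  also have "\<dots> = ennreal (t * a\<^sup>2 + (1/t) * b\<^sup>2)"
    using t by (simp add: ennreal_mult[symmetric] ennreal_plus[symmetric] del: ennreal_plus)
  also have "t * a\<^sup>2 + (1/t) * b\<^sup>2 = 2 * (a * b)"
    using assms by (simp add: t_def power2_eq_square)
  also have "ennreal (2 * (a * b)) = 2 * ennreal (a * b)"
    using assms by (simp add: ennreal_mult)
  finally show ?thesis by (simp add: ennreal_mult_le_mult_iff)
qed

text \<open>This plays the role of \<open>|\<rho> (Y\<^sup>* A)| \<le> \<parallel>Y\<parallel>\<^sub>\<infinity> \<parallel>A\<parallel>\<^sub>1\<close>, but stays inside the positive cone, where the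
  trace is defined. Domination of \<open>A\<close> by \<open>(|A\<^sup>*|, |A|)\<close>, applied to \<open>x = B z\<close>, \<open>y = z\<close> with the
  contraction \<open>B = Y / c\<close>, bounds the mixed term of
  \<open>(Y - A)\<^sup>* (Y - A) = Y\<^sup>* Y + A\<^sup>* A - (Y\<^sup>* A + A\<^sup>* Y)\<close> by \<open>c (B\<^sup>* |A\<^sup>*| B + |A|)\<close>.\<close>

lemma rho_square_le:
  assumes Y: "Y \<in> M" "norm Y \<le> c" and c: "0 < c" and A: "A \<in> M"
  shows "\<rho> (adj Y o\<^sub>L Y) \<le> \<rho> (adj (Y - A) o\<^sub>L (Y - A)) + ennreal (2 * c) * \<rho> (abs_op A)"
proof -
  define B where "B = (1/c) *\<^sub>R Y"
  have B: "B \<in> M" using Y by (auto simp: B_def intro: algebra_closed)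
  have nB: "norm B \<le> 1" using Y c by (simp add: B_def)
  have bY: "Y \<in> bounded_ops" and bA: "A \<in> bounded_ops" and bB: "B \<in> bounded_ops" and bD: "Y - A \<in> bounded_ops"
    using Y A B by (auto intro!: in_bounded_ops algebra_closed)
  have A': "adj A \<in> M" using A by (rule adj_closed)
  let ?P = "abs_op (adj A)" and ?Q = "abs_op A"
  let ?D = "adj (Y - A) o\<^sub>L (Y - A)"
  let ?K = "adj B o\<^sub>L ?P o\<^sub>L B"
  have D: "?D \<in> M" "nonneg_op ?D" using Y A by (auto intro!: algebra_closed adj_closed adj_compose_nonneg)
  have K: "?K \<in> M" using A A' B by (intro algebra_closed adj_closed abs_op)
  have Kn: "nonneg_op ?K"
    using abs_op(2)[OF A'] self_adjointD[OF nonneg_opD(2)[OF abs_op(2)[OF A']]]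
    by (auto simp: nonneg_op_def self_adjoint_def inner_adj[OF bB] inner_adj'[OF bB])
  have YY: "adj Y o\<^sub>L Y \<in> M" "nonneg_op (adj Y o\<^sub>L Y)"
    using Y by (auto intro!: algebra_closed adj_closed adj_compose_nonneg)
  have cQ: "c *\<^sub>R ?Q \<in> M" "nonneg_op (c *\<^sub>R ?Q)" "c *\<^sub>R ?K \<in> M" "nonneg_op (c *\<^sub>R ?K)"
    using A c K Kn by (auto intro!: algebra_closed nonneg_op_intros abs_op)
  have "nonneg_op ((?D + (c *\<^sub>R ?Q + c *\<^sub>R ?K)) - (adj Y o\<^sub>L Y))"
    unfolding nonneg_op_def
  proof (intro conjI allI)
    show "self_adjoint ((?D + (c *\<^sub>R ?Q + c *\<^sub>R ?K)) - (adj Y o\<^sub>L Y))"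
      using D cQ YY by (intro self_adjoint_intros nonneg_opD)
    fix z
    have "2 * inner (B z) (A z) \<le> inner (B z) (?P (B z)) + inner z (?Q z)"
      using dominates_abs[OF A] unfolding dominates_def by blast
    then have "c * (2 * inner (B z) (A z)) \<le> c * (inner (B z) (?P (B z)) + inner z (?Q z))"
      using c by (intro mult_left_mono) auto
    moreover have "c * (2 * inner (B z) (A z)) = 2 * inner (Y z) (A z)"
      using c by (simp add: B_def blinfun.scaleR_left)
    moreover have "inner z (?D z) = inner (Y z) (Y z) + inner (A z) (A z) - 2 * inner (Y z) (A z)"
      by (simp add: inner_adj'[OF bD]) (simp add: blinfun.diff_left inner_diff inner_commute)
    moreover have "0 \<le> inner (A z) (A z)" by simp
    ultimately show "0 \<le> inner z (((?D + (c *\<^sub>R ?Q + c *\<^sub>R ?K)) - (adj Y o\<^sub>L Y)) z)"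
      by (simp add: blinfun.bilinear_simps inner_add inner_diff inner_adj'[OF bY] inner_adj'[OF bB] distrib_left
          del: inner_ge_zero)
  qed
  then have "\<rho> (adj Y o\<^sub>L Y) \<le> \<rho> (?D + (c *\<^sub>R ?Q + c *\<^sub>R ?K))"
    using YY D cQ by (intro rho_mono algebra_closed(3)) auto
  also have "\<dots> = \<rho> ?D + (ennreal c * \<rho> ?Q + ennreal c * \<rho> ?K)"
    using D cQ c A K Kn by (simp add: rho_add algebra_closed nonneg_op_intros rho_scaleR abs_op)
  also have "\<dots> \<le> \<rho> ?D + (ennreal c * \<rho> ?Q + ennreal c * \<rho> ?Q)"
    using rho_conj_le[OF B nB abs_op(1,2)[OF A']] rho_abs_adj_le[OF A]
    by (intro add_left_mono mult_left_mono) auto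
  also have "\<dots> = \<rho> ?D + ennreal (2 * c) * \<rho> ?Q"
  proof -
    have "ennreal (2 * c) = ennreal c + ennreal c" using c by (simp flip: ennreal_plus)
    then show ?thesis by (simp only: distrib_right)
  qed
  finally show ?thesis .
qed

section \<open>The norms of bounded elements\<close>

lemma pnorm_1: "pnorm \<rho> 1 X = enn2real (\<rho> (abs_op X))"
  by (simp add: pnorm_def)

lemma L1_iff: "X \<in> Lp_bdd M \<rho> 1 \<longleftrightarrow> X \<in> M \<and> \<rho> (abs_op X) < \<infinity>"
  by (simp add: Lp_bdd_def)

lemmas L1_simps = pnorm_1 pnorm_1[unfolded One_nat_def] L1_iff L1_iff[unfolded One_nat_def]

lemma square_abs: "X \<in> M \<Longrightarrow> power_op (abs_op X) 2 = adj X o\<^sub>L X"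
  by (simp add: numeral_2_eq_2 abs_op)

lemma pnorm_2: "X \<in> M \<Longrightarrow> pnorm \<rho> 2 X = sqrt (enn2real (\<rho> (adj X o\<^sub>L X)))"
  by (simp add: pnorm_def square_abs sqrt_def)

lemma L2_iff: "X \<in> Lp_bdd M \<rho> 2 \<longleftrightarrow> X \<in> M \<and> \<rho> (adj X o\<^sub>L X) < \<infinity>"
  by (auto simp: Lp_bdd_def square_abs)

lemma L1_I:
  assumes "X \<in> M" "\<rho> (abs_op X) \<le> ennreal r" "0 \<le> r"
  shows "X \<in> Lp_bdd M \<rho> 1 \<and> pnorm \<rho> 1 X \<le> r"
  using assms by (auto simp: L1_simps enn2real_leI intro: le_less_trans)

lemma L2_I:
  assumes "X \<in> M" "\<rho> (adj X o\<^sub>L X) \<le> ennreal (r\<^sup>2)" "0 \<le> r"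
  shows "X \<in> Lp_bdd M \<rho> 2 \<and> pnorm \<rho> 2 X \<le> r"
  using assms by (auto simp: L2_iff pnorm_2 enn2real_leI real_le_lsqrt intro: le_less_trans)

lemma rho_abs_eq: "X \<in> Lp_bdd M \<rho> 1 \<Longrightarrow> \<rho> (abs_op X) = ennreal (pnorm \<rho> 1 X)"
  by (simp add: L1_simps)

lemma rho_square_eq: "X \<in> Lp_bdd M \<rho> 2 \<Longrightarrow> \<rho> (adj X o\<^sub>L X) = ennreal ((pnorm \<rho> 2 X)\<^sup>2)"
  by (simp add: L2_iff pnorm_2)

lemma pnorm_nonneg: "0 < p \<Longrightarrow> 0 \<le> pnorm \<rho> p X"
  by (simp add: pnorm_def)

text \<open>\<open>(A + B)\<^sup>* (A + B) \<le> (1 + t) A\<^sup>* A + (1 + t\<^sup>-\<^sup>1) B\<^sup>* B\<close> for every \<open>t > 0\<close>, and \<open>t = b / a\<close> turns the bound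
  \<open>(1 + t) a\<^sup>2 + (1 + t\<^sup>-\<^sup>1) b\<^sup>2\<close> into \<open>(a + b)\<^sup>2\<close>. Strictly positive bounds \<open>a, b\<close> of the norms are used
  because the norms themselves may vanish.\<close>

lemma L2_add:
  assumes A: "A \<in> Lp_bdd M \<rho> 2" and B: "B \<in> Lp_bdd M \<rho> 2"
  shows "A + B \<in> Lp_bdd M \<rho> 2 \<and> pnorm \<rho> 2 (A + B) \<le> pnorm \<rho> 2 A + pnorm \<rho> 2 B"
proof -
  have AM: "A \<in> M" and BM: "B \<in> M" using A B by (auto simp: L2_iff)
  have bA: "A \<in> bounded_ops" and bB: "B \<in> bounded_ops" and bAB: "A + B \<in> bounded_ops"
    using AM BM by (auto intro!: in_bounded_ops algebra_closed)
  have main: "A + B \<in> Lp_bdd M \<rho> 2 \<and> pnorm \<rho> 2 (A + B) \<le> a + b"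
    if a: "pnorm \<rho> 2 A \<le> a" "0 < a" and b: "pnorm \<rho> 2 B \<le> b" "0 < b" for a b
  proof (rule L2_I)
    show "A + B \<in> M" using AM BM by (rule algebra_closed)
    define t where "t = b / a"
    have t: "0 < t" using a b by (simp add: t_def)
    let ?P = "(1 + t) *\<^sub>R (adj A o\<^sub>L A)" and ?Q = "(1 + 1/t) *\<^sub>R (adj B o\<^sub>L B)"
    have M: "adj A o\<^sub>L A \<in> M" "adj B o\<^sub>L B \<in> M" "adj (A + B) o\<^sub>L (A + B) \<in> M"
      using AM BM by (auto intro!: algebra_closed adj_closed)
    have nn: "nonneg_op (adj A o\<^sub>L A)" "nonneg_op (adj B o\<^sub>L B)" "nonneg_op (adj (A + B) o\<^sub>L (A + B))"
      using AM BM by (auto intro!: adj_compose_nonneg algebra_closed)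
    have PQ: "nonneg_op ?P" "nonneg_op ?Q" using nn t by (auto intro!: nonneg_op_intros)
    have "nonneg_op ((?P + ?Q) - (adj (A + B) o\<^sub>L (A + B)))"
      unfolding nonneg_op_def
    proof (intro conjI allI)
      show "self_adjoint ((?P + ?Q) - (adj (A + B) o\<^sub>L (A + B)))"
        using PQ nn by (intro self_adjoint_intros(3,4) nonneg_opD)
      fix x
      have "0 \<le> (norm (sqrt t *\<^sub>R A x - sqrt (1/t) *\<^sub>R B x))\<^sup>2" by simp
      also have "\<dots> = t * inner (A x) (A x) + (1/t) * inner (B x) (B x) - 2 * inner (A x) (B x)"
        using t unfolding power2_norm_eq_inner
        by (simp add: inner_diff inner_commute real_sqrt_divide)
      also have "\<dots> = inner x (((?P + ?Q) - (adj (A + B) o\<^sub>L (A + B))) x)"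
        by (simp add: blinfun.diff_left blinfun.add_left[of ?P] blinfun.scaleR_left inner_add_right inner_diff_right
             inner_adj'[OF bA] inner_adj'[OF bB] inner_adj'[OF bAB])
           (simp add: blinfun.add_left inner_add inner_commute algebra_simps)
      finally show "0 \<le> inner x (((?P + ?Q) - (adj (A + B) o\<^sub>L (A + B))) x)" .
    qed
    then have "\<rho> (adj (A + B) o\<^sub>L (A + B)) \<le> \<rho> (?P + ?Q)"
      using M nn by (intro rho_mono algebra_closed(3,5)) auto
    also have "\<dots> = ennreal (1 + t) * \<rho> (adj A o\<^sub>L A) + ennreal (1 + 1/t) * \<rho> (adj B o\<^sub>L B)"
      using M nn PQ t by (simp add: rho_add rho_scaleR algebra_closed)
    also have "\<dots> \<le> ennreal (1 + t) * ennreal (a\<^sup>2) + ennreal (1 + 1/t) * ennreal (b\<^sup>2)"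
      unfolding rho_square_eq[OF A] rho_square_eq[OF B]
      using a b by (intro add_mono mult_left_mono ennreal_leI power_mono pnorm_nonneg) auto
    also have "\<dots> = ennreal ((1 + t) * a\<^sup>2 + (1 + 1/t) * b\<^sup>2)"
      using t by (simp add: ennreal_mult[symmetric] ennreal_plus[symmetric] del: ennreal_plus)
    also have "(1 + t) * a\<^sup>2 + (1 + 1/t) * b\<^sup>2 = (a + b)\<^sup>2"
      using a b by (simp add: t_def power2_eq_square field_simps)
    finally show "\<rho> (adj (A + B) o\<^sub>L (A + B)) \<le> ennreal ((a + b)\<^sup>2)" .
    show "0 \<le> a + b" using a b by simp
  qed
  have "pnorm \<rho> 2 (A + B) \<le> pnorm \<rho> 2 A + pnorm \<rho> 2 B + e" if "0 < e" for e
    using main[of "pnorm \<rho> 2 A + e / 2" "pnorm \<rho> 2 B + e / 2"] that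
      pnorm_nonneg[of 2 A] pnorm_nonneg[of 2 B] by simp
  then show ?thesis
    using main[of "pnorm \<rho> 2 A + 1" "pnorm \<rho> 2 B + 1"] pnorm_nonneg[of 2]
    by (auto simp: add_nonneg_pos intro: field_le_epsilon)
qed

lemma L1_add:
  assumes A: "A \<in> Lp_bdd M \<rho> 1" and B: "B \<in> Lp_bdd M \<rho> 1"
  shows "A + B \<in> Lp_bdd M \<rho> 1 \<and> pnorm \<rho> 1 (A + B) \<le> pnorm \<rho> 1 A + pnorm \<rho> 1 B"
proof (rule L1_I)
  have M: "A \<in> M" "B \<in> M" using A B by (auto simp: L1_simps)
  then show "A + B \<in> M" by (rule algebra_closed)
  show "0 \<le> pnorm \<rho> 1 A + pnorm \<rho> 1 B" by (simp add: pnorm_nonneg)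
  then show "\<rho> (abs_op (A + B)) \<le> ennreal (pnorm \<rho> 1 A + pnorm \<rho> 1 B)"
    using rho_abs_add[OF M] by (simp add: rho_abs_eq[OF A] rho_abs_eq[OF B] pnorm_nonneg)
qed

lemma Lp_scaleC:
  assumes "A \<in> Lp_bdd M \<rho> p" "p \<in> {1, 2}"
  shows "scaleC_op c A \<in> Lp_bdd M \<rho> p \<and> pnorm \<rho> p (scaleC_op c A) = cmod c * pnorm \<rho> p A"
proof -
  have A: "A \<in> M" using assms by (auto simp: Lp_bdd_def)
  have pw: "power_op (abs_op (scaleC_op c A)) p = (cmod c)^p *\<^sub>R power_op (abs_op A) p"
    using assms(2) by (auto simp: abs_scaleC_op[OF A] numeral_2_eq_2 compose_algebra)
  have nn: "nonneg_op (power_op (abs_op A) p)" "power_op (abs_op A) p \<in> M"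
    using assms(2) abs_op[OF A] adj_compose_nonneg[OF A] power_closed[OF abs_op(1)[OF A], of p]
    by (auto simp: numeral_2_eq_2)
  have "\<rho> (power_op (abs_op (scaleC_op c A)) p) = ennreal ((cmod c)^p) * \<rho> (power_op (abs_op A) p)"
    using nn by (simp add: pw rho_scaleR)
  then show ?thesis
    using assms A algebra_closed(6)[OF A]
    by (auto simp: Lp_bdd_def pnorm_def enn2real_mult real_root_mult ennreal_mult_less_top real_root_power_cancel)
qed

lemma L2_compose_left:
  assumes W: "W \<in> M" "norm W \<le> 1" and A: "A \<in> Lp_bdd M \<rho> 2"
  shows "W o\<^sub>L A \<in> Lp_bdd M \<rho> 2 \<and> pnorm \<rho> 2 (W o\<^sub>L A) \<le> pnorm \<rho> 2 A"
proof (rule L2_I)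
  have AM: "A \<in> M" using A by (simp add: L2_iff)
  show WA: "W o\<^sub>L A \<in> M" using W AM by (intro algebra_closed)
  have b: "A \<in> bounded_ops" "W o\<^sub>L A \<in> bounded_ops" using AM WA by (auto intro: in_bounded_ops)
  have "\<rho> (adj (W o\<^sub>L A) o\<^sub>L (W o\<^sub>L A)) \<le> \<rho> (adj A o\<^sub>L A)"
  proof (rule rho_mono)
    show "nonneg_op ((adj A o\<^sub>L A) - (adj (W o\<^sub>L A) o\<^sub>L (W o\<^sub>L A)))"
      unfolding nonneg_op_def
    proof (intro conjI allI)
      show "self_adjoint ((adj A o\<^sub>L A) - (adj (W o\<^sub>L A) o\<^sub>L (W o\<^sub>L A)))"
        using AM WA by (intro self_adjoint_intros(4) nonneg_opD adj_compose_nonneg)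
      fix x
      have "(norm (W (A x)))\<^sup>2 \<le> (norm (A x))\<^sup>2"
        by (intro power_mono norm_apply_le W) simp
      then show "0 \<le> inner x (((adj A o\<^sub>L A) - (adj (W o\<^sub>L A) o\<^sub>L (W o\<^sub>L A))) x)"
        by (simp add: blinfun.diff_left inner_diff inner_adj'[OF b(1)] inner_adj'[OF b(2)] power2_norm_eq_inner)
    qed
  qed (use AM WA in \<open>auto intro!: algebra_closed adj_closed adj_compose_nonneg\<close>)
  then show "\<rho> (adj (W o\<^sub>L A) o\<^sub>L (W o\<^sub>L A)) \<le> ennreal ((pnorm \<rho> 2 A)\<^sup>2)"
    by (simp add: rho_square_eq[OF A])
qed (simp add: pnorm_nonneg)

lemma L2_adj:
  assumes A: "A \<in> Lp_bdd M \<rho> 2"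
  shows "adj A \<in> Lp_bdd M \<rho> 2" "pnorm \<rho> 2 (adj A) = pnorm \<rho> 2 A"
  using A rho_adj_commute[of A] by (auto simp: L2_iff pnorm_2 adj_closed adj_adj in_bounded_ops)

lemma L2_compose_right:
  assumes W: "W \<in> M" "norm W \<le> 1" and A: "A \<in> Lp_bdd M \<rho> 2"
  shows "A o\<^sub>L W \<in> Lp_bdd M \<rho> 2 \<and> pnorm \<rho> 2 (A o\<^sub>L W) \<le> pnorm \<rho> 2 A"
proof -
  have AM: "A \<in> M" using A by (simp add: L2_iff)
  have "adj (adj W o\<^sub>L adj A) = A o\<^sub>L W"
    using AM W by (simp add: adj_compose adj_adj adj_bounded_ops in_bounded_ops)
  moreover have "adj W o\<^sub>L adj A \<in> Lp_bdd M \<rho> 2 \<and> pnorm \<rho> 2 (adj W o\<^sub>L adj A) \<le> pnorm \<rho> 2 A"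
    using L2_compose_left[OF adj_closed[OF W(1)] norm_adj_le[OF in_bounded_ops[OF W(1)] W(2)] L2_adj(1)[OF A]]
    by (simp add: L2_adj(2)[OF A])
  ultimately show ?thesis using L2_adj[of "adj W o\<^sub>L adj A"] by auto
qed

text \<open>\<open>\<parallel>W (A W)\<parallel>\<^sub>1 \<le> \<parallel>W\<parallel>\<^sub>2 \<parallel>A W\<parallel>\<^sub>2 \<le> \<parallel>A\<parallel>\<^sub>2\<close>. This makes \<open>F \<mapsto> WFW\<close> continuous from \<open>L\<^sup>2\<close> to \<open>L\<^sup>1\<close> and
  bounds the supremum.\<close>

lemma sandwich_L1:
  assumes W: "W \<in> Lp_bdd M \<rho> 2" "nonneg_op W" "pnorm \<rho> 2 W \<le> 1" "norm W \<le> 1"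
    and A: "A \<in> Lp_bdd M \<rho> 2"
  shows "W o\<^sub>L A o\<^sub>L W \<in> Lp_bdd M \<rho> 1 \<and> pnorm \<rho> 1 (W o\<^sub>L A o\<^sub>L W) \<le> pnorm \<rho> 2 A"
proof -
  have WM: "W \<in> M" and AM: "A \<in> M" using W A by (auto simp: L2_iff)
  have aW: "adj W = W" using W WM in_bounded_ops by (intro adj_self_adjoint nonneg_opD)
  have AW: "A o\<^sub>L W \<in> Lp_bdd M \<rho> 2" "pnorm \<rho> 2 (A o\<^sub>L W) \<le> pnorm \<rho> 2 A"
    using L2_compose_right[OF WM W(4) A] by auto
  have main: "W o\<^sub>L A o\<^sub>L W \<in> Lp_bdd M \<rho> 1 \<and> pnorm \<rho> 1 (W o\<^sub>L A o\<^sub>L W) \<le> pnorm \<rho> 2 A + e" if "0 < e" for e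
  proof (rule L1_I)
    have pos: "0 < pnorm \<rho> 2 A + e" using that pnorm_nonneg[of 2 A] by simp
    have "\<rho> (abs_op (adj W o\<^sub>L (A o\<^sub>L W))) \<le> ennreal (1 * (pnorm \<rho> 2 A + e))"
    proof (rule rho_abs_compose_le)
      show "\<rho> (adj W o\<^sub>L W) \<le> ennreal (1\<^sup>2)"
        using W pnorm_nonneg[of 2 W] by (simp add: rho_square_eq power_le_one)
      show "\<rho> (adj (A o\<^sub>L W) o\<^sub>L (A o\<^sub>L W)) \<le> ennreal ((pnorm \<rho> 2 A + e)\<^sup>2)"
        unfolding rho_square_eq[OF AW(1)] using AW that
        by (intro ennreal_leI power_mono pnorm_nonneg) auto
    qed (use WM AM pos in \<open>auto intro: algebra_closed\<close>)
    then show "\<rho> (abs_op (W o\<^sub>L A o\<^sub>L W)) \<le> ennreal (pnorm \<rho> 2 A + e)"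
      by (simp add: aW compose_assoc)
    show "W o\<^sub>L A o\<^sub>L W \<in> M" using WM AM by (intro algebra_closed)
    show "0 \<le> pnorm \<rho> 2 A + e" using pos by simp
  qed
  show ?thesis using main[of 1] main by (auto intro: field_le_epsilon)
qed

text \<open>\<open>W\<close> is the cutoff \<open>1 - D\<close>, \<open>D = (1 - T)\<^sup>n\<close>, of \<open>T = s (X\<^sup>* X + X X\<^sup>*)\<close>, which is at least
  \<open>s X\<^sup>* X\<close> and at least \<open>s X X\<^sup>*\<close>. Hence \<open>\<parallel>X D\<parallel>\<^sub>2\<^sup>2 = \<rho> (D X\<^sup>* X D)\<close> and \<open>\<parallel>D X\<parallel>\<^sub>2\<^sup>2 = \<rho> (D X X\<^sup>* D)\<close> are at
  most \<open>s\<^sup>-\<^sup>1 \<rho> (T D)\<close>, which tends to zero as \<open>\<rho> T < \<infinity>\<close>, and \<open>X - W X W = D X + W X D\<close>.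
  The cutoff lies in \<open>L\<^sup>2\<close> because \<open>W\<^sup>2 \<le> W\<close> and \<open>W\<close> is a sum of \<open>n\<close> operators \<open>T (1 - T)\<^sup>k \<le> T\<close>.\<close>

lemma sandwich_approximation:
  assumes X: "X \<in> Lp_bdd M \<rho> 2" and e: "0 < e"
  obtains W where "W \<in> Lp_bdd M \<rho> 2" "nonneg_op W" "norm W \<le> 1"
    "pnorm \<rho> 2 (X - (W o\<^sub>L X o\<^sub>L W)) \<le> e"
proof -
  have XM: "X \<in> M" and bX: "X \<in> bounded_ops" using X in_bounded_ops by (auto simp: L2_iff)
  have X': "adj X \<in> M" using XM by (rule adj_closed)
  let ?A = "adj X o\<^sub>L X" and ?B = "X o\<^sub>L adj X"
  have A: "?A \<in> M" "nonneg_op ?A" using XM by (auto intro!: algebra_closed adj_closed adj_compose_nonneg)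
  have B: "?B \<in> M" "nonneg_op ?B"
    using XM adj_compose_nonneg[OF X'] by (auto simp: adj_adj[OF bX] intro!: algebra_closed adj_closed)
  obtain s where s: "0 < s" "norm (s *\<^sub>R (?A + ?B)) \<le> 1" using contraction_scaling .
  define T where "T = s *\<^sub>R (?A + ?B)"
  have T: "T \<in> M" using A B by (auto simp: T_def intro!: algebra_closed)
  have Tn: "nonneg_op T" using A B s by (auto simp: T_def intro!: nonneg_op_intros)
  have ui: "unit_interval_op T"
    using Tn s by unfold_locales (auto simp: T_def[symmetric] intro!: nonneg_id_minus nonneg_opD)
  interpret unit_interval_op T by (rule ui)
  have rT: "\<rho> T < \<infinity>"
    using X A B s rho_adj_commute[OF XM]
    by (simp add: T_def rho_scaleR rho_add algebra_closed nonneg_op_intros L2_iff ennreal_mult_less_top)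
  have "0 < s * (e / 2)\<^sup>2" using s e by simp
  then obtain n where n: "\<rho> (T o\<^sub>L power_op C n) < ennreal (s * (e / 2)\<^sup>2)"
    using tail_convergence[OF T ui rT] by blast
  let ?W = "cutoff T n" and ?D = "power_op C n"
  have W: "?W \<in> M" "nonneg_op ?W" "norm ?W \<le> 1" using T cutoff_nonneg norm_cutoff by (auto intro: cutoff_closed)
  have D: "?D \<in> M" "nonneg_op ?D" "norm ?D \<le> 1"
    using T power_nonneg norm_power by (auto intro!: power_closed algebra_closed)
  have aD: "adj ?D = ?D" using D in_bounded_ops by (intro adj_self_adjoint nonneg_opD)
  have TD: "T o\<^sub>L ?D = ?D o\<^sub>L T" by (rule T_power_commute)
  have DTD: "\<rho> (?D o\<^sub>L T o\<^sub>L ?D) \<le> ennreal (s * (e / 2)\<^sup>2)"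
  proof -
    have "nonneg_op ((T o\<^sub>L ?D) o\<^sub>L (id_blinfun - ?D))"
      using power_le[of n] by (intro nonneg_op_compose T_power_nonneg)
        (simp_all add: compose_algebra TD compose_assoc)
    then have "\<rho> (?D o\<^sub>L T o\<^sub>L ?D) \<le> \<rho> (T o\<^sub>L ?D)"
      using T D Tn by (intro rho_mono algebra_closed nonneg_op_intros nonneg_opD) (auto simp: compose_algebra TD)
    then show ?thesis using n by (meson le_less_trans less_imp_le)
  qed
  have part: "\<rho> (?D o\<^sub>L Z o\<^sub>L ?D) \<le> ennreal ((e / 2)\<^sup>2)" if Z: "Z \<in> M" "nonneg_op Z" "nonneg_op (T - s *\<^sub>R Z)" for Z
  proof -
    have "nonneg_op (?D o\<^sub>L (T - s *\<^sub>R Z) o\<^sub>L ?D)"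
      using Z D by (intro nonneg_op_intros nonneg_opD)
    then have "\<rho> (s *\<^sub>R (?D o\<^sub>L Z o\<^sub>L ?D)) \<le> \<rho> (?D o\<^sub>L T o\<^sub>L ?D)"
      using Z D T s by (intro rho_mono algebra_closed nonneg_op_intros nonneg_opD) (auto simp: compose_algebra)
    also note DTD
    also have "\<rho> (s *\<^sub>R (?D o\<^sub>L Z o\<^sub>L ?D)) = ennreal s * \<rho> (?D o\<^sub>L Z o\<^sub>L ?D)"
      using Z D s by (intro rho_scaleR algebra_closed nonneg_op_intros nonneg_opD) auto
    finally show ?thesis using s by (simp add: ennreal_mult ennreal_mult_le_mult_iff)
  qed
  have WX: "W = id_blinfun - ?D \<Longrightarrow> X - (W o\<^sub>L X o\<^sub>L W) = (?D o\<^sub>L X) + ((W o\<^sub>L X) o\<^sub>L ?D)" for W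
    by (simp add: compose_algebra)
  have right: "X o\<^sub>L ?D \<in> Lp_bdd M \<rho> 2 \<and> pnorm \<rho> 2 (X o\<^sub>L ?D) \<le> e / 2"
  proof (rule L2_I)
    have "T - s *\<^sub>R ?A = s *\<^sub>R ?B" by (simp add: T_def scaleR_add_right)
    then have "\<rho> (?D o\<^sub>L ?A o\<^sub>L ?D) \<le> ennreal ((e / 2)\<^sup>2)"
      using A B s by (intro part) (auto intro: nonneg_op_intros)
    then show "\<rho> (adj (X o\<^sub>L ?D) o\<^sub>L (X o\<^sub>L ?D)) \<le> ennreal ((e / 2)\<^sup>2)"
      using D by (simp add: adj_compose bX in_bounded_ops aD compose_assoc)
  qed (use XM D e in \<open>auto intro: algebra_closed\<close>)
  have left: "?D o\<^sub>L X \<in> Lp_bdd M \<rho> 2 \<and> pnorm \<rho> 2 (?D o\<^sub>L X) \<le> e / 2"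
  proof (rule L2_I)
    show DX: "?D o\<^sub>L X \<in> M" using D XM by (intro algebra_closed)
    have "T - s *\<^sub>R ?B = s *\<^sub>R ?A" by (simp add: T_def scaleR_add_right)
    then have "\<rho> (?D o\<^sub>L ?B o\<^sub>L ?D) \<le> ennreal ((e / 2)\<^sup>2)"
      using A B s by (intro part) (auto intro: nonneg_op_intros)
    then show "\<rho> (adj (?D o\<^sub>L X) o\<^sub>L (?D o\<^sub>L X)) \<le> ennreal ((e / 2)\<^sup>2)"
      unfolding rho_adj_commute[OF DX] using D by (simp add: adj_compose bX in_bounded_ops aD compose_assoc)
  qed (use e in auto)
  have "?W o\<^sub>L (X o\<^sub>L ?D) \<in> Lp_bdd M \<rho> 2 \<and> pnorm \<rho> 2 (?W o\<^sub>L (X o\<^sub>L ?D)) \<le> e / 2"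
    using L2_compose_left[OF W(1,3)] right by (meson order_trans)
  then have "pnorm \<rho> 2 ((?D o\<^sub>L X) + ((?W o\<^sub>L X) o\<^sub>L ?D)) \<le> e"
    using L2_add[of "?D o\<^sub>L X" "?W o\<^sub>L X o\<^sub>L ?D"] left by (simp add: compose_assoc)
  then have "pnorm \<rho> 2 (X - (?W o\<^sub>L X o\<^sub>L ?W)) \<le> e"
    using WX[of ?W] by (simp add: cutoff_def)
  moreover have "?W \<in> Lp_bdd M \<rho> 2"
  proof -
    have aW: "adj ?W = ?W" using W in_bounded_ops by (intro adj_self_adjoint nonneg_opD)
    have "nonneg_op (?W o\<^sub>L (id_blinfun - ?W))"
      by (intro nonneg_op_compose cutoff_nonneg cutoff_le) (simp add: compose_algebra)
    then have "\<rho> (?W o\<^sub>L ?W) \<le> \<rho> ?W"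
      using W by (intro rho_mono algebra_closed nonneg_op_intros nonneg_opD) (auto simp: compose_algebra)
    also have "\<rho> ?W < \<infinity>"
    proof -
      have step: "\<rho> (cutoff T k) < \<infinity>" for k
      proof (induction k)
        case 0
        have "\<rho> (0 *\<^sub>R T) = 0" using rho_scaleR[OF T Tn, of 0] by simp
        then show ?case by (simp add: cutoff_def)
      next
        case (Suc k)
        have eq: "cutoff T (Suc k) = cutoff T k + (T o\<^sub>L power_op C k)"
          by (simp add: cutoff_def compose_algebra)
        have "nonneg_op (T - (T o\<^sub>L power_op C k))"
        proof -
          have "nonneg_op (T o\<^sub>L (id_blinfun - power_op C k))"
            by (intro nonneg_op_compose Tn power_le) (simp add: compose_algebra T_power_commute)
          then show ?thesis by (simp add: compose_algebra)
        qed
        then have "\<rho> (T o\<^sub>L power_op C k) \<le> \<rho> T"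
          using T by (intro rho_mono T_power_nonneg algebra_closed power_closed)
        moreover have "\<rho> (cutoff T (Suc k)) = \<rho> (cutoff T k) + \<rho> (T o\<^sub>L power_op C k)"
          unfolding eq using T by (intro rho_add cutoff_closed cutoff_nonneg T_power_nonneg algebra_closed power_closed)
        ultimately show ?case using Suc rT by (simp add: less_top[symmetric]) (metis infinity_ennreal_def neq_top_trans)
      qed
      then show ?thesis .
    qed
    finally show ?thesis using W by (simp add: L2_iff aW)
  qed
  ultimately show thesis using W that by blast
qed

section \<open>Completions\<close>

lemma rho_0: "\<rho> 0 = 0"
  using rho_scaleR[of 0 0] by (simp add: algebra_closed nonneg_op_intros)

lemma abs_0: "abs_op (0 :: 'a \<Rightarrow>\<^sub>L 'a) = 0"
  using abs_scaleR[of 0 0] by (simp add: algebra_closed)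

lemma scaleC_op_minus: "scaleC_op (-1) A = - A"
  using scaleC_op_of_real[of "-1" A] by simp

context
  fixes p :: nat
  assumes p: "p \<in> {1, 2}"
begin

lemma p_pos: "0 < p" using p by auto

lemma Lp_bdd_add:
  assumes "A \<in> Lp_bdd M \<rho> p" "B \<in> Lp_bdd M \<rho> p"
  shows "A + B \<in> Lp_bdd M \<rho> p" "pnorm \<rho> p (A + B) \<le> pnorm \<rho> p A + pnorm \<rho> p B"
  using p assms L1_add[of A B] L2_add[of A B] by auto

lemma Lp_bdd_minus:
  assumes "A \<in> Lp_bdd M \<rho> p"
  shows "- A \<in> Lp_bdd M \<rho> p" "pnorm \<rho> p (- A) = pnorm \<rho> p A"
  using Lp_scaleC[OF assms p, of "-1"] by (simp_all add: scaleC_op_minus)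

lemma Lp_bdd_0: "0 \<in> Lp_bdd M \<rho> p" "pnorm \<rho> p 0 = 0"
  using p p_pos by (auto simp: Lp_bdd_def pnorm_def abs_0 rho_0 algebra_closed numeral_2_eq_2)

lemma Lp_bdd_diff:
  assumes "A \<in> Lp_bdd M \<rho> p" "B \<in> Lp_bdd M \<rho> p"
  shows "A - B \<in> Lp_bdd M \<rho> p" "pnorm \<rho> p (A - B) \<le> pnorm \<rho> p A + pnorm \<rho> p B"
  using Lp_bdd_add[OF assms(1) Lp_bdd_minus(1)[OF assms(2)]] Lp_bdd_minus(2)[OF assms(2)] by auto

lemma pnorm_minus_commute:
  assumes "A \<in> Lp_bdd M \<rho> p" "B \<in> Lp_bdd M \<rho> p"
  shows "pnorm \<rho> p (A - B) = pnorm \<rho> p (B - A)"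
  using Lp_bdd_minus(2)[OF Lp_bdd_diff(1)[OF assms]] by simp

lemma pnorm_triangle_diff:
  assumes "A \<in> Lp_bdd M \<rho> p" "B \<in> Lp_bdd M \<rho> p" "D \<in> Lp_bdd M \<rho> p"
  shows "pnorm \<rho> p (A - D) \<le> pnorm \<rho> p (A - B) + pnorm \<rho> p (B - D)"
  using Lp_bdd_add(2)[OF Lp_bdd_diff(1)[OF assms(1,2)] Lp_bdd_diff(1)[OF assms(2,3)]] by simp

lemma pnorm_diff_abs_le:
  assumes "A \<in> Lp_bdd M \<rho> p" "B \<in> Lp_bdd M \<rho> p"
  shows "\<bar>pnorm \<rho> p A - pnorm \<rho> p B\<bar> \<le> pnorm \<rho> p (A - B)"
  using pnorm_triangle_diff[OF assms Lp_bdd_0(1)] pnorm_triangle_diff[OF assms(2,1) Lp_bdd_0(1)]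
    pnorm_minus_commute[OF assms] by simp

lemma Lp_CauchyD:
  assumes "X \<in> Lp_Cauchy M \<rho> p"
  shows "X n \<in> Lp_bdd M \<rho> p"
    and "0 < e \<Longrightarrow> \<exists>N. \<forall>m\<ge>N. \<forall>n\<ge>N. pnorm \<rho> p (X m - X n) < e"
  using assms by (auto simp: Lp_Cauchy_def)

lemma equiv_Lp_rel: "equiv (Lp_Cauchy M \<rho> p) (Lp_rel M \<rho> p)"
proof (rule equivI)
  show "Lp_rel M \<rho> p \<subseteq> Lp_Cauchy M \<rho> p \<times> Lp_Cauchy M \<rho> p" by (auto simp: Lp_rel_def)
  show "refl_on (Lp_Cauchy M \<rho> p) (Lp_rel M \<rho> p)"
    by (auto simp: refl_on_def Lp_rel_def Lp_bdd_0)
  show "sym (Lp_rel M \<rho> p)"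
  proof (rule symI)
    fix X Y assume XY: "(X, Y) \<in> Lp_rel M \<rho> p"
    then have "(\<lambda>n. pnorm \<rho> p (Y n - X n)) = (\<lambda>n. pnorm \<rho> p (X n - Y n))"
      by (auto simp: Lp_rel_def intro!: pnorm_minus_commute Lp_CauchyD)
    with XY show "(Y, X) \<in> Lp_rel M \<rho> p" by (auto simp: Lp_rel_def)
  qed
  show "trans (Lp_rel M \<rho> p)"
  proof (rule transI)
    fix X Y Z assume XY: "(X, Y) \<in> Lp_rel M \<rho> p" and YZ: "(Y, Z) \<in> Lp_rel M \<rho> p"
    have "(\<lambda>n. pnorm \<rho> p (X n - Z n)) \<longlonglongrightarrow> 0"
    proof (rule tendsto_sandwich[OF always_eventually always_eventually tendsto_const])
      show "\<forall>n. 0 \<le> pnorm \<rho> p (X n - Z n)" using pnorm_nonneg[OF p_pos] by blast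
      show "\<forall>n. pnorm \<rho> p (X n - Z n) \<le> pnorm \<rho> p (X n - Y n) + pnorm \<rho> p (Y n - Z n)"
        using XY YZ by (auto simp: Lp_rel_def intro!: pnorm_triangle_diff Lp_CauchyD)
      show "(\<lambda>n. pnorm \<rho> p (X n - Y n) + pnorm \<rho> p (Y n - Z n)) \<longlonglongrightarrow> 0"
        using XY YZ by (auto simp: Lp_rel_def intro: tendsto_add_zero)
    qed
    with XY YZ show "(X, Z) \<in> Lp_rel M \<rho> p" by (auto simp: Lp_rel_def)
  qed
qed

lemma Lp_class:
  assumes "F \<in> Lp M \<rho> p" "X \<in> F"
  shows "X \<in> Lp_Cauchy M \<rho> p" "F = Lp_rel M \<rho> p `` {X}"
proof -
  from assms obtain Z where Z: "Z \<in> Lp_Cauchy M \<rho> p" "F = Lp_rel M \<rho> p `` {Z}"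
    by (auto simp: Lp_def elim: quotientE)
  with assms(2) have ZX: "(Z, X) \<in> Lp_rel M \<rho> p" by simp
  then show "X \<in> Lp_Cauchy M \<rho> p" by (simp add: Lp_rel_def)
  show "F = Lp_rel M \<rho> p `` {X}" using equiv_class_eq[OF equiv_Lp_rel ZX] Z(2) by simp
qed

lemma Lp_representative:
  assumes "F \<in> Lp M \<rho> p"
  obtains X where "X \<in> F"
  using assms equiv_Lp_rel in_quotient_imp_non_empty unfolding Lp_def by blast

lemma Lp_related:
  assumes "F \<in> Lp M \<rho> p" "X \<in> F" "Y \<in> F"
  shows "(X, Y) \<in> Lp_rel M \<rho> p"
  using Lp_class[OF assms(1,2)] assms(3) by blast

lemma Lp_classI:
  assumes "X \<in> Lp_Cauchy M \<rho> p"
  shows "Lp_rel M \<rho> p `` {X} \<in> Lp M \<rho> p" "X \<in> Lp_rel M \<rho> p `` {X}"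
  using assms equiv_Lp_rel by (auto simp: Lp_def quotientI equiv_def refl_on_def)

text \<open>The operations on the completion are images of sets of representatives under the equivalence
  relation; such an image is a single class as soon as these representatives are equivalent.\<close>

lemma Image_related:
  assumes "X \<in> S" "\<And>Y. Y \<in> S \<Longrightarrow> (X, Y) \<in> Lp_rel M \<rho> p"
  shows "Lp_rel M \<rho> p `` S = Lp_rel M \<rho> p `` {X}"
  using assms equiv_class_eq[OF equiv_Lp_rel] by blast

lemma Lp_norm_tendsto:
  assumes X: "X \<in> Lp_Cauchy M \<rho> p"
  shows "(\<lambda>n. pnorm \<rho> p (X n)) \<longlonglongrightarrow> Lp_norm \<rho> p (Lp_rel M \<rho> p `` {X})"
proof -
  have "Cauchy (\<lambda>n. pnorm \<rho> p (X n))"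
  proof (rule CauchyI)
    fix e :: real assume "0 < e"
    then obtain N where "\<forall>m\<ge>N. \<forall>n\<ge>N. pnorm \<rho> p (X m - X n) < e" using Lp_CauchyD[OF X] by blast
    then show "\<exists>N. \<forall>m\<ge>N. \<forall>n\<ge>N. norm (pnorm \<rho> p (X m) - pnorm \<rho> p (X n)) < e"
      using le_less_trans[OF pnorm_diff_abs_le[OF Lp_CauchyD(1)[OF X] Lp_CauchyD(1)[OF X]]]
      unfolding real_norm_def by blast
  qed
  then obtain r where r: "(\<lambda>n. pnorm \<rho> p (X n)) \<longlonglongrightarrow> r"
    using Cauchy_convergent_iff convergent_def by blast
  have "Lp_norm \<rho> p (Lp_rel M \<rho> p `` {X}) = r"
    unfolding Lp_norm_def
  proof (rule the_equality)
    show "\<forall>Y\<in>Lp_rel M \<rho> p `` {X}. (\<lambda>n. pnorm \<rho> p (Y n)) \<longlonglongrightarrow> r"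
    proof
      fix Y assume "Y \<in> Lp_rel M \<rho> p `` {X}"
      then have Y: "Y \<in> Lp_Cauchy M \<rho> p" "(\<lambda>n. pnorm \<rho> p (X n - Y n)) \<longlonglongrightarrow> 0"
        by (auto simp: Lp_rel_def)
      have "(\<lambda>n. pnorm \<rho> p (X n) - pnorm \<rho> p (Y n)) \<longlonglongrightarrow> 0"
        by (rule Lim_null_comparison[OF always_eventually Y(2)])
           (use pnorm_diff_abs_le Lp_CauchyD(1)[OF X] Lp_CauchyD(1)[OF Y(1)] in auto)
      then show "(\<lambda>n. pnorm \<rho> p (Y n)) \<longlonglongrightarrow> r"
        using tendsto_diff[OF r] by fastforce
    qed
    fix r' assume "\<forall>Y\<in>Lp_rel M \<rho> p `` {X}. (\<lambda>n. pnorm \<rho> p (Y n)) \<longlonglongrightarrow> r'"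
    then show "r' = r" using Lp_classI(2)[OF X] r LIMSEQ_unique by blast
  qed
  with r show ?thesis by simp
qed

lemma Lp_Cauchy_add:
  assumes X: "X \<in> Lp_Cauchy M \<rho> p" and Y: "Y \<in> Lp_Cauchy M \<rho> p"
  shows "(\<lambda>n. X n + Y n) \<in> Lp_Cauchy M \<rho> p"
  unfolding Lp_Cauchy_def
proof (intro CollectI conjI allI impI)
  show "X n + Y n \<in> Lp_bdd M \<rho> p" for n
    using X Y by (intro Lp_bdd_add Lp_CauchyD)
  fix e :: real assume "0 < e"
  then obtain N1 N2 where N: "\<forall>m\<ge>N1. \<forall>n\<ge>N1. pnorm \<rho> p (X m - X n) < e/2"
    "\<forall>m\<ge>N2. \<forall>n\<ge>N2. pnorm \<rho> p (Y m - Y n) < e/2"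
    using Lp_CauchyD(2)[OF X, of "e/2"] Lp_CauchyD(2)[OF Y, of "e/2"] by auto
  have "pnorm \<rho> p (X m + Y m - (X n + Y n)) < e" if "m \<ge> max N1 N2" "n \<ge> max N1 N2" for m n
  proof -
    have "pnorm \<rho> p ((X m - X n) + (Y m - Y n)) \<le> pnorm \<rho> p (X m - X n) + pnorm \<rho> p (Y m - Y n)"
      using X Y by (intro Lp_bdd_add Lp_bdd_diff Lp_CauchyD)
    also have "\<dots> < e/2 + e/2" using N that by (intro add_strict_mono) auto
    finally show ?thesis by (simp add: add_diff_add)
  qed
  then show "\<exists>N. \<forall>m\<ge>N. \<forall>n\<ge>N. pnorm \<rho> p (X m + Y m - (X n + Y n)) < e" by blast
qed

lemma Lp_add_class:
  assumes F: "F \<in> Lp M \<rho> p" "X \<in> F" and G: "G \<in> Lp M \<rho> p" "Y \<in> G"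
  shows "Lp_add M \<rho> p F G \<in> Lp M \<rho> p" "(\<lambda>n. X n + Y n) \<in> Lp_add M \<rho> p F G"
proof -
  have C: "X \<in> Lp_Cauchy M \<rho> p" "Y \<in> Lp_Cauchy M \<rho> p" using Lp_class F G by auto
  have "Lp_add M \<rho> p F G = Lp_rel M \<rho> p `` {\<lambda>n. X n + Y n}"
    unfolding Lp_add_def
  proof (rule Image_related)
    show "(\<lambda>n. X n + Y n) \<in> {\<lambda>n. X n + Y n |X Y. X \<in> F \<and> Y \<in> G}" using F G by blast
    fix Z assume "Z \<in> {\<lambda>n. X n + Y n |X Y. X \<in> F \<and> Y \<in> G}"
    then obtain X' Y' where Z: "Z = (\<lambda>n. X' n + Y' n)" "X' \<in> F" "Y' \<in> G" by blast
    have C': "X' \<in> Lp_Cauchy M \<rho> p" "Y' \<in> Lp_Cauchy M \<rho> p" using Lp_class F G Z by auto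
    have rel: "(\<lambda>n. pnorm \<rho> p (X n - X' n)) \<longlonglongrightarrow> 0" "(\<lambda>n. pnorm \<rho> p (Y n - Y' n)) \<longlonglongrightarrow> 0"
      using Lp_related[OF F Z(2)] Lp_related[OF G Z(3)] by (auto simp: Lp_rel_def)
    have "(\<lambda>n. pnorm \<rho> p (X n + Y n - Z n)) \<longlonglongrightarrow> 0"
    proof (rule tendsto_sandwich[OF always_eventually always_eventually tendsto_const])
      show "\<forall>n. 0 \<le> pnorm \<rho> p (X n + Y n - Z n)" using pnorm_nonneg[OF p_pos] by blast
      have "pnorm \<rho> p ((X n - X' n) + (Y n - Y' n)) \<le> pnorm \<rho> p (X n - X' n) + pnorm \<rho> p (Y n - Y' n)" for n
        using C C' by (intro Lp_bdd_add Lp_bdd_diff Lp_CauchyD)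
      then show "\<forall>n. pnorm \<rho> p (X n + Y n - Z n) \<le> pnorm \<rho> p (X n - X' n) + pnorm \<rho> p (Y n - Y' n)"
        by (simp add: Z add_diff_add)
      show "(\<lambda>n. pnorm \<rho> p (X n - X' n) + pnorm \<rho> p (Y n - Y' n)) \<longlonglongrightarrow> 0"
        using rel by (rule tendsto_add_zero)
    qed
    then show "(\<lambda>n. X n + Y n, Z) \<in> Lp_rel M \<rho> p"
      using Lp_Cauchy_add[OF C] Lp_Cauchy_add[OF C'] by (simp add: Lp_rel_def Z)
  qed
  then show "Lp_add M \<rho> p F G \<in> Lp M \<rho> p" "(\<lambda>n. X n + Y n) \<in> Lp_add M \<rho> p F G"
    using Lp_classI[OF Lp_Cauchy_add[OF C]] by auto
qed

lemma scaleC_op_diff: "scaleC_op c A - scaleC_op c B = scaleC_op c (A - B)"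
  by (rule blinfun_eqI) (simp add: scaleC_op_apply blinfun.diff_left scaleC_diff_right)

lemma Lp_Cauchy_scale:
  assumes X: "X \<in> Lp_Cauchy M \<rho> p"
  shows "(\<lambda>n. scaleC_op c (X n)) \<in> Lp_Cauchy M \<rho> p"
  unfolding Lp_Cauchy_def
proof (intro CollectI conjI allI impI)
  show "scaleC_op c (X n) \<in> Lp_bdd M \<rho> p" for n
    using Lp_scaleC[OF Lp_CauchyD(1)[OF X] p] by blast
  fix e :: real assume "0 < e"
  moreover have c: "0 < cmod c + 1" by (simp add: add_nonneg_pos)
  ultimately have "0 < e / (cmod c + 1)" by simp
  then obtain N where N: "\<forall>m\<ge>N. \<forall>n\<ge>N. pnorm \<rho> p (X m - X n) < e / (cmod c + 1)"
    using Lp_CauchyD(2)[OF X] by blast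
  have "pnorm \<rho> p (scaleC_op c (X m) - scaleC_op c (X n)) < e" if "m \<ge> N" "n \<ge> N" for m n
  proof -
    have "pnorm \<rho> p (scaleC_op c (X m) - scaleC_op c (X n)) = cmod c * pnorm \<rho> p (X m - X n)"
      using Lp_scaleC[OF Lp_bdd_diff(1)[OF Lp_CauchyD(1)[OF X] Lp_CauchyD(1)[OF X]] p]
      by (simp add: scaleC_op_diff)
    also have "\<dots> \<le> (cmod c + 1) * pnorm \<rho> p (X m - X n)"
      using pnorm_nonneg[OF p_pos] by (intro mult_right_mono) auto
    also have "\<dots> < e" using N that c by (simp add: pos_less_divide_eq mult.commute)
    finally show ?thesis .
  qed
  then show "\<exists>N. \<forall>m\<ge>N. \<forall>n\<ge>N. pnorm \<rho> p (scaleC_op c (X m) - scaleC_op c (X n)) < e" by blast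
qed

lemma Lp_scale_class:
  assumes F: "F \<in> Lp M \<rho> p" "X \<in> F"
  shows "Lp_scale M \<rho> p c F \<in> Lp M \<rho> p" "(\<lambda>n. scaleC_op c (X n)) \<in> Lp_scale M \<rho> p c F"
proof -
  have C: "X \<in> Lp_Cauchy M \<rho> p" using Lp_class F by auto
  have "Lp_scale M \<rho> p c F = Lp_rel M \<rho> p `` {\<lambda>n. scaleC_op c (X n)}"
    unfolding Lp_scale_def
  proof (rule Image_related)
    show "(\<lambda>n. scaleC_op c (X n)) \<in> {\<lambda>n. scaleC_op c (X n) |X. X \<in> F}" using F by blast
    fix Z assume "Z \<in> {\<lambda>n. scaleC_op c (X n) |X. X \<in> F}"
    then obtain X' where Z: "Z = (\<lambda>n. scaleC_op c (X' n))" "X' \<in> F" by blast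
    have C': "X' \<in> Lp_Cauchy M \<rho> p" using Lp_class F Z by auto
    have "pnorm \<rho> p (scaleC_op c (X n) - Z n) = cmod c * pnorm \<rho> p (X n - X' n)" for n
      using Lp_scaleC[OF Lp_bdd_diff(1)[OF Lp_CauchyD(1)[OF C] Lp_CauchyD(1)[OF C']] p]
      by (simp add: scaleC_op_diff Z)
    moreover have "(\<lambda>n. cmod c * pnorm \<rho> p (X n - X' n)) \<longlonglongrightarrow> 0"
      using Lp_related[OF F Z(2)] by (auto simp: Lp_rel_def intro: tendsto_mult_right_zero)
    ultimately show "(\<lambda>n. scaleC_op c (X n), Z) \<in> Lp_rel M \<rho> p"
      using Lp_Cauchy_scale[OF C] Lp_Cauchy_scale[OF C'] by (simp add: Lp_rel_def Z)
  qed
  then show "Lp_scale M \<rho> p c F \<in> Lp M \<rho> p" "(\<lambda>n. scaleC_op c (X n)) \<in> Lp_scale M \<rho> p c F"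
    using Lp_classI[OF Lp_Cauchy_scale[OF C]] by auto
qed

lemma Lp_zero_class: "Lp_zero M \<rho> p \<in> Lp M \<rho> p" "(\<lambda>_. 0) \<in> Lp_zero M \<rho> p"
proof -
  have "(\<lambda>_. 0) \<in> Lp_Cauchy M \<rho> p" by (simp add: Lp_Cauchy_def Lp_bdd_0)
  then show "Lp_zero M \<rho> p \<in> Lp M \<rho> p" "(\<lambda>_. 0) \<in> Lp_zero M \<rho> p"
    unfolding Lp_zero_def using Lp_classI by auto
qed

end

lemma p1: "(1::nat) \<in> {1, 2}" and p2: "(2::nat) \<in> {1, 2}" by auto

section \<open>The seminorms and their supremum\<close>

definition admissible :: "('a \<Rightarrow>\<^sub>L 'a) set" where
  "admissible = {W \<in> Lp_bdd M \<rho> 2. positive_op W \<and> pnorm \<rho> 2 W \<le> 1 \<and> norm W \<le> 1}"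

lemma admissible_sandwich:
  assumes "W \<in> admissible" "A \<in> Lp_bdd M \<rho> 2"
  shows "W o\<^sub>L A o\<^sub>L W \<in> Lp_bdd M \<rho> 1" "pnorm \<rho> 1 (W o\<^sub>L A o\<^sub>L W) \<le> pnorm \<rho> 2 A"
  using sandwich_L1[of W A] assms by (auto simp: admissible_def positive_op_iff)

lemma compose_sandwich_diff: "(W o\<^sub>L A o\<^sub>L W) - (W o\<^sub>L B o\<^sub>L W) = W o\<^sub>L (A - B) o\<^sub>L W"
  by (simp add: compose_algebra)

lemma sandwich_Cauchy:
  assumes W: "W \<in> admissible" and X: "X \<in> Lp_Cauchy M \<rho> 2"
  shows "(\<lambda>n. W o\<^sub>L X n o\<^sub>L W) \<in> Lp_Cauchy M \<rho> 1"
  unfolding Lp_Cauchy_def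
proof (intro CollectI conjI allI impI)
  note XL = Lp_CauchyD(1)[OF p2 X]
  show "W o\<^sub>L X n o\<^sub>L W \<in> Lp_bdd M \<rho> 1" for n using admissible_sandwich(1)[OF W XL] .
  fix e :: real assume "0 < e"
  then obtain N where N: "\<forall>m\<ge>N. \<forall>n\<ge>N. pnorm \<rho> 2 (X m - X n) < e"
    using Lp_CauchyD(2)[OF p2 X] by blast
  have "pnorm \<rho> 1 ((W o\<^sub>L X m o\<^sub>L W) - (W o\<^sub>L X n o\<^sub>L W)) < e" if "m \<ge> N" "n \<ge> N" for m n
    unfolding compose_sandwich_diff
    using admissible_sandwich(2)[OF W Lp_bdd_diff(1)[OF p2 XL XL]] N that by (meson le_less_trans)
  then show "\<exists>N. \<forall>m\<ge>N. \<forall>n\<ge>N. pnorm \<rho> 1 ((W o\<^sub>L X m o\<^sub>L W) - (W o\<^sub>L X n o\<^sub>L W)) < e" by blast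
qed

lemma sandwich_norm_tendsto:
  assumes W: "W \<in> admissible" and F: "F \<in> Lp M \<rho> 2" "X \<in> F"
  shows "(\<lambda>n. pnorm \<rho> 1 (W o\<^sub>L X n o\<^sub>L W)) \<longlonglongrightarrow> Lp_norm \<rho> 1 (sandwich M \<rho> W F)"
proof -
  have C: "X \<in> Lp_Cauchy M \<rho> 2" using Lp_class[OF p2] F by auto
  have "sandwich M \<rho> W F = Lp_rel M \<rho> 1 `` {\<lambda>n. W o\<^sub>L X n o\<^sub>L W}"
    unfolding sandwich_def
  proof (rule Image_related[OF p1])
    show "(\<lambda>n. W o\<^sub>L X n o\<^sub>L W) \<in> {\<lambda>n. W o\<^sub>L X n o\<^sub>L W |X. X \<in> F}" using F by blast
    fix Z assume "Z \<in> {\<lambda>n. W o\<^sub>L X n o\<^sub>L W |X. X \<in> F}"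
    then obtain X' where Z: "Z = (\<lambda>n. W o\<^sub>L X' n o\<^sub>L W)" "X' \<in> F" by blast
    have C': "X' \<in> Lp_Cauchy M \<rho> 2" using Lp_class[OF p2] F Z by auto
    have "(\<lambda>n. pnorm \<rho> 1 ((W o\<^sub>L X n o\<^sub>L W) - Z n)) \<longlonglongrightarrow> 0"
    proof (rule tendsto_sandwich[OF always_eventually always_eventually tendsto_const])
      show "\<forall>n. 0 \<le> pnorm \<rho> 1 ((W o\<^sub>L X n o\<^sub>L W) - Z n)" by (simp add: pnorm_nonneg)
      have "pnorm \<rho> 1 (W o\<^sub>L (X n - X' n) o\<^sub>L W) \<le> pnorm \<rho> 2 (X n - X' n)" for n
        by (rule admissible_sandwich(2)[OF W Lp_bdd_diff(1)[OF p2 Lp_CauchyD(1)[OF p2 C] Lp_CauchyD(1)[OF p2 C']]])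
      then show "\<forall>n. pnorm \<rho> 1 ((W o\<^sub>L X n o\<^sub>L W) - Z n) \<le> pnorm \<rho> 2 (X n - X' n)"
        by (simp only: Z compose_sandwich_diff) blast
      show "(\<lambda>n. pnorm \<rho> 2 (X n - X' n)) \<longlonglongrightarrow> 0"
        using Lp_related[OF p2 F Z(2)] by (simp add: Lp_rel_def)
    qed
    then show "(\<lambda>n. W o\<^sub>L X n o\<^sub>L W, Z) \<in> Lp_rel M \<rho> 1"
      using sandwich_Cauchy[OF W C] sandwich_Cauchy[OF W C'] by (simp add: Lp_rel_def Z)
  qed
  then show ?thesis using Lp_norm_tendsto[OF p1 sandwich_Cauchy[OF W C]] by simp
qed

lemma sandwich_norm_nonneg:
  assumes "W \<in> admissible" "F \<in> Lp M \<rho> 2"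
  shows "0 \<le> Lp_norm \<rho> 1 (sandwich M \<rho> W F)"
proof -
  obtain X where "X \<in> F" using assms(2) by (rule Lp_representative[OF p2])
  then show ?thesis
    by (intro LIMSEQ_le_const[OF sandwich_norm_tendsto[OF assms]]) (auto simp: pnorm_nonneg)
qed

lemma triple_norm_eq:
  "triple_norm M \<rho> F = (SUP W\<in>admissible. ennreal (Lp_norm \<rho> 1 (sandwich M \<rho> W F)))"
  by (simp add: triple_norm_def admissible_def)

lemma triple_norm_finite:
  assumes F: "F \<in> Lp M \<rho> 2"
  shows "triple_norm M \<rho> F < \<infinity>"
proof -
  obtain X where X: "X \<in> F" using F by (rule Lp_representative[OF p2])
  note C = Lp_class[OF p2 F X]
  have "Lp_norm \<rho> 1 (sandwich M \<rho> W F) \<le> Lp_norm \<rho> 2 F" if W: "W \<in> admissible" for W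
  proof (rule LIMSEQ_le[OF sandwich_norm_tendsto[OF W F X]])
    show "(\<lambda>n. pnorm \<rho> 2 (X n)) \<longlonglongrightarrow> Lp_norm \<rho> 2 F"
      using Lp_norm_tendsto[OF p2 C(1)] C(2) by simp
    show "\<exists>N. \<forall>n\<ge>N. pnorm \<rho> 1 (W o\<^sub>L X n o\<^sub>L W) \<le> pnorm \<rho> 2 (X n)"
      using admissible_sandwich(2)[OF W Lp_CauchyD(1)[OF p2 C(1)]] by blast
  qed
  then have "triple_norm M \<rho> F \<le> ennreal (Lp_norm \<rho> 2 F)"
    unfolding triple_norm_eq by (intro SUP_least ennreal_leI)
  then show ?thesis by (rule le_less_trans) simp
qed

lemma triple_norm_add:
  assumes F: "F \<in> Lp M \<rho> 2" and G: "G \<in> Lp M \<rho> 2"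
  shows "triple_norm M \<rho> (Lp_add M \<rho> 2 F G) \<le> triple_norm M \<rho> F + triple_norm M \<rho> G"
  unfolding triple_norm_eq[of "Lp_add M \<rho> 2 F G"]
proof (rule SUP_least)
  fix W assume W: "W \<in> admissible"
  obtain X where X: "X \<in> F" using F by (rule Lp_representative[OF p2])
  obtain Y where Y: "Y \<in> G" using G by (rule Lp_representative[OF p2])
  let ?t = "\<lambda>F. Lp_norm \<rho> 1 (sandwich M \<rho> W F)"
  note XY = Lp_add_class[OF p2 F X G Y]
  note LX = Lp_CauchyD(1)[OF p2 Lp_class(1)[OF p2 F X]] and LY = Lp_CauchyD(1)[OF p2 Lp_class(1)[OF p2 G Y]]
  have "?t (Lp_add M \<rho> 2 F G) \<le> ?t F + ?t G"
  proof (rule LIMSEQ_le[OF sandwich_norm_tendsto[OF W XY]])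
    show "(\<lambda>n. pnorm \<rho> 1 (W o\<^sub>L X n o\<^sub>L W) + pnorm \<rho> 1 (W o\<^sub>L Y n o\<^sub>L W)) \<longlonglongrightarrow> ?t F + ?t G"
      by (intro tendsto_add sandwich_norm_tendsto W F G X Y)
    have "pnorm \<rho> 1 ((W o\<^sub>L X n o\<^sub>L W) + (W o\<^sub>L Y n o\<^sub>L W))
        \<le> pnorm \<rho> 1 (W o\<^sub>L X n o\<^sub>L W) + pnorm \<rho> 1 (W o\<^sub>L Y n o\<^sub>L W)" for n
      by (intro Lp_bdd_add(2)[OF p1] admissible_sandwich(1)[OF W] LX LY)
    then show "\<exists>N. \<forall>n\<ge>N. pnorm \<rho> 1 (W o\<^sub>L (X n + Y n) o\<^sub>L W)
        \<le> pnorm \<rho> 1 (W o\<^sub>L X n o\<^sub>L W) + pnorm \<rho> 1 (W o\<^sub>L Y n o\<^sub>L W)"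
      by (simp add: compose_algebra)
  qed
  then have "ennreal (?t (Lp_add M \<rho> 2 F G)) \<le> ennreal (?t F) + ennreal (?t G)"
    using sandwich_norm_nonneg[OF W F] sandwich_norm_nonneg[OF W G]
    by (simp add: ennreal_plus[symmetric] ennreal_leI del: ennreal_plus)
  also have "\<dots> \<le> triple_norm M \<rho> F + triple_norm M \<rho> G"
    unfolding triple_norm_eq using W by (intro add_mono SUP_upper)
  finally show "ennreal (?t (Lp_add M \<rho> 2 F G)) \<le> triple_norm M \<rho> F + triple_norm M \<rho> G" .
qed

lemma sandwich_scale: "W o\<^sub>L scaleC_op c A o\<^sub>L W = scaleC_op c (W o\<^sub>L A o\<^sub>L W)" if "W \<in> M"
  by (rule blinfun_eqI) (simp add: scaleC_op_apply bounded_opsD[OF in_bounded_ops[OF that]])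

lemma admissible_closed: "W \<in> admissible \<Longrightarrow> W \<in> M"
  by (simp add: admissible_def L2_iff)

lemma triple_norm_scale:
  assumes F: "F \<in> Lp M \<rho> 2"
  shows "triple_norm M \<rho> (Lp_scale M \<rho> 2 c F) = ennreal (cmod c) * triple_norm M \<rho> F"
proof -
  obtain X where X: "X \<in> F" using F by (rule Lp_representative[OF p2])
  note S = Lp_scale_class[OF p2 F X, of c]
  note LX = Lp_CauchyD(1)[OF p2 Lp_class(1)[OF p2 F X]]
  have "ennreal (Lp_norm \<rho> 1 (sandwich M \<rho> W (Lp_scale M \<rho> 2 c F)))
      = ennreal (cmod c) * ennreal (Lp_norm \<rho> 1 (sandwich M \<rho> W F))" if W: "W \<in> admissible" for W
  proof -
    have "pnorm \<rho> 1 (W o\<^sub>L scaleC_op c (X n) o\<^sub>L W) = cmod c * pnorm \<rho> 1 (W o\<^sub>L X n o\<^sub>L W)" for n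
      unfolding sandwich_scale[OF admissible_closed[OF W]]
      using Lp_scaleC[OF admissible_sandwich(1)[OF W LX] p1] by blast
    then have "(\<lambda>n. pnorm \<rho> 1 (W o\<^sub>L scaleC_op c (X n) o\<^sub>L W)) \<longlonglongrightarrow> cmod c * Lp_norm \<rho> 1 (sandwich M \<rho> W F)"
      by (simp only:) (intro tendsto_mult tendsto_const sandwich_norm_tendsto W F X)
    then have "Lp_norm \<rho> 1 (sandwich M \<rho> W (Lp_scale M \<rho> 2 c F)) = cmod c * Lp_norm \<rho> 1 (sandwich M \<rho> W F)"
      using sandwich_norm_tendsto[OF W S] LIMSEQ_unique by blast
    then show ?thesis using sandwich_norm_nonneg[OF W F] by (simp add: ennreal_mult)
  qed
  then show ?thesis unfolding triple_norm_eq by (simp add: SUP_mult_left_ennreal)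
qed

lemma triple_norm_zero: "triple_norm M \<rho> (Lp_zero M \<rho> 2) = 0"
proof -
  have "Lp_norm \<rho> 1 (sandwich M \<rho> W (Lp_zero M \<rho> 2)) = 0" if W: "W \<in> admissible" for W
  proof -
    have "W o\<^sub>L 0 o\<^sub>L W = 0" by simp
    then have "(\<lambda>_::nat. 0) \<longlonglongrightarrow> Lp_norm \<rho> 1 (sandwich M \<rho> W (Lp_zero M \<rho> 2))"
      using sandwich_norm_tendsto[OF W Lp_zero_class[OF p2]] by (simp only: Lp_bdd_0(2)[OF p1])
    then show ?thesis by (simp add: LIMSEQ_const_iff)
  qed
  then show ?thesis unfolding triple_norm_eq by (intro antisym SUP_least) auto
qed

text \<open>Fix a large \<open>m\<close> and choose \<open>W\<close> with \<open>\<parallel>X\<^sub>m - W X\<^sub>m W\<parallel>\<^sub>2 \<le> d\<close>. For large \<open>n\<close> then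
  \<open>\<parallel>X\<^sub>m - W X\<^sub>n W\<parallel>\<^sub>2 \<le> 2 d\<close>, while \<open>\<parallel>W X\<^sub>n W\<parallel>\<^sub>1 \<rightarrow> 0\<close>; so \<open>rho_square_le\<close> gives \<open>\<parallel>X\<^sub>m\<parallel>\<^sub>2 \<le> 2 d\<close>. The point of
  bringing in \<open>m\<close> is that this inequality contains the operator norm of \<open>X\<^sub>m\<close>, over which there is no
  control as \<open>m\<close> varies, whereas \<open>n \<rightarrow> \<infinity>\<close> for fixed \<open>m\<close> is harmless.\<close>

lemma L2_null_sequence:
  assumes X: "X \<in> Lp_Cauchy M \<rho> 2"
    and null: "\<And>W. W \<in> admissible \<Longrightarrow> (\<lambda>n. pnorm \<rho> 1 (W o\<^sub>L X n o\<^sub>L W)) \<longlonglongrightarrow> 0"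
  shows "(\<lambda>n. pnorm \<rho> 2 (X n)) \<longlonglongrightarrow> 0"
proof (rule LIMSEQ_I)
  fix e :: real assume "0 < e"
  define d where "d = e / 3"
  have d: "0 < d" using \<open>0 < e\<close> by (simp add: d_def)
  note XL = Lp_CauchyD(1)[OF p2 X]
  have XM: "X n \<in> M" for n using XL by (simp add: L2_iff)
  obtain N where N: "\<And>m n. m \<ge> N \<Longrightarrow> n \<ge> N \<Longrightarrow> pnorm \<rho> 2 (X m - X n) < d"
    using Lp_CauchyD(2)[OF p2 X d] by blast
  have "pnorm \<rho> 2 (X m) \<le> 2 * d" if m: "m \<ge> N" for m
  proof -
    obtain W where W: "W \<in> Lp_bdd M \<rho> 2" "nonneg_op W" "norm W \<le> 1"
      and appr: "pnorm \<rho> 2 (X m - (W o\<^sub>L X m o\<^sub>L W)) \<le> d"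
      using sandwich_approximation[OF XL d] .
    have WM: "W \<in> M" using W by (simp add: L2_iff)
    \<comment> \<open>The cutoff need not satisfy \<open>\<parallel>W\<parallel>\<^sub>2 \<le> 1\<close>; a small multiple of it does and is admissible.\<close>
    define t where "t = 1 / (pnorm \<rho> 2 W + 1)"
    have t: "0 < t" "t \<le> 1" "t * pnorm \<rho> 2 W \<le> 1"
      using pnorm_nonneg[of 2 W] by (auto simp: t_def field_simps add_nonneg_pos)
    let ?V = "scaleC_op (of_real t) W"
    have V: "?V = t *\<^sub>R W" by (rule scaleC_op_of_real)
    have "norm ?V \<le> 1" using t W(3) by (simp add: V mult_le_one)
    moreover have "positive_op ?V"
      using t W WM by (auto simp: V positive_op_iff intro!: nonneg_op_intros in_bounded_ops algebra_closed)
    ultimately have adm: "?V \<in> admissible"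
      using t Lp_scaleC[OF W(1) p2, of "of_real t"] by (simp add: admissible_def)
    have tt: "?V o\<^sub>L A o\<^sub>L ?V = scaleC_op (of_real (t * t)) (W o\<^sub>L A o\<^sub>L W)" for A
      by (simp only: V scaleC_op_of_real) (simp add: compose_algebra)
    have rescale: "W o\<^sub>L A o\<^sub>L W = scaleC_op (of_real (1 / (t * t))) (?V o\<^sub>L A o\<^sub>L ?V)" for A
      unfolding tt using t by (simp only: scaleC_op_of_real) simp
    have L1: "W o\<^sub>L X n o\<^sub>L W \<in> Lp_bdd M \<rho> 1"
      and N1: "pnorm \<rho> 1 (W o\<^sub>L X n o\<^sub>L W) = 1 / (t * t) * pnorm \<rho> 1 (?V o\<^sub>L X n o\<^sub>L ?V)" for n
      unfolding rescale[of "X n"] using Lp_scaleC[OF admissible_sandwich(1)[OF adm XL[of n]] p1, of "of_real (1 / (t * t))"] t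
      by (auto simp del: of_real_divide of_real_mult)
    have lim: "(\<lambda>n. pnorm \<rho> 1 (W o\<^sub>L X n o\<^sub>L W)) \<longlonglongrightarrow> 0"
      unfolding N1 by (intro tendsto_mult_right_zero null adm)
    define c where "c = norm (X m) + 1"
    have c: "0 < c" "norm (X m) \<le> c" by (auto simp: c_def add_nonneg_pos)
    have bound: "(pnorm \<rho> 2 (X m))\<^sup>2 \<le> (2 * d)\<^sup>2 + (2 * c) * pnorm \<rho> 1 (W o\<^sub>L X n o\<^sub>L W)" if n: "n \<ge> N" for n
    proof -
      let ?A = "W o\<^sub>L X n o\<^sub>L W"
      have S: "W o\<^sub>L B o\<^sub>L W \<in> Lp_bdd M \<rho> 2 \<and> pnorm \<rho> 2 (W o\<^sub>L B o\<^sub>L W) \<le> pnorm \<rho> 2 B"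
        if "B \<in> Lp_bdd M \<rho> 2" for B
        using L2_compose_right[OF WM W(3), of "W o\<^sub>L B"] L2_compose_left[OF WM W(3) that] by (meson order_trans)
      have AL: "?A \<in> Lp_bdd M \<rho> 2" "W o\<^sub>L X m o\<^sub>L W \<in> Lp_bdd M \<rho> 2" using S XL by auto
      have "pnorm \<rho> 2 (X m - ?A) \<le> pnorm \<rho> 2 (X m - (W o\<^sub>L X m o\<^sub>L W)) + pnorm \<rho> 2 ((W o\<^sub>L X m o\<^sub>L W) - ?A)"
        using XL AL by (intro pnorm_triangle_diff[OF p2])
      also have "\<dots> \<le> d + pnorm \<rho> 2 (X m - X n)"
        unfolding compose_sandwich_diff using S[OF Lp_bdd_diff(1)[OF p2 XL XL]] appr by (intro add_mono) auto
      also have "\<dots> \<le> 2 * d" using N[OF m n] by simp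
      finally have "pnorm \<rho> 2 (X m - ?A) \<le> 2 * d" .
      then have "(pnorm \<rho> 2 (X m - ?A))\<^sup>2 \<le> (2 * d)\<^sup>2" by (intro power_mono) (auto simp: pnorm_nonneg)
      moreover have "ennreal ((pnorm \<rho> 2 (X m))\<^sup>2)
          \<le> ennreal ((pnorm \<rho> 2 (X m - ?A))\<^sup>2 + (2 * c) * pnorm \<rho> 1 ?A)"
        using rho_square_le[OF XM c(2,1), of ?A] AL c pnorm_nonneg[of 1 ?A]
        unfolding rho_square_eq[OF XL] rho_square_eq[OF Lp_bdd_diff(1)[OF p2 XL AL(1)]] rho_abs_eq[OF L1]
        by (simp add: L2_iff ennreal_mult)
      ultimately show ?thesis
        using c pnorm_nonneg[of 1 ?A] by (subst (asm) ennreal_le_iff) (auto intro: order_trans)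
    qed
    have "(pnorm \<rho> 2 (X m))\<^sup>2 \<le> (2 * d)\<^sup>2 + (2 * c) * 0"
      by (rule LIMSEQ_le_const[OF tendsto_add[OF tendsto_const tendsto_mult[OF tendsto_const lim]]])
         (use bound in blast)
    then have "(pnorm \<rho> 2 (X m))\<^sup>2 \<le> (2 * d)\<^sup>2" by simp
    then show ?thesis by (rule power2_le_imp_le) (use d in simp)
  qed
  then have "norm (pnorm \<rho> 2 (X m) - 0) < e" if "m \<ge> N" for m
    using that d pnorm_nonneg[of 2 "X m"] by (fastforce simp: d_def)
  then show "\<exists>N. \<forall>n\<ge>N. norm (pnorm \<rho> 2 (X n) - 0) < e" by blast
qed

lemma triple_norm_definite:
  assumes F: "F \<in> Lp M \<rho> 2" and z: "triple_norm M \<rho> F = 0"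
  shows "F = Lp_zero M \<rho> 2"
proof -
  obtain X where X: "X \<in> F" using F by (rule Lp_representative[OF p2])
  note C = Lp_class[OF p2 F X]
  have "(\<lambda>n. pnorm \<rho> 1 (W o\<^sub>L X n o\<^sub>L W)) \<longlonglongrightarrow> 0" if W: "W \<in> admissible" for W
  proof -
    have "ennreal (Lp_norm \<rho> 1 (sandwich M \<rho> W F)) \<le> 0"
      using z W unfolding triple_norm_eq by (metis SUP_upper)
    then have "Lp_norm \<rho> 1 (sandwich M \<rho> W F) = 0"
      using sandwich_norm_nonneg[OF W F] by simp
    then show ?thesis using sandwich_norm_tendsto[OF W F X] by simp
  qed
  then have "(\<lambda>n. pnorm \<rho> 2 (X n)) \<longlonglongrightarrow> 0" by (rule L2_null_sequence[OF C(1)])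
  then have "(X, \<lambda>_. 0) \<in> Lp_rel M \<rho> 2"
    using C(1) Lp_class(1)[OF p2 Lp_zero_class[OF p2]] by (simp add: Lp_rel_def)
  then show ?thesis
    using equiv_class_eq[OF equiv_Lp_rel[OF p2]] C(2) by (simp add: Lp_zero_def)
qed

theorem triple_norm_is_norm:
  "(\<forall>F\<in>Lp M \<rho> 2. triple_norm M \<rho> F < \<infinity>) \<and>
    is_norm_on (Lp M \<rho> 2) (Lp_add M \<rho> 2) (Lp_scale M \<rho> 2) (Lp_zero M \<rho> 2)
      (\<lambda>F. enn2real (triple_norm M \<rho> F))"
  unfolding is_norm_on_def
proof (intro conjI ballI allI)
  fix F assume F: "F \<in> Lp M \<rho> 2"
  show fin: "triple_norm M \<rho> F < \<infinity>" using F by (rule triple_norm_finite)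
  show "0 \<le> enn2real (triple_norm M \<rho> F)" by simp
  show "enn2real (triple_norm M \<rho> F) = 0 \<longleftrightarrow> F = Lp_zero M \<rho> 2"
    using fin triple_norm_definite[OF F] triple_norm_zero by (auto simp: enn2real_eq_0_iff)
  show "enn2real (triple_norm M \<rho> (Lp_scale M \<rho> 2 c F)) = cmod c * enn2real (triple_norm M \<rho> F)" for c
    by (simp add: triple_norm_scale[OF F] enn2real_mult)
  fix G assume G: "G \<in> Lp M \<rho> 2"
  have "enn2real (triple_norm M \<rho> (Lp_add M \<rho> 2 F G)) \<le> enn2real (triple_norm M \<rho> F + triple_norm M \<rho> G)"
    using triple_norm_finite[OF F] triple_norm_finite[OF G] by (intro enn2real_mono triple_norm_add F G) simp
  then show "enn2real (triple_norm M \<rho> (Lp_add M \<rho> 2 F G)) \<le> enn2real (triple_norm M \<rho> F) + enn2real (triple_norm M \<rho> G)"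
    using triple_norm_finite[OF F] triple_norm_finite[OF G] by (simp add: enn2real_plus)
qed

end

theorem lemma4p5:
  fixes M :: "('a::complex_hilbert_space \<Rightarrow>\<^sub>L 'a) set"
    and \<rho> :: "('a \<Rightarrow>\<^sub>L 'a) \<Rightarrow> ennreal"
  assumes "factor M"
    and "type_I M \<or> type_II M"
    and "is_trace M \<rho>" and "faithful M \<rho>" and "normal M \<rho>" and "semifinite M \<rho>"
  shows "(\<forall>F\<in>Lp M \<rho> 2. triple_norm M \<rho> F < \<infinity>) \<and>
    is_norm_on (Lp M \<rho> 2) (Lp_add M \<rho> 2) (Lp_scale M \<rho> 2) (Lp_zero M \<rho> 2)
      (\<lambda>F. enn2real (triple_norm M \<rho> F))"
proof -
  interpret traced_algebra M \<rho>
    using assms by unfold_locales (auto simp: factor_def)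
  show ?thesis by (rule triple_norm_is_norm)
qed

end
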